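(* For any $u<w$ in $W$ with $u\in c_0$, $w\in c_1$ and $|L(u)|=|R(u)|=1$, we have $\mu(u,w)=0$.
   Context: $W$ is the affine Weyl group of type $\widetilde A_2$: the Coxeter group on $S=\{r,s,t\}$ with $(rs)^3=(st)^3=(rt)^3=1$, with length $l$ and Bruhat order $\le$. For $u<w$, $\mu(u,w)$ is the coefficient of $q^{(l(w)-l(u)-1)/2}$ in the Kazhdan–Lusztig polynomial $P_{u,w}$. $c_1$ is the set of elements $w\neq e$ having a unique reduced expression (the two-sided cell of $\mathbf a$-value 1), and $c_0=W\setminus(\{e\}\cup c_1)$ (the two-sided cell of $\mathbf a$-value 3). $L(u)=\{\sigma\in S:\sigma u<u\}$, $R(u)=\{\sigma\in S:u\sigma<u\}$. *)

theory Defs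
  imports
    "HOL-Library.Poly_Mapping"
    "HOL-Computational_Algebra.Polynomial"
begin

datatype gen = Gen_r | Gen_s | Gen_t

inductive word_eq :: "gen list \<Rightarrow> gen list \<Rightarrow> bool" where
  word_refl: "word_eq xs xs"
| word_sym: "word_eq xs ys \<Longrightarrow> word_eq ys xs"
| word_trans: "word_eq xs ys \<Longrightarrow> word_eq ys zs \<Longrightarrow> word_eq xs zs"
| word_square: "word_eq (xs @ [a, a] @ ys) (xs @ ys)"
| word_order3: "a \<noteq> b \<Longrightarrow> word_eq (xs @ [a, b, a, b, a, b] @ ys) (xs @ ys)"

lemma word_eq_equivp: "equivp word_eq"
  by (intro equivpI reflpI sympI transpI) (blast intro: word_eq.intros)+

lemma word_eq_context: "word_eq xs ys \<Longrightarrow> word_eq (us @ xs @ vs) (us @ ys @ vs)"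
proof (induction rule: word_eq.induct)
  case (word_square xs a ys)
  then show ?case using word_eq.word_square[of "us @ xs" a "ys @ vs"] by simp
next
  case (word_order3 a b xs ys)
  then show ?case using word_eq.word_order3[of a b "us @ xs" "ys @ vs"] by simp
qed (blast intro: word_eq.intros)+

lemma word_eq_append:
  assumes "word_eq xs xs'" "word_eq ys ys'"
  shows "word_eq (xs @ ys) (xs' @ ys')"
  using word_eq_context[OF assms(1), of "[]" ys] word_eq_context[OF assms(2), of xs' "[]"]
  by (auto intro: word_trans)

lemma word_eq_rev: "word_eq xs ys \<Longrightarrow> word_eq (rev xs) (rev ys)"
proof (induction rule: word_eq.induct)
  case (word_square xs a ys)
  then show ?case using word_eq.word_square[of "rev ys" a "rev xs"] by simp
next
  case (word_order3 a b xs ys)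
  then show ?case using word_eq.word_order3[of b a "rev ys" "rev xs"] by simp
qed (blast intro: word_eq.intros)+

lemma word_eq_rev_append: "word_eq (rev xs @ xs) []"
proof (induction xs)
  case (Cons a xs)
  then show ?case using word_square[of "rev xs" a xs] by (auto intro: word_trans)
qed (simp add: word_refl)

quotient_type affW = "gen list" / word_eq
  by (rule word_eq_equivp)

instantiation affW :: "{monoid_mult, inverse}"
begin

lift_definition one_affW :: affW is "[]" .

lift_definition times_affW :: "affW \<Rightarrow> affW \<Rightarrow> affW" is "(@)"
  by (rule word_eq_append)

lift_definition inverse_affW :: "affW \<Rightarrow> affW" is rev
  by (rule word_eq_rev)

definition divide_affW :: "affW \<Rightarrow> affW \<Rightarrow> affW" where
  "divide_affW x y = x * inverse y"

instance
  by standard (transfer, simp add: word_refl)+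

end

lemma affW_left_inverse: "inverse x * x = (1 :: affW)"
  by transfer (rule word_eq_rev_append)

lift_definition simple :: "gen \<Rightarrow> affW" is "\<lambda>a. [a]" .

definition word_val :: "gen list \<Rightarrow> affW" where
  "word_val xs = prod_list (map simple xs)"

definition len :: "affW \<Rightarrow> nat" where
  "len w = (LEAST n. \<exists>xs. word_val xs = w \<and> length xs = n)"

definition reduced_expr :: "affW \<Rightarrow> gen list \<Rightarrow> bool" where
  "reduced_expr w xs \<longleftrightarrow> word_val xs = w \<and> length xs = len w"

lemma word_val_surj: "\<exists>xs. word_val xs = w"
proof -
  have "word_val xs = abs_affW xs" for xs
    by (induction xs)
      (simp_all add: word_val_def one_affW_def times_affW.abs_eq simple.abs_eq)
  then show ?thesis by (metis Quotient3_abs_rep[OF Quotient3_affW])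
qed

lemma reduced_expr_exists: "\<exists>xs. reduced_expr w xs"
  unfolding reduced_expr_def len_def
  using word_val_surj[of w] LeastI_ex[of "\<lambda>n. \<exists>xs. word_val xs = w \<and> length xs = n"]
  by blast

definition reflections :: "affW set" where
  "reflections = {x * simple a * inverse x | x a. True}"

definition bruhat_step :: "affW \<Rightarrow> affW \<Rightarrow> bool" where
  "bruhat_step u w \<longleftrightarrow> (\<exists>\<rho>\<in>reflections. w = u * \<rho>) \<and> len u < len w"

lemma bruhat_step_rtranclp_len: "bruhat_step\<^sup>*\<^sup>* u w \<Longrightarrow> u = w \<or> len u < len w"
  by (induction rule: rtranclp_induct) (auto simp: bruhat_step_def)

instantiation affW :: order
begin

definition less_eq_affW :: "affW \<Rightarrow> affW \<Rightarrow> bool" where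
  "less_eq_affW = bruhat_step\<^sup>*\<^sup>*"

definition less_affW :: "affW \<Rightarrow> affW \<Rightarrow> bool" where
  "less_affW u w \<longleftrightarrow> u \<le> w \<and> u \<noteq> w"

instance
proof
  fix x y z :: affW
  show antisym: "x = y" if "x \<le> y" "y \<le> x"
    using that bruhat_step_rtranclp_len[of x y] bruhat_step_rtranclp_len[of y x]
    by (auto simp: less_eq_affW_def)
  show "x < y \<longleftrightarrow> x \<le> y \<and> \<not> y \<le> x"
    using bruhat_step_rtranclp_len[of x y] bruhat_step_rtranclp_len[of y x]
    by (auto simp: less_eq_affW_def less_affW_def)
  show "x \<le> x" by (simp add: less_eq_affW_def)
  show "x \<le> z" if "x \<le> y" "y \<le> z"
    using that by (simp add: less_eq_affW_def)
qed

end

definition left_descents :: "affW \<Rightarrow> gen set" where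
  "left_descents u = {a. simple a * u < u}"

definition right_descents :: "affW \<Rightarrow> gen set" where
  "right_descents u = {a. u * simple a < u}"

definition cell1 :: "affW set" where
  "cell1 = {w. w \<noteq> 1 \<and> (\<exists>!xs. reduced_expr w xs)}"

definition cell0 :: "affW set" where
  "cell0 = UNIV - ({1} \<union> cell1)"

text \<open>
  Laurent polynomials in \<open>q\<^bsup>1/2\<^esup>\<close> over the integers are finitely supported functions
  on the exponents with the convolution product; the exponent \<open>k\<close> stands for
  \<open>q\<^bsup>k/2\<^esup>\<close>. The Hecke algebra is the free module over them on the basis \<open>T\<^sub>w\<close>.
\<close>

type_synonym laurent = "int \<Rightarrow>\<^sub>0 int"
type_synonym hecke = "affW \<Rightarrow>\<^sub>0 laurent"

definition qhalf_pow :: "int \<Rightarrow> laurent" where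
  "qhalf_pow k = Poly_Mapping.single k 1"

definition q :: laurent where
  "q = qhalf_pow 2"

definition laurent_bar :: "laurent \<Rightarrow> laurent" where
  "laurent_bar f = (\<Sum>k\<in>Poly_Mapping.keys f.
     Poly_Mapping.single (- k) (Poly_Mapping.lookup f k))"

definition hscale :: "laurent \<Rightarrow> hecke \<Rightarrow> hecke" where
  "hscale c h = Poly_Mapping.map (\<lambda>x. c * x) h"

definition T :: "affW \<Rightarrow> hecke" where
  "T w = Poly_Mapping.single w 1"

definition lin_ext :: "(affW \<Rightarrow> hecke) \<Rightarrow> hecke \<Rightarrow> hecke" where
  "lin_ext f h = (\<Sum>w\<in>Poly_Mapping.keys h. hscale (Poly_Mapping.lookup h w) (f w))"

definition T_simple_mult :: "gen \<Rightarrow> hecke \<Rightarrow> hecke" where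
  "T_simple_mult a = lin_ext (\<lambda>w.
     if w < simple a * w then T (simple a * w)
     else hscale (q - 1) (T w) + hscale q (T (simple a * w)))"

text \<open>
  The product is forced by \<open>T\<^sub>w = T\<^sub>a \<dots> T\<^sub>b\<close> for any reduced expression \<open>a \<dots> b\<close> of \<open>w\<close>; by
  associativity of the Hecke algebra it does not depend on the reduced expression chosen.
\<close>

definition hecke_mult :: "hecke \<Rightarrow> hecke \<Rightarrow> hecke" where
  "hecke_mult g h = lin_ext (\<lambda>w. foldr T_simple_mult (SOME xs. reduced_expr w xs) h) g"

definition hecke_inverse :: "hecke \<Rightarrow> hecke" where
  "hecke_inverse h = (THE g. hecke_mult g h = T 1 \<and> hecke_mult h g = T 1)"

definition hecke_bar :: "hecke \<Rightarrow> hecke" where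
  "hecke_bar h = (\<Sum>w\<in>Poly_Mapping.keys h.
     hscale (laurent_bar (Poly_Mapping.lookup h w)) (hecke_inverse (T (inverse w))))"

definition poly_at_q :: "int poly \<Rightarrow> laurent" where
  "poly_at_q p = poly (map_poly of_int p) q"

text \<open>
  \<open>KL_family w p\<close> says that \<open>C = q\<^bsup>-l(w)/2\<^esup> \<Sum>\<^bsub>y \<le> w\<^esub> p\<^sub>y T\<^sub>y\<close> is bar-invariant, \<open>p\<^sub>w = 1\<close>, and
  \<open>p\<^sub>y\<close> has degree at most \<open>(l(w) - l(y) - 1)/2\<close> for \<open>y < w\<close>. Kazhdan and Lusztig's theorem
  is that for each \<open>w\<close> there is exactly one such family.
\<close>

definition KL_family :: "affW \<Rightarrow> (affW \<Rightarrow> int poly) \<Rightarrow> bool" where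
  "KL_family w p \<longleftrightarrow>
     p w = 1 \<and>
     (\<forall>y. \<not> y \<le> w \<longrightarrow> p y = 0) \<and>
     (\<forall>y<w. real (degree (p y)) \<le> (real (len w) - real (len y) - 1) / 2) \<and>
     (\<exists>C :: hecke.
        (\<forall>y. Poly_Mapping.lookup C y = qhalf_pow (- int (len w)) * poly_at_q (p y)) \<and>
        hecke_bar C = C)"

definition KL_poly :: "affW \<Rightarrow> affW \<Rightarrow> int poly" where
  "KL_poly u w = (THE p. KL_family w p) u"

text \<open>
  There is no term \<open>q\<^bsup>(l(w) - l(u) - 1)/2\<^esup>\<close> in a polynomial in \<open>q\<close> when the exponent is not an
  integer, so the coefficient is then 0. Only meaningful for \<open>u < w\<close>.
\<close>

definition KL_mu :: "affW \<Rightarrow> affW \<Rightarrow> int" where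
  "KL_mu u w =
     (if odd (len w - len u) then coeff (KL_poly u w) ((len w - len u - 1) div 2) else 0)"

end

theory Submission
  imports Defs
begin

text \<open>
  The elements of \<open>c\<^sub>1\<close> are the cyclic words \<open>w\<^sub>n = s\<^sub>1 \<dots> s\<^sub>n\<close>, where any three consecutive letters
  are distinct. If \<open>u \<in> c\<^sub>0\<close> has the single right descent \<open>s\<^sub>n\<close>, then \<open>u = z s\<^sub>n\<close> where \<open>z\<close> has the
  two other generators as right descents, and a star operation gives \<open>\<mu>(u, w\<^sub>n) = \<mu>(z, w\<^sub>n\<^sub>-\<^sub>1)\<close>.
  Applying the braid relation to \<open>C\<^sub>w\<close> for \<open>w = w\<^sub>n\<close> and comparing coefficients in the
  Kazhdan-Lusztig basis yields a recurrence in \<open>n\<close> for the elements \<open>z\<close> with right descents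
  \<open>s\<^sub>n\<close> and \<open>s\<^sub>n\<^sub>-\<^sub>1\<close> that are joined to \<open>w\<^sub>n\<close> in the W-graph. Its solution contains at most one
  such \<open>z < w\<^sub>n\<close>, namely \<open>s\<^sub>1 s\<^sub>3 s\<^sub>4 \<dots> s\<^sub>n\<close> for even \<open>n\<close>, and this one has two left descents.
\<close>

subsection \<open>Group structure and words\<close>

text \<open>The braid relation at a cyclic word also involves the star partners
  \<open>tau s k\<close> of the neighbours with two descents, so the neighbours of
  \<open>tau s k\<close> must be known before the recurrence can be solved. They are found
  independently of it: a star operation shows that each is one generator away from
  \<open>tau s k\<close>, or two generators away from \<open>zeta s k\<close>, or a coatom of
  \<open>tau s k\<close>. Coatoms are listed by deleting one letter from a reduced word, and on them
  \<mu> is a constant term, so no Kazhdan-Lusztig polynomial of higher degree is ever computed. Star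
  operations preserve only the sum of the two one-sided coefficients, which is why the argument runs
  on the symmetric \<open>mu\<close>. The definitions build the Hecke product from left
  multiplication by generators and from chosen reduced words. Right multiplication operators that
  commute with the left ones take the place of associativity, make those choices immaterial, and
  lead to existence and uniqueness of the Kazhdan-Lusztig basis.\<close>

lemma word_val_eq_abs: "word_val xs = abs_affW xs"
  by (induction xs)
    (simp_all add: word_val_def one_affW_def times_affW.abs_eq simple.abs_eq)

lemma word_val_eq_iff: "word_val xs = word_val ys \<longleftrightarrow> word_eq xs ys"
  by (simp add: word_val_eq_abs affW.abs_eq_iff)

lemma word_val_simps [simp]:
  "word_val [] = 1"
  "word_val (a # xs) = simple a * word_val xs"
  "word_val (xs @ ys) = word_val xs * word_val ys"
  by (simp_all add: word_val_def)

lemma inverse_inverse_affW [simp]: "inverse (inverse x) = (x :: affW)"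
  by transfer (simp add: word_refl)

lemma inverse_mult_affW [simp]: "inverse (x * y) = inverse y * inverse (x :: affW)"
  by transfer (simp add: word_refl)

lemma inverse_one_affW [simp]: "inverse 1 = (1 :: affW)"
  by transfer (simp add: word_refl)

lemma inverse_simple [simp]: "inverse (simple a) = simple a"
  by transfer (simp add: word_refl)

lemma affW_right_inverse: "x * inverse x = (1 :: affW)"
  using affW_left_inverse[of "inverse x"] by simp

lemma affW_cancel [simp]:
  "inverse x * (x * y) = y" "x * (inverse x * y) = (y :: affW)"
  by (simp_all add: mult.assoc[symmetric] affW_left_inverse affW_right_inverse)

lemma affW_inv_simps [simp]: "inverse x * x = (1 :: affW)" "x * inverse x = 1"
  by (simp_all add: affW_left_inverse affW_right_inverse)

lemma affW_mult_left_cancel [simp]: "x * y = x * z \<longleftrightarrow> y = (z :: affW)"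
  by (metis affW_cancel(1))

lemma affW_mult_right_cancel [simp]: "y * x = z * x \<longleftrightarrow> y = (z :: affW)"
  by (metis affW_right_inverse mult.assoc mult.right_neutral)

lemma conj_eq_iff: "x = inverse y * z * y \<longleftrightarrow> y * x * inverse y = (z :: affW)"
  by (auto simp: mult.assoc)

lemma simple_square [simp]: "simple a * simple a = 1" "x * simple a * simple a = x"
  "simple a * (simple a * x) = x"
proof -
  show "simple a * simple a = 1"
    using affW_left_inverse[of "simple a"] by simp
  then show "x * simple a * simple a = x" "simple a * (simple a * x) = x"
    by (metis mult.assoc mult.right_neutral) (metis \<open>simple a * simple a = 1\<close> mult.assoc mult.left_neutral)
qed

lemma mult_simple_eq_iff: "x * simple a = y \<longleftrightarrow> x = y * simple a"
  by auto

lemma simple_order3: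
  assumes "a \<noteq> b"
  shows "simple a * simple b * simple a * simple b * simple a * simple b = 1"
proof -
  have "word_val [a, b, a, b, a, b] = word_val []"
    using word_order3[OF assms, of "[]" "[]"] by (simp only: word_val_eq_iff append_Nil append_Nil2)
  then show ?thesis by (simp add: mult.assoc)
qed

lemma braid:
  assumes "a \<noteq> b"
  shows "simple a * simple b * simple a = simple b * simple a * simple b"
  by (metis assms mult.left_neutral simple_order3 simple_square(2))

lemma braid_right:
  assumes "a \<noteq> b"
  shows "x * simple a * simple b * simple a = x * simple b * simple a * simple b"
  using braid[OF assms] by (simp add: mult.assoc)

subsection \<open>Strong exchange\<close>

text \<open>The parity of the number of positions at which a letter of the word can be deleted to
  multiply its value by \<open>\<rho>\<close> on the right; it depends only on the value of the word.\<close>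

fun del_parity :: "gen list \<Rightarrow> affW \<Rightarrow> bool" where
  "del_parity [] \<rho> = False"
| "del_parity (a # xs) \<rho> =
     (del_parity xs \<rho> \<noteq> (\<rho> = inverse (word_val xs) * simple a * word_val xs))"

text \<open>The cocycle rule: a deletion in \<open>xs\<close> is seen through \<open>ys\<close> as a
  conjugated reflection.\<close>

lemma del_parity_append:
  "del_parity (xs @ ys) \<rho> =
     (del_parity ys \<rho> \<noteq> del_parity xs (word_val ys * \<rho> * inverse (word_val ys)))"
proof (induction xs)
  case (Cons a xs)
  have "(\<rho> = inverse (word_val ys) * (inverse (word_val xs) * simple a * word_val xs) * word_val ys)
    = (word_val ys * \<rho> * inverse (word_val ys) = inverse (word_val xs) * simple a * word_val xs)"
    by (rule conj_eq_iff)
  then show ?case using Cons by (auto simp: mult.assoc)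
qed simp

text \<open>Both deletions in \<open>[a, a]\<close> give the same reflection, and the six deletions
  in \<open>[a, b, a, b, a, b]\<close> give each of the three reflections of the dihedral group
  twice, up to conjugation by \<open>ys\<close>; modulo two nothing remains.\<close>

lemma del_parity_cong: "word_eq xs ys \<Longrightarrow> del_parity xs = del_parity ys"
proof (induction rule: word_eq.induct)
  case (word_square xs a ys)
  have v: "word_val ([a, a] @ ys) = word_val ys" by simp
  have "del_parity ([a, a] @ ys) = del_parity ys" by (rule ext) (simp add: mult.assoc, argo)
  then show ?case unfolding fun_eq_iff del_parity_append[of xs] v by simp
next
  case (word_order3 a b xs ys)
  define w where "w = word_val ys"
  have v: "word_val ([a, b, a, b, a, b] @ ys) = word_val ys"
    using simple_order3[OF word_order3] by (simp add: mult.assoc flip: mult.assoc)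
  have "simple a * (simple b * (simple a * x)) = simple b * (simple a * (simple b * x))" for x
    using braid[OF word_order3] by (metis mult.assoc)
  then have "del_parity ([a, b, a, b, a, b] @ ys) = del_parity ys"
    by (intro ext) (simp add: mult.assoc flip: w_def, argo)
  then show ?case unfolding fun_eq_iff del_parity_append[of xs] v by simp
qed auto

text \<open>The parity as a function of the group element. For a reflection \<rho> it says that
  \<rho> is a right inversion of \<open>w\<close>; see \<open>len_mult_refl_iff\<close>.\<close>

definition inv_refl :: "affW \<Rightarrow> affW \<Rightarrow> bool" where
  "inv_refl w \<rho> = del_parity (SOME xs. word_val xs = w) \<rho>"

lemma inv_refl_word: "inv_refl (word_val xs) = del_parity xs"
proof -
  have "word_val (SOME ys. word_val ys = word_val xs) = word_val xs"
    by (rule someI) simp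
  then show ?thesis
    unfolding inv_refl_def using del_parity_cong by (metis word_val_eq_iff)
qed

lemma inv_refl_mult: "inv_refl (x * y) \<rho> = (inv_refl y \<rho> \<noteq> inv_refl x (y * \<rho> * inverse y))"
proof -
  obtain xs ys where "x = word_val xs" "y = word_val ys" using word_val_surj by metis
  then show ?thesis
    using del_parity_append[of xs ys \<rho>] inv_refl_word[of "xs @ ys"] by (simp add: inv_refl_word)
qed

lemma inv_refl_one [simp]: "\<not> inv_refl 1 \<rho>"
  using inv_refl_word[of "[]"] by simp

lemma inv_refl_simple: "inv_refl (simple a) \<rho> \<longleftrightarrow> \<rho> = simple a"
  using inv_refl_word[of "[a]"] by simp

text \<open>Along \<open>x * simple a * inverse x\<close> the contributions of \<open>x\<close> and
  \<open>inverse x\<close> cancel modulo two, which leaves the one of the middle letter.\<close>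

lemma inv_refl_self:
  assumes "\<rho> \<in> reflections" shows "inv_refl \<rho> \<rho>"
proof -
  obtain x a where r: "\<rho> = x * simple a * inverse x" using assms by (auto simp: reflections_def)
  have "inv_refl (x * inverse x) \<rho> = (inv_refl (inverse x) \<rho> \<noteq> inv_refl x (simple a))"
    by (subst inv_refl_mult) (simp add: r mult.assoc)
  then have eq: "inv_refl (inverse x) \<rho> = inv_refl x (simple a)" by simp
  have "inv_refl (x * (simple a * inverse x)) \<rho> =
      (inv_refl (simple a * inverse x) \<rho> \<noteq> inv_refl x (simple a))"
    by (subst inv_refl_mult) (simp add: r mult.assoc)
  also have "inv_refl (simple a * inverse x) \<rho> = (inv_refl (inverse x) \<rho> \<noteq> inv_refl (simple a) (simple a))"
    by (subst inv_refl_mult) (simp add: r mult.assoc)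
  finally show ?thesis using eq by (simp add: inv_refl_simple r mult.assoc)
qed

lemma reflection_square: "\<rho> \<in> reflections \<Longrightarrow> \<rho> * \<rho> = 1"
  by (auto simp: reflections_def mult.assoc)

lemma simple_in_reflections [simp]: "simple a \<in> reflections"
  unfolding reflections_def by (auto intro!: exI[of _ 1] exI[of _ a])

lemma len_word_le: "len (word_val xs) \<le> length xs"
  unfolding len_def by (rule Least_le) blast

lemma reduced_word_obtain: obtains xs where "word_val xs = w" "length xs = len w"
  using reduced_expr_exists[of w] by (auto simp: reduced_expr_def)

lemma len_one [simp]: "len 1 = 0"
  using len_word_le[of "[]"] by simp

lemma len_zero_iff [simp]: "len w = 0 \<longleftrightarrow> w = 1"
  by (metis len_one length_0_conv reduced_word_obtain word_val_simps(1))

lemma del_parity_deletion: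
  "del_parity xs \<rho> \<Longrightarrow> \<exists>us a vs. xs = us @ a # vs \<and> word_val xs * \<rho> = word_val (us @ vs)"
proof (induction xs)
  case (Cons b xs)
  show ?case
  proof (cases "\<rho> = inverse (word_val xs) * simple b * word_val xs")
    case True
    then have "word_val (b # xs) * \<rho> = word_val ([] @ xs)" by (simp add: mult.assoc)
    then show ?thesis by blast
  next
    case False
    then obtain us a vs where "xs = us @ a # vs" "word_val xs * \<rho> = word_val (us @ vs)"
      using Cons by auto
    then have "b # xs = (b # us) @ a # vs" "word_val (b # xs) * \<rho> = word_val ((b # us) @ vs)"
      by (simp_all add: mult.assoc)
    then show ?thesis by blast
  qed
qed simp

lemma len_mult_inv_refl: "inv_refl w \<rho> \<Longrightarrow> len (w * \<rho>) < len w"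
proof -
  assume *: "inv_refl w \<rho>"
  obtain xs where xs: "word_val xs = w" "length xs = len w" using reduced_word_obtain .
  then have "del_parity xs \<rho>" using * inv_refl_word by metis
  then obtain us a vs where "xs = us @ a # vs" "w * \<rho> = word_val (us @ vs)"
    using del_parity_deletion xs by metis
  then show ?thesis using len_word_le[of "us @ vs"] xs by simp
qed

text \<open>If \<open>w\<close> does not invert \<rho>, the cocycle rule and
  \<open>inv_refl_self\<close> make \<open>w * \<rho>\<close> invert it, and multiplying back by
  \<rho> shortens.\<close>

lemma len_mult_refl_iff:
  assumes "\<rho> \<in> reflections"
  shows "len (w * \<rho>) < len w \<longleftrightarrow> inv_refl w \<rho>"
proof
  assume *: "len (w * \<rho>) < len w"
  show "inv_refl w \<rho>"
  proof (rule ccontr)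
    assume "\<not> inv_refl w \<rho>"
    then have "inv_refl (w * \<rho>) \<rho>"
      using inv_refl_self[OF assms] reflection_square[OF assms]
      by (subst inv_refl_mult) (metis affW_right_inverse mult.assoc mult.right_neutral)
    from len_mult_inv_refl[OF this] have "len w < len (w * \<rho>)"
      using reflection_square[OF assms] by (simp add: mult.assoc)
    then show False using * by simp
  qed
qed (rule len_mult_inv_refl)

lemma strong_exchange:
  assumes "\<rho> \<in> reflections" "len (word_val xs * \<rho>) < len (word_val xs)"
  obtains us a vs where "xs = us @ a # vs" "word_val xs * \<rho> = word_val (us @ vs)"
  using assms len_mult_refl_iff inv_refl_word del_parity_deletion by metis

text \<open>One of \<open>w\<close> and \<open>w * \<rho>\<close> inverts \<rho>; this stands in for
  the sign character.\<close>

lemma len_mult_refl_neq: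
  assumes "\<rho> \<in> reflections"
  shows "len (w * \<rho>) \<noteq> len w"
proof
  assume eq: "len (w * \<rho>) = len w"
  then have "\<not> inv_refl w \<rho>" using len_mult_refl_iff[OF assms, of w] by simp
  then have "inv_refl (w * \<rho>) \<rho>"
    using inv_refl_self[OF assms] reflection_square[OF assms]
    by (subst inv_refl_mult) (metis affW_right_inverse mult.assoc mult.right_neutral)
  from len_mult_inv_refl[OF this] eq reflection_square[OF assms] show False
    by (simp add: mult.assoc)
qed

lemma len_mult_simple_le: "len (w * simple a) \<le> Suc (len w)"
proof -
  obtain xs where xs: "word_val xs = w" "length xs = len w" using reduced_word_obtain .
  then show ?thesis using len_word_le[of "xs @ [a]"] by simp
qed

lemma len_mult_simple_cases:
  obtains "len (w * simple a) = Suc (len w)" | "len w = Suc (len (w * simple a))"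
proof -
  have "len (w * simple a) \<noteq> len w" by (rule len_mult_refl_neq) simp
  moreover have "len w \<le> Suc (len (w * simple a))"
    using len_mult_simple_le[of "w * simple a" a] by simp
  ultimately show ?thesis using len_mult_simple_le[of w a] that by linarith
qed

lemma len_inverse [simp]: "len (inverse w) = len w"
proof -
  have inv: "inverse (word_val xs) = word_val (rev xs)" for xs by (induction xs) simp_all
  have "len (inverse w) \<le> len w" for w
  proof -
    obtain xs where "word_val xs = w" "length xs = len w" using reduced_word_obtain .
    then show ?thesis using len_word_le[of "rev xs"] inv[of xs] by auto
  qed
  from this[of w] this[of "inverse w"] show ?thesis by simp
qed

lemma len_simple_mult: "len (simple a * w) = len (inverse w * simple a)"
  using len_inverse[of "simple a * w"] by simp

lemma len_simple_mult_cases: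
  obtains "len (simple a * w) = Suc (len w)" | "len w = Suc (len (simple a * w))"
  using len_mult_simple_cases[of "inverse w" a] unfolding len_simple_mult by fastforce

subsection \<open>Descents and the Bruhat order\<close>

definition desc :: "affW \<Rightarrow> gen \<Rightarrow> bool" where
  "desc w a \<longleftrightarrow> len (w * simple a) < len w"

lemma less_affW_len: "u < w \<Longrightarrow> len u < len (w :: affW)"
  using bruhat_step_rtranclp_len[of u w] by (auto simp: less_affW_def less_eq_affW_def)

lemma le_affW_len: "u \<le> w \<Longrightarrow> u = w \<or> len u < len (w :: affW)"
  using bruhat_step_rtranclp_len[of u w] by (auto simp: less_eq_affW_def)

lemma less_mult_refl_iff:
  assumes "\<rho> \<in> reflections" shows "u < u * \<rho> \<longleftrightarrow> len u < len (u * \<rho>)"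
proof
  assume "len u < len (u * \<rho>)"
  then have "bruhat_step u (u * \<rho>)" using assms by (auto simp: bruhat_step_def)
  then show "u < u * \<rho>" using \<open>len u < _\<close> by (auto simp: less_affW_def less_eq_affW_def)
qed (rule less_affW_len)

lemma mult_simple_less_iff: "w * simple a < w \<longleftrightarrow> desc w a"
  using less_mult_refl_iff[of "simple a" "w * simple a"] by (simp add: desc_def)

lemma less_mult_simple_iff: "w < w * simple a \<longleftrightarrow> \<not> desc w a"
  using less_mult_refl_iff[of "simple a" w] len_mult_simple_cases[of w a] by (fastforce simp: desc_def)

lemma less_simple_mult_iff: "w < simple a * w \<longleftrightarrow> len w < len (simple a * w)"
proof -
  have "inverse w * simple a * w \<in> reflections"
    unfolding reflections_def by (auto intro!: exI[of _ "inverse w"])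
  moreover have "w * (inverse w * simple a * w) = simple a * w" by (simp add: mult.assoc)
  ultimately show ?thesis using less_mult_refl_iff by metis
qed

lemma simple_mult_less_iff: "simple a * w < w \<longleftrightarrow> len (simple a * w) < len w"
  using less_simple_mult_iff[of "simple a * w" a] by simp

lemma right_descents_eq: "right_descents w = {a. desc w a}"
  by (simp add: right_descents_def mult_simple_less_iff)

lemma len_desc: "desc w a \<Longrightarrow> len w = Suc (len (w * simple a))"
  using len_mult_simple_cases[of w a] by (fastforce simp: desc_def)

lemma len_not_desc: "\<not> desc w a \<Longrightarrow> len (w * simple a) = Suc (len w)"
  using len_mult_simple_cases[of w a] by (fastforce simp: desc_def)

lemma desc_mult_self [simp]: "desc (w * simple a) a \<longleftrightarrow> \<not> desc w a"
  using len_mult_simple_cases[of w a] by (fastforce simp: desc_def)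

lemma desc_one [simp]: "\<not> desc 1 a"
  by (simp add: desc_def)

lemma exchange:
  assumes "desc (word_val xs) a"
  obtains us b vs where "xs = us @ b # vs" "word_val xs * simple a = word_val (us @ vs)"
  using strong_exchange[of "simple a" xs] assms by (auto simp: desc_def)

lemma exists_desc: "w \<noteq> 1 \<Longrightarrow> \<exists>a. desc w a"
proof -
  assume "w \<noteq> 1"
  obtain xs where xs: "word_val xs = w" "length xs = len w" using reduced_word_obtain .
  have "xs \<noteq> []" using xs \<open>w \<noteq> 1\<close> by auto
  then obtain ys a where "xs = ys @ [a]" by (meson rev_exhaust)
  then have "len (w * simple a) < len w" using xs len_word_le[of ys] by auto
  then show ?thesis by (auto simp: desc_def)
qed

lemma affW_len_induct [case_names one mult]:
  assumes "P 1" "\<And>x a. P x \<Longrightarrow> \<not> desc x a \<Longrightarrow> P (x * simple a)"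
  shows "P x"
proof (induction "len x" arbitrary: x rule: less_induct)
  case less
  show ?case
  proof (cases "x = 1")
    case False
    then obtain a where a: "desc x a" using exists_desc by blast
    then have "P (x * simple a)" using less by (simp add: desc_def)
    then show ?thesis using assms(2)[of "x * simple a" a] a by simp
  qed (use assms in simp)
qed

text \<open>Conjugating \<rho> by \<open>s\<close> relates the two products. If their lengths come
  in the wrong order, strong exchange deletes a letter of \<open>ys @ [s]\<close>: the last letter
  gives \<open>y * simple s = w\<close>, any other makes \<open>w\<close> shorter than
  \<open>y\<close>.\<close>

lemma bruhat_step_mult_simple:
  assumes "bruhat_step y w"
  shows "y * simple s \<le> w * simple s \<or> y * simple s = w"
proof -
  obtain \<rho> where r: "\<rho> \<in> reflections" "w = y * \<rho>" and l: "len y < len w"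
    using assms by (auto simp: bruhat_step_def)
  have conj: "simple s * \<rho> * simple s \<in> reflections"
  proof -
    obtain x a where "\<rho> = x * simple a * inverse x" using r by (auto simp: reflections_def)
    then have "simple s * \<rho> * simple s = (simple s * x) * simple a * inverse (simple s * x)"
      by (simp add: mult.assoc)
    then show ?thesis unfolding reflections_def by blast
  qed
  have eq: "w * simple s = y * simple s * (simple s * \<rho> * simple s)"
    using r by (simp add: mult.assoc)
  show ?thesis
  proof (cases "len (y * simple s) < len (w * simple s)")
    case True
    then show ?thesis using less_mult_refl_iff[OF conj, of "y * simple s"] eq by auto
  next
    case False
    then have lt: "len (w * simple s) < len (y * simple s)"
      using len_mult_refl_neq[OF conj, of "y * simple s"] eq by fastforce
    obtain ys where ys: "word_val ys = y" "length ys = len y" using reduced_word_obtain .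
    have "len (word_val (ys @ [s]) * (simple s * \<rho> * simple s)) < len (word_val (ys @ [s]))"
      using lt ys eq by simp
    then obtain us a vs where u: "ys @ [s] = us @ a # vs"
      "word_val (ys @ [s]) * (simple s * \<rho> * simple s) = word_val (us @ vs)"
      using strong_exchange[OF conj] by blast
    have "word_val (ys @ [s]) = y * simple s" using ys by simp
    then have w: "w * simple s = word_val (us @ vs)" using u(2) eq by simp
    show ?thesis
    proof (cases vs rule: rev_cases)
      case Nil
      then have "w * simple s = y" using u w ys by auto
      then show ?thesis by auto
    next
      case (snoc vs' b)
      then have "w * simple s = word_val (us @ vs') * simple s" and yy: "ys = us @ a # vs'"
        using u w by (auto simp: mult.assoc)
      then have "w = word_val (us @ vs')" by simp
      then have "len w \<le> length (us @ vs')" using len_word_le by metis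
      also have "\<dots> < len y" using ys(2) yy by simp
      finally show ?thesis using l by simp
    qed
  qed
qed

lemma bruhat_mult_simple:
  assumes "y \<le> w"
  shows "y * simple s \<le> w \<or> y * simple s \<le> w * simple s"
proof -
  have "bruhat_step\<^sup>*\<^sup>* y w" using assms by (simp add: less_eq_affW_def)
  then show ?thesis
  proof (induction rule: converse_rtranclp_induct)
    case (step y z)
    have "z \<le> w" using step by (simp add: less_eq_affW_def)
    then show ?case using bruhat_step_mult_simple[OF step(1), of s] step(3) by (metis order_trans)
  qed simp
qed

lemma bruhat_mult_simple_up:
  assumes "y \<le> w" "\<not> desc w s"
  shows "y \<le> w * simple s" "y * simple s \<le> w * simple s"
  using bruhat_mult_simple[OF assms(1), of s] assms less_mult_simple_iff[of w s]
  by (meson less_imp_le order_trans)+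

text \<open>A Bruhat chain that rises by length one is a single step, so strong exchange applies
  directly and the full subword criterion is avoided.\<close>

lemma coatom_deletion:
  assumes "x < word_val xs" "Suc (len x) = len (word_val xs)"
  obtains us a vs where "xs = us @ a # vs" "x = word_val (us @ vs)"
proof -
  let ?w = "word_val xs"
  have "bruhat_step\<^sup>*\<^sup>* x ?w" "x \<noteq> ?w" using assms by (auto simp: less_affW_def less_eq_affW_def)
  then obtain z where z: "bruhat_step x z" "bruhat_step\<^sup>*\<^sup>* z ?w"
    by (auto elim: converse_rtranclpE)
  then have "z = ?w" using bruhat_step_rtranclp_len[OF z(2)] assms(2) by (auto simp: bruhat_step_def)
  then obtain \<rho> where r: "\<rho> \<in> reflections" "?w = x * \<rho>" "len x < len ?w"
    using z(1) by (auto simp: bruhat_step_def)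
  then have "?w * \<rho> = x" using reflection_square[OF r(1)] by (simp add: mult.assoc)
  then show ?thesis using strong_exchange[OF r(1), of xs] r(3) that by metis
qed

subsection \<open>Rank two cosets\<close>

text \<open>An action of the group on the three generators, through a quotient isomorphic to the
  symmetric group: a generator transposes the other two. It serves to tell the generators apart in
  the quotient type.\<close>

fun swap_others :: "gen \<Rightarrow> gen \<Rightarrow> gen" where
  "swap_others Gen_r Gen_s = Gen_t" | "swap_others Gen_r Gen_t = Gen_s"
| "swap_others Gen_s Gen_r = Gen_t" | "swap_others Gen_s Gen_t = Gen_r"
| "swap_others Gen_t Gen_r = Gen_s" | "swap_others Gen_t Gen_s = Gen_r"
| "swap_others Gen_r Gen_r = Gen_r" | "swap_others Gen_s Gen_s = Gen_s"
| "swap_others Gen_t Gen_t = Gen_t"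

lemma foldr_swap_others_cong: "word_eq xs ys \<Longrightarrow> foldr swap_others xs = foldr swap_others ys"
proof (induction rule: word_eq.induct)
  case (word_square xs a ys)
  have "swap_others a (swap_others a x) = x" for x by (cases a; cases x) auto
  then show ?case by (auto simp: fun_eq_iff)
next
  case (word_order3 a b xs ys)
  then have "swap_others a (swap_others b (swap_others a (swap_others b
    (swap_others a (swap_others b x))))) = x" for x by (cases a; cases b; cases x) auto
  then show ?case by (auto simp: fun_eq_iff)
qed auto

lemma simple_inject [simp]: "simple a = simple b \<longleftrightarrow> a = b"
proof
  assume "simple a = simple b"
  then have "word_eq [a] [b]" by (simp flip: word_val_eq_iff)
  then have "swap_others a = swap_others b" using foldr_swap_others_cong by fastforce
  then have "swap_others a x = swap_others b x" for x by simp
  then have "swap_others a Gen_r = swap_others b Gen_r" "swap_others a Gen_s = swap_others b Gen_s"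
    by auto
  then show "a = b" by (cases a; cases b) auto
qed simp

text \<open>Exchange applied to a reduced word of \<open>z\<close> ending in \<open>s\<close> cannot
  delete that last letter, since \<open>s\<close> and \<open>t\<close> differ; so
  \<open>z * simple t\<close> is again the value of a word ending in \<open>s\<close>, of the right
  length.\<close>

lemma desc_pair:
  assumes "s \<noteq> t" "desc z s" "desc z t"
  shows "desc (z * simple t) s"
proof -
  obtain ys where ys: "word_val ys = z * simple s" "length ys = len (z * simple s)"
    using reduced_word_obtain .
  have "word_val (ys @ [s]) = z" using ys by simp
  then obtain us b vs where u: "ys @ [s] = us @ b # vs" "z * simple t = word_val (us @ vs)"
    using exchange[of "ys @ [s]" t] assms(3) by metis
  show ?thesis
  proof (cases vs rule: rev_cases)
    case Nil
    then have "z * simple t = z * simple s" using u ys by auto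
    then show ?thesis using assms(1) by simp
  next
    case (snoc vs' c)
    then have v: "z * simple t = word_val (us @ vs') * simple s" and yy: "ys = us @ b # vs'"
      using u by (auto simp: mult.assoc)
    then have "len (z * simple t * simple s) \<le> length (us @ vs')" using len_word_le[of "us @ vs'"] by simp
    also have "\<dots> < length ys" using yy by simp
    also have "length ys = len (z * simple t)"
      using ys len_desc[OF assms(2)] len_desc[OF assms(3)] by simp
    finally show ?thesis by (simp add: desc_def)
  qed
qed

text \<open>The shortest element of a coset of the dihedral group of \<open>s\<close> and
  \<open>t\<close>; \<open>min_rep_cases\<close> and \<open>min_rep_desc\<close> list the six
  elements of the coset and their descents.\<close>

definition min_rep :: "gen \<Rightarrow> gen \<Rightarrow> affW \<Rightarrow> bool" where
  "min_rep s t x \<longleftrightarrow> s \<noteq> t \<and> \<not> desc x s \<and> \<not> desc x t"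

lemma min_rep_sym: "min_rep s t x \<Longrightarrow> min_rep t s x"
  by (auto simp: min_rep_def)

lemma min_rep_not_desc1: "min_rep s t x \<Longrightarrow> \<not> desc (x * simple s) t"
  using desc_pair[of t s "x * simple s"] by (auto simp: min_rep_def)

text \<open>Otherwise two descents would lead from \<open>x * simple s * simple t\<close> to
  \<open>x * simple t * simple s\<close>, which has the same length.\<close>

lemma min_rep_not_desc2:
  assumes "min_rep s t x" shows "\<not> desc (x * simple s * simple t) s"
proof
  let ?z = "x * simple s * simple t"
  assume d: "desc ?z s"
  have st: "s \<noteq> t" and m: "min_rep t s x" using assms by (auto simp: min_rep_def)
  have "desc ?z t" using min_rep_not_desc1[OF assms] by simp
  then have "desc (?z * simple s) t" using desc_pair[of t s ?z] st d by auto
  then have "len ?z = Suc (Suc (len (?z * simple s * simple t)))"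
    using len_desc d by metis
  moreover have "?z * simple s * simple t = x * simple t * simple s"
    using braid_right[OF st, of x] by simp
  moreover have "len (x * simple t * simple s) = Suc (Suc (len x))"
    using min_rep_not_desc1[OF m] m by (simp add: len_not_desc min_rep_def)
  moreover have "len ?z = Suc (Suc (len x))"
    using min_rep_not_desc1[OF assms] assms by (simp add: len_not_desc min_rep_def)
  ultimately show False by simp
qed

lemma min_rep_desc:
  assumes "min_rep s t x"
  shows "\<not> desc x s" "\<not> desc x t"
    "desc (x * simple s) s" "\<not> desc (x * simple s) t"
    "desc (x * simple t) t" "\<not> desc (x * simple t) s"
    "desc (x * simple s * simple t) t" "\<not> desc (x * simple s * simple t) s"
    "desc (x * simple t * simple s) s" "\<not> desc (x * simple t * simple s) t"
    "desc (x * simple s * simple t * simple s) s" "desc (x * simple s * simple t * simple s) t"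
    "desc (x * simple t * simple s * simple t) s" "desc (x * simple t * simple s * simple t) t"
proof -
  have m: "min_rep t s x" and st: "s \<noteq> t" using assms by (auto simp: min_rep_def)
  have m1: "\<not> desc (x * simple s) t" "\<not> desc (x * simple t) s"
    using min_rep_not_desc1[OF assms] min_rep_not_desc1[OF m] by auto
  have m2: "\<not> desc (x * simple s * simple t) s" "\<not> desc (x * simple t * simple s) t"
    using min_rep_not_desc2[OF assms] min_rep_not_desc2[OF m] by auto
  have b: "x * simple s * simple t * simple s = x * simple t * simple s * simple t"
    by (rule braid_right[OF st])
  show "desc (x * simple s * simple t * simple s) s" "desc (x * simple t * simple s * simple t) t"
    using m2 by simp_all
  then show "desc (x * simple s * simple t * simple s) t" "desc (x * simple t * simple s * simple t) s"
    by (simp_all add: b)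
qed (use assms min_rep_not_desc1[OF assms] min_rep_not_desc1[OF min_rep_sym[OF assms]]
    min_rep_not_desc2[OF assms] min_rep_not_desc2[OF min_rep_sym[OF assms]]
    in \<open>auto simp: min_rep_def\<close>)

lemma min_rep_cases:
  assumes "s \<noteq> t"
  obtains x0 where "min_rep s t x0"
    "x \<in> {x0, x0 * simple s, x0 * simple t, x0 * simple s * simple t, x0 * simple t * simple s,
      x0 * simple s * simple t * simple s}"
proof -
  let ?S = "\<lambda>x0. {x0, x0 * simple s, x0 * simple t, x0 * simple s * simple t, x0 * simple t * simple s,
      x0 * simple s * simple t * simple s}"
  have closed: "y * simple s \<in> ?S x0" "y * simple t \<in> ?S x0" if "y \<in> ?S x0" for y x0
  proof -
    have "x0 * simple t * simple s * simple t = x0 * simple s * simple t * simple s"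
      "x0 * simple s * simple t * simple s * simple t = x0 * simple t * simple s"
      using braid_right[OF assms, of x0] by simp_all
    then show "y * simple s \<in> ?S x0" "y * simple t \<in> ?S x0" using that by auto
  qed
  have "\<exists>x0. min_rep s t x0 \<and> x \<in> ?S x0"
  proof (induction "len x" arbitrary: x rule: less_induct)
    case less
    consider "desc x s" | "desc x t" | "min_rep s t x" using assms by (auto simp: min_rep_def)
    then show ?case
    proof cases
      case 1
      then obtain x0 where "min_rep s t x0" "x * simple s \<in> ?S x0"
        using less[of "x * simple s"] unfolding desc_def by blast
      then show ?thesis using closed(1)[of "x * simple s" x0] unfolding simple_square by blast
    next
      case 2
      then obtain x0 where "min_rep s t x0" "x * simple t \<in> ?S x0"
        using less[of "x * simple t"] unfolding desc_def by blast
      then show ?thesis using closed(2)[of "x * simple t" x0] unfolding simple_square by blast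
    next
      case 3
      then show ?thesis by blast
    qed
  qed
  then show ?thesis using that by blast
qed

definition in_D :: "gen \<Rightarrow> gen \<Rightarrow> affW \<Rightarrow> bool" where
  "in_D s t x \<longleftrightarrow> s \<noteq> t \<and> desc x s \<and> \<not> desc x t"

text \<open>The star operation of Kazhdan and Lusztig on elements with exactly one descent, \<open>s\<close>,
  among \<open>s\<close> and \<open>t\<close>.\<close>

definition star :: "gen \<Rightarrow> gen \<Rightarrow> affW \<Rightarrow> affW" where
  "star s t x = (if desc (x * simple s) t then x * simple s else x * simple t)"

lemma in_D_cases:
  assumes "in_D s t x"
  obtains (short) x0 where "min_rep s t x0" "x = x0 * simple s" "star s t x = x0 * simple s * simple t"
  | (long) x0 where "min_rep s t x0" "x = x0 * simple t * simple s" "star s t x = x0 * simple t"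
proof -
  have "s \<noteq> t" using assms by (simp add: in_D_def)
  then obtain x0 where x0: "min_rep s t x0"
    "x \<in> {x0, x0 * simple s, x0 * simple t, x0 * simple s * simple t, x0 * simple t * simple s,
      x0 * simple s * simple t * simple s}" using min_rep_cases by metis
  show ?thesis
    using x0 min_rep_desc[OF x0(1)] assms short long by (auto simp: in_D_def star_def)
qed

lemma in_D_star:
  assumes "in_D s t x"
  shows "in_D t s (star s t x)" "star t s (star s t x) = x"
  using assms
proof (atomize (full), cases rule: in_D_cases)
  case (short x0)
  then show "in_D t s (star s t x) \<and> star t s (star s t x) = x"
    using min_rep_desc[OF short(1)] by (auto simp: in_D_def star_def min_rep_def)
next
  case (long x0)
  then show "in_D t s (star s t x) \<and> star t s (star s t x) = x"
    using min_rep_desc[OF long(1)] by (auto simp: in_D_def star_def min_rep_def)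
qed

lemma desc_pair_obtain:
  assumes "s \<noteq> t" "desc x s" "desc x t"
  obtains x0 where "min_rep s t x0" "x = x0 * simple s * simple t * simple s"
    "x = x0 * simple t * simple s * simple t"
proof -
  obtain x0 where x0: "min_rep s t x0"
    "x \<in> {x0, x0 * simple s, x0 * simple t, x0 * simple s * simple t, x0 * simple t * simple s,
      x0 * simple s * simple t * simple s}" using min_rep_cases[OF assms(1)] by metis
  then have "x = x0 * simple s * simple t * simple s"
    using min_rep_desc[OF x0(1)] assms by auto
  then show ?thesis using that x0(1) braid_right[OF assms(1), of x0] by simp
qed

text \<open>With \<open>s\<close> an ascent of \<open>x\<close>, the product
  \<open>x * simple s\<close> has the descent \<open>t\<close> exactly when it is the longest
  element of its dihedral coset.\<close>

lemma desc_up_iff: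
  assumes "s \<noteq> t" "\<not> desc x s"
  shows "desc (x * simple s) t \<longleftrightarrow> desc x t \<and> desc (x * simple t) s"
proof -
  obtain x0 where x0: "min_rep s t x0"
    "x \<in> {x0, x0 * simple s, x0 * simple t, x0 * simple s * simple t, x0 * simple t * simple s,
      x0 * simple s * simple t * simple s}" using min_rep_cases[OF assms(1)] by metis
  show ?thesis using x0 min_rep_desc[OF x0(1)] assms(2) by auto
qed

subsection \<open>Elements with two descents\<close>

lemma gen_cases: "distinct [a, b, c] \<Longrightarrow> d = a \<or> d = b \<or> d = (c :: gen)"
  by (cases a; cases b; cases c; cases d) auto

text \<open>Infinite descent: if \<open>z * simple a\<close> had the descent \<open>c\<close>, it
  would be a shorter counterexample, with descents \<open>b\<close> and \<open>c\<close>, and with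
  the descent \<open>a\<close> once \<open>b\<close> is removed.\<close>

lemma two_desc_third:
  assumes "distinct [a, b, c]" "desc z a" "desc z b"
  shows "\<not> desc z c" "\<not> desc (z * simple a) c" "\<not> desc (z * simple b) c"
proof -
  have main: "\<not> desc (z * simple a) c" if "distinct [a, b, c]" "desc z a" "desc z b" for z a b c
    using that
  proof (induction "len z" arbitrary: z a b c rule: less_induct)
    case less
    then obtain x0 where x0: "min_rep a b x0" "z = x0 * simple a * simple b * simple a"
      using desc_pair_obtain[of a b z] by (metis distinct_length_2_or_more)
    let ?y = "z * simple a"
    have "len ?y < len z" using less.prems(2) by (simp add: desc_def)
    moreover have "desc ?y b" "desc (?y * simple b) a"
      using x0(2) min_rep_desc[OF x0(1)] by simp_all
    ultimately show ?case using less.hyps[of ?y b c a] less.prems(1) by auto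
  qed
  show "\<not> desc (z * simple a) c" "\<not> desc (z * simple b) c"
    using main[OF assms] main[of b a c z] assms by auto
  then show "\<not> desc z c" using desc_pair[of c a z] assms by auto
qed

definition two_desc :: "gen \<Rightarrow> gen \<Rightarrow> gen \<Rightarrow> affW \<Rightarrow> bool" where
  "two_desc a b c z \<longleftrightarrow> distinct [a, b, c] \<and> desc z a \<and> desc z b"

lemma two_descD:
  assumes "two_desc a b c z"
  shows "a \<noteq> b" "b \<noteq> c" "a \<noteq> c" "desc z a" "desc z b" "\<not> desc z c"
    "desc (z * simple a) b" "desc (z * simple b) a"
    "\<not> desc (z * simple a) c" "\<not> desc (z * simple b) c"
  using assms two_desc_third[of a b c z] desc_pair[of a b z] desc_pair[of b a z]
  by (auto simp: two_desc_def)

lemma two_desc_sym: "two_desc a b c z \<Longrightarrow> two_desc b a c z"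
  by (auto simp: two_desc_def)

text \<open>Since \<open>z * simple c\<close> has the single descent \<open>c\<close>, it is the
  star partner of \<open>z\<close> for both pairs of generators that contain
  \<open>c\<close>.\<close>

lemma two_desc_third_up:
  assumes "two_desc a b c z"
  shows "desc (z * simple c) c" "\<not> desc (z * simple c) a" "\<not> desc (z * simple c) b"
    "two_desc a c b (z * simple c * simple a)"
proof -
  note d = two_descD[OF assms]
  show 1: "desc (z * simple c) c" "\<not> desc (z * simple c) a" "\<not> desc (z * simple c) b"
    using d desc_up_iff[of c a z] desc_up_iff[of c b z] by auto
  have "desc (z * simple c * simple a) a" using 1 by simp
  moreover have "desc (z * simple c * simple a) c"
    using desc_up_iff[of a c "z * simple c"] 1 d by simp
  ultimately show "two_desc a c b (z * simple c * simple a)" using d by (auto simp: two_desc_def)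
qed

lemma two_desc_len:
  assumes "two_desc a b c z" shows "3 \<le> len z"
proof -
  obtain x0 where x0: "min_rep a b x0" "z = x0 * simple a * simple b * simple a"
    using desc_pair_obtain[of a b z] two_descD[OF assms] by metis
  have "len z = Suc (Suc (Suc (len x0)))"
    unfolding x0(2) using min_rep_desc[OF x0(1)] by (simp add: len_not_desc)
  then show ?thesis by simp
qed

lemma two_desc_len3:
  assumes "two_desc a b c z" "len z = 3" shows "z = simple a * simple b * simple a"
proof -
  obtain x0 where x0: "min_rep a b x0" "z = x0 * simple a * simple b * simple a"
    using desc_pair_obtain[of a b z] two_descD[OF assms(1)] by metis
  have "len z = Suc (Suc (Suc (len x0)))"
    unfolding x0(2) using min_rep_desc[OF x0(1)] by (simp add: len_not_desc)
  then show ?thesis using assms x0 by simp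
qed

lemma in_D_two_desc:
  assumes "two_desc a b c z"
  shows "in_D a c z" "star a c z = z * simple c"
    "in_D c a (z * simple c)" "star c a (z * simple c) = z"
  using two_descD[OF assms] two_desc_third_up[OF assms] by (auto simp: in_D_def star_def)

subsection \<open>Laurent polynomials\<close>

abbreviation lookup where "lookup \<equiv> Poly_Mapping.lookup"
abbreviation keys where "keys \<equiv> Poly_Mapping.keys"
abbreviation single where "single \<equiv> Poly_Mapping.single"

lemma poly_mapping_sum_single:
  fixes f :: "'a \<Rightarrow>\<^sub>0 'b::comm_monoid_add"
  shows "(\<Sum>k\<in>keys f. single k (lookup f k)) = f"
  by (rule poly_mapping_eqI) (simp add: lookup_sum lookup_single when_def in_keys_iff)

lemma poly_mapping_single_induct [case_names single add]:
  fixes f :: "'a \<Rightarrow>\<^sub>0 'b::comm_monoid_add"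
  assumes "\<And>k c. P (single k c)" "\<And>f g. P f \<Longrightarrow> P g \<Longrightarrow> P (f + g)"
  shows "P f"
proof -
  have "P (\<Sum>k\<in>A. single k (lookup f k))" if "finite A" for A
    using that
  proof induction
    case empty
    then show ?case using assms(1)[of undefined 0] by simp
  qed (simp add: assms)
  then show ?thesis using poly_mapping_sum_single[of f] by (metis finite_keys)
qed

lemma lookup_single_mult: "lookup (single k c * f) n = c * lookup (f :: laurent) (n - k)"
proof (induction f rule: poly_mapping_single_induct)
  case (single j d)
  then show ?case by (simp add: mult_single lookup_single when_def)
next
  case (add f g)
  then show ?case by (simp add: distrib_left lookup_add)
qed

lemma lookup_qhalf_pow_mult [simp]: "lookup (qhalf_pow k * f) n = lookup f (n - k)"
  by (simp add: qhalf_pow_def lookup_single_mult)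

lemma qhalf_pow_mult: "qhalf_pow j * qhalf_pow k = qhalf_pow (j + k)"
  by (simp add: qhalf_pow_def mult_single)

lemma qhalf_pow_mult_left: "qhalf_pow j * (qhalf_pow k * f) = qhalf_pow (j + k) * f"
  by (simp add: qhalf_pow_mult flip: mult.assoc)

lemma qhalf_pow_zero [simp]: "qhalf_pow 0 = 1"
  by (simp add: qhalf_pow_def)

lemma lookup_qhalf_pow: "lookup (qhalf_pow k) n = (if n = k then 1 else 0)"
  by (simp add: qhalf_pow_def lookup_single when_def)

lemma q_mult_qhalf_pow: "q * qhalf_pow k = qhalf_pow (k + 2)" "qhalf_pow k * q = qhalf_pow (k + 2)"
  by (simp_all add: q_def qhalf_pow_mult add.commute)

lemma lookup_laurent_bar [simp]: "lookup (laurent_bar f) k = lookup f (- k)"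
proof -
  have "lookup (laurent_bar f) k = (\<Sum>j\<in>keys f. if j = - k then lookup f j else 0)"
    unfolding laurent_bar_def lookup_sum lookup_single when_def
    by (intro sum.cong) auto
  then show ?thesis by (simp add: in_keys_iff)
qed

lemma laurent_bar_add: "laurent_bar (f + g) = laurent_bar f + laurent_bar g"
  by (rule poly_mapping_eqI) (simp add: lookup_add)

lemma laurent_bar_single: "laurent_bar (single k c) = single (- k) c"
  by (rule poly_mapping_eqI) (auto simp: lookup_single when_def)

lemma laurent_bar_mult: "laurent_bar (f * g) = laurent_bar f * laurent_bar g"
proof (induction f rule: poly_mapping_single_induct)
  case (single k c)
  show ?case
    by (rule poly_mapping_eqI) (simp add: laurent_bar_single lookup_single_mult)
next
  case (add f g)
  then show ?case by (simp add: laurent_bar_add distrib_right)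
qed

lemma laurent_bar_qhalf_pow [simp]: "laurent_bar (qhalf_pow k) = qhalf_pow (- k)"
  by (simp add: qhalf_pow_def laurent_bar_single)

lemma laurent_bar_consts [simp]: "laurent_bar 1 = 1" "laurent_bar 0 = 0"
  by (rule poly_mapping_eqI, auto simp: lookup_one when_def)+

lemma laurent_bar_minus: "laurent_bar (f - g) = laurent_bar f - laurent_bar g"
  by (rule poly_mapping_eqI) (simp add: lookup_minus)

subsection \<open>Linear operators on the Hecke module\<close>

lemma lookup_hscale [simp]: "lookup (hscale c h) y = c * lookup h y"
  by (simp add: hscale_def map.rep_eq when_def)

lemma hscale_simps [simp]:
  "hscale c (g + h) = hscale c g + hscale c h" "hscale c (hscale d h) = hscale (c * d) h"
  "hscale 1 h = h" "hscale 0 h = 0" "hscale c 0 = 0"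
  by (rule poly_mapping_eqI, simp add: lookup_add algebra_simps)+

lemma hscale_add_left: "hscale (c + d) h = hscale c h + hscale d h"
  by (rule poly_mapping_eqI, simp add: lookup_add algebra_simps)

lemma hscale_sum: "hscale c (sum f A) = (\<Sum>x\<in>A. hscale c (f x))"
  by (rule poly_mapping_eqI, simp add: lookup_sum sum_distrib_left)

lemma lookup_T: "lookup (T w) y = (if y = w then 1 else 0)"
  by (simp add: T_def lookup_single when_def)

lemma hecke_sum_T: "(\<Sum>w\<in>keys h. hscale (lookup h w) (T w)) = h"
  by (rule poly_mapping_eqI) (simp add: lookup_sum lookup_T in_keys_iff if_distrib cong: if_cong)

definition hlinear :: "(hecke \<Rightarrow> hecke) \<Rightarrow> bool" where
  "hlinear F \<longleftrightarrow> (\<forall>g h. F (g + h) = F g + F h) \<and> (\<forall>c h. F (hscale c h) = hscale c (F h))"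

lemma hlinearI:
  assumes "\<And>g h. F (g + h) = F g + F h" "\<And>c h. F (hscale c h) = hscale c (F h)"
  shows "hlinear F"
  using assms by (simp add: hlinear_def)

lemma hlinearD:
  assumes "hlinear F"
  shows "F (g + h) = F g + F h" "F (hscale c h) = hscale c (F h)" "F 0 = 0"
    "F (sum f A) = (\<Sum>x\<in>A. F (f x))"
proof -
  show add: "F (g + h) = F g + F h" "F (hscale c h) = hscale c (F h)" for g h c
    using assms by (simp_all add: hlinear_def)
  show zero: "F 0 = 0" using add(2)[of 0 0] by simp
  show "F (sum f A) = (\<Sum>x\<in>A. F (f x))"
    by (induction A rule: infinite_finite_induct) (simp_all add: zero add)
qed

lemma hlinear_comp: "hlinear F \<Longrightarrow> hlinear G \<Longrightarrow> hlinear (\<lambda>h. F (G h))"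
  by (simp add: hlinear_def)

lemma hlinear_eqI:
  assumes "hlinear F" "hlinear G" "\<And>w. F (T w) = G (T w)"
  shows "F h = G h"
proof -
  have "F (\<Sum>w\<in>keys h. hscale (lookup h w) (T w)) = G (\<Sum>w\<in>keys h. hscale (lookup h w) (T w))"
    by (simp add: hlinearD[OF assms(1)] hlinearD[OF assms(2)] assms(3))
  then show ?thesis by (simp add: hecke_sum_T)
qed

lemma lin_ext_superset:
  assumes "finite A" "keys h \<subseteq> A"
  shows "lin_ext f h = (\<Sum>w\<in>A. hscale (lookup h w) (f w))"
  unfolding lin_ext_def using assms
  by (intro sum.mono_neutral_left) (auto simp: in_keys_iff)

lemma hlinear_lin_ext: "hlinear (lin_ext f)"
proof (rule hlinearI)
  fix g h :: hecke and c
  let ?A = "keys g \<union> keys h"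
  have "keys (g + h) \<subseteq> ?A" by (auto simp: in_keys_iff lookup_add)
  then show "lin_ext f (g + h) = lin_ext f g + lin_ext f h"
    by (subst (1 2 3) lin_ext_superset[of ?A]) (auto simp: lookup_add hscale_add_left sum.distrib)
  have "keys (hscale c h) \<subseteq> keys h" by (auto simp: in_keys_iff)
  then show "lin_ext f (hscale c h) = hscale c (lin_ext f h)"
    by (subst (1 2) lin_ext_superset[of "keys h"]) (auto simp: hscale_sum)
qed

lemma lin_ext_T [simp]: "lin_ext f (T w) = f w"
  by (subst lin_ext_superset[of "{w}"]) (auto simp: lookup_T in_keys_iff split: if_splits)

lemma lookup_lin_ext:
  assumes "finite A" "\<And>w. w \<notin> A \<Longrightarrow> lookup (f w) y = 0"
  shows "lookup (lin_ext f h) y = (\<Sum>w\<in>A. lookup h w * lookup (f w) y)"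
proof -
  have "lookup (lin_ext f h) y = (\<Sum>w\<in>keys h \<union> A. lookup h w * lookup (f w) y)"
    using assms(1) by (subst lin_ext_superset[of "keys h \<union> A"]) (auto simp: lookup_sum)
  also have "\<dots> = (\<Sum>w\<in>A. lookup h w * lookup (f w) y)"
    using assms by (intro sum.mono_neutral_right) auto
  finally show ?thesis .
qed

text \<open>Multiplication by the generator of \<open>a\<close> on the right, which the definition
  of \<open>hecke_mult\<close> does not provide.\<close>

definition T_right :: "gen \<Rightarrow> hecke \<Rightarrow> hecke" where
  "T_right a = lin_ext (\<lambda>w.
     if desc w a then hscale (q - 1) (T w) + hscale q (T (w * simple a)) else T (w * simple a))"

lemma lookup_T_right:
  "lookup (T_right a h) y =
    (if desc y a then lookup h (y * simple a) + (q - 1) * lookup h y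
     else q * lookup h (y * simple a))"
proof -
  have ne: "y * simple a \<noteq> y" by (metis desc_mult_self)
  have "lookup (T_right a h) y = (\<Sum>w\<in>{y, y * simple a}. lookup h w * lookup
    (if desc w a then hscale (q - 1) (T w) + hscale q (T (w * simple a)) else T (w * simple a)) y)"
    unfolding T_right_def
    by (rule lookup_lin_ext) (auto simp: lookup_add lookup_T)
  then show ?thesis using ne by (simp add: lookup_add lookup_T algebra_simps)
qed

lemma lookup_T_left:
  "lookup (T_simple_mult a h) y =
    (if len (simple a * y) < len y then lookup h (simple a * y) + (q - 1) * lookup h y
     else q * lookup h (simple a * y))"
proof -
  have ne: "simple a * y \<noteq> y" and less: "y < simple a * y \<longleftrightarrow> \<not> len (simple a * y) < len y"
    using len_simple_mult_cases[of a y] by (fastforce simp: less_simple_mult_iff)+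
  have "lookup (T_simple_mult a h) y = (\<Sum>w\<in>{y, simple a * y}. lookup h w * lookup
    (if w < simple a * w then T (simple a * w)
     else hscale (q - 1) (T w) + hscale q (T (simple a * w))) y)"
    unfolding T_simple_mult_def
    by (rule lookup_lin_ext) (auto simp: lookup_add lookup_T)
  then show ?thesis using ne less by (simp add: lookup_add lookup_T algebra_simps less_simple_mult_iff)
qed

lemma hlinear_T_right [simp]: "hlinear (T_right a)"
  unfolding T_right_def by (rule hlinear_lin_ext)

lemma hlinear_T_left [simp]: "hlinear (T_simple_mult a)"
  unfolding T_simple_mult_def by (rule hlinear_lin_ext)

lemma T_right_T: "\<not> desc w a \<Longrightarrow> T_right a (T w) = T (w * simple a)"
  by (simp add: T_right_def)

lemma T_left_T: "len w < len (simple a * w) \<Longrightarrow> T_simple_mult a (T w) = T (simple a * w)"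
  by (simp add: T_simple_mult_def less_simple_mult_iff)

text \<open>The hypothesis says that the reflection \<open>inverse y * simple a * y\<close> is not
  \<open>simple b\<close>; by the cocycle rule, multiplication on one side then leaves the descent
  on the other side unchanged.\<close>

lemma left_right_len:
  assumes "simple a * y \<noteq> y * simple b"
  shows "desc (simple a * y) b \<longleftrightarrow> desc y b"
    "len (simple a * (y * simple b)) < len (y * simple b) \<longleftrightarrow> len (simple a * y) < len y"
proof -
  let ?r = "inverse y * simple a * y"
  have refl: "?r \<in> reflections"
    unfolding reflections_def by (auto intro!: exI[of _ "inverse y"])
  have yr: "y * ?r = simple a * y" by (simp add: mult.assoc)
  have ne: "?r \<noteq> simple b" using assms yr by metis
  have *: "inv_refl (z * simple b) (simple b * \<rho> * simple b) = inv_refl z \<rho>" if "\<rho> \<noteq> simple b" for z \<rho>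
  proof -
    have "inv_refl (z * simple b) (simple b * \<rho> * simple b) =
      ((simple b * \<rho> * simple b = simple b) \<noteq> inv_refl z \<rho>)"
      by (subst inv_refl_mult) (simp add: inv_refl_simple mult.assoc)
    moreover have "simple b * \<rho> * simple b \<noteq> simple b"
      using that by (metis affW_mult_left_cancel mult.assoc mult.right_neutral simple_square(1) simple_square(2))
    ultimately show ?thesis by simp
  qed
  have refl': "simple b * ?r * simple b \<in> reflections"
    unfolding reflections_def by (auto intro!: exI[of _ "simple b * inverse y"] exI[of _ a] simp: mult.assoc)
  have "simple a * (y * simple b) = (y * simple b) * (simple b * ?r * simple b)"
    by (simp add: mult.assoc)
  then show 2: "len (simple a * (y * simple b)) < len (y * simple b) \<longleftrightarrow> len (simple a * y) < len y"
    using len_mult_refl_iff[OF refl', of "y * simple b"] len_mult_refl_iff[OF refl, of y] *[OF ne, of y] yr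
    by metis
  have eq: "inv_refl (simple a * y) (simple b) = inv_refl y (simple b)"
  proof -
    have "y * simple b * inverse y \<noteq> simple a"
      using assms by (metis affW_inv_simps(1) mult.assoc mult.right_neutral)
    then show ?thesis by (subst inv_refl_mult) (simp add: inv_refl_simple)
  qed
  then show "desc (simple a * y) b \<longleftrightarrow> desc y b"
    using len_mult_refl_iff[of "simple b"] by (simp add: desc_def)
qed

lemma T_left_right_commute: "T_simple_mult a (T_right b h) = T_right b (T_simple_mult a h)"
proof (rule poly_mapping_eqI)
  fix y
  have dl: "desc y b = (len (y * simple b) < len y)" for y by (simp add: desc_def)
  show "lookup (T_simple_mult a (T_right b h)) y = lookup (T_right b (T_simple_mult a h)) y"
  proof (cases "simple a * y = y * simple b")
    case True
    \<comment> \<open>Here the left descent \<open>a\<close> and the right descent \<open>b\<close>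
      of \<open>y\<close> determine each other, and both operators link the same two
      coefficients.\<close>
    have 1: "simple a * y * simple b = y" "simple a * (y * simple b) = y"
      using True by (metis simple_square(2)) (metis True simple_square(3))
    have 2: "len (simple a * (y * simple b)) < len (y * simple b) \<longleftrightarrow> \<not> desc y b"
      "len (simple a * y) < len y \<longleftrightarrow> desc y b"
      using 1 True len_mult_simple_cases[of y b] by (fastforce simp: desc_def)+
    show ?thesis
      unfolding lookup_T_left lookup_T_right
      using True 1 2 by (auto simp: algebra_simps)
  next
    case False
    note * = left_right_len[OF False]
    show ?thesis
      unfolding lookup_T_left lookup_T_right *
      by (auto simp: algebra_simps)
  qed
qed

text \<open>The inverse operator, solved from the quadratic relation
  \<open>T_right_square\<close>.\<close>

definition T_right_inv :: "gen \<Rightarrow> hecke \<Rightarrow> hecke" where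
  "T_right_inv a h = hscale (qhalf_pow (-2)) (T_right a h) + hscale (qhalf_pow (-2) - 1) h"

definition T_left_inv :: "gen \<Rightarrow> hecke \<Rightarrow> hecke" where
  "T_left_inv a h = hscale (qhalf_pow (-2)) (T_simple_mult a h) + hscale (qhalf_pow (-2) - 1) h"

lemma q_inverse: "q * qhalf_pow (-2) = 1" "qhalf_pow (-2) * q = 1"
  "q * (qhalf_pow (-2) * f) = f" "qhalf_pow (-2) * (q * f) = f"
  by (simp_all add: q_mult_qhalf_pow qhalf_pow_mult q_def qhalf_pow_mult_left)

lemma hlinear_T_right_inv [simp]: "hlinear (T_right_inv a)"
  by (rule hlinearI; rule poly_mapping_eqI)
    (simp_all add: T_right_inv_def hlinearD[OF hlinear_T_right] lookup_add algebra_simps)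

lemma hlinear_T_left_inv [simp]: "hlinear (T_left_inv a)"
  by (rule hlinearI; rule poly_mapping_eqI)
    (simp_all add: T_left_inv_def hlinearD[OF hlinear_T_left] lookup_add algebra_simps)

lemma T_right_square: "T_right a (T_right a h) = hscale (q - 1) (T_right a h) + hscale q h"
  by (rule poly_mapping_eqI) (simp add: lookup_T_right lookup_add algebra_simps)

lemma T_left_square: "T_simple_mult a (T_simple_mult a h) = hscale (q - 1) (T_simple_mult a h) + hscale q h"
proof (rule poly_mapping_eqI)
  fix y
  have "len (simple a * (simple a * y)) < len (simple a * y) \<longleftrightarrow> \<not> len (simple a * y) < len y"
    using len_simple_mult_cases[of a y] by fastforce
  then show "lookup (T_simple_mult a (T_simple_mult a h)) y =
    lookup (hscale (q - 1) (T_simple_mult a h) + hscale q h) y"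
    by (auto simp add: lookup_T_left lookup_add algebra_simps)
qed

lemma T_inv_cancel [simp]:
  "T_right a (T_right_inv a h) = h" "T_right_inv a (T_right a h) = h"
  "T_simple_mult a (T_left_inv a h) = h" "T_left_inv a (T_simple_mult a h) = h"
  by (rule poly_mapping_eqI; simp add: T_right_inv_def T_left_inv_def hlinearD[OF hlinear_T_right]
    hlinearD[OF hlinear_T_left] T_right_square T_left_square lookup_add ring_distribs q_inverse flip: mult.assoc)+

lemma T_right_inv_square:
  "T_right_inv a (T_right_inv a h) = hscale (qhalf_pow (-2) - 1) (T_right_inv a h) + hscale (qhalf_pow (-2)) h"
  by (rule poly_mapping_eqI; simp add: T_right_inv_def hlinearD[OF hlinear_T_right]
    T_right_square lookup_add ring_distribs q_inverse flip: mult.assoc)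

lemma T_left_right_inv_commute:
  "T_left_inv a (T_right b h) = T_right b (T_left_inv a h)"
  "T_left_inv a (T_right_inv b h) = T_right_inv b (T_left_inv a h)"
  by (simp_all add: T_left_inv_def T_right_inv_def hlinearD[OF hlinear_T_right]
    hlinearD[OF hlinear_T_left] T_left_right_commute algebra_simps)

subsection \<open>The bar involution\<close>

text \<open>Endomorphisms of the right regular module, hence determined by their value at
  \<open>T 1\<close>. This makes products independent of the reduced words picked by
  \<open>SOME\<close>.\<close>

definition right_equivariant :: "(hecke \<Rightarrow> hecke) \<Rightarrow> bool" where
  "right_equivariant F \<longleftrightarrow> hlinear F \<and> (\<forall>b h. F (T_right b h) = T_right b (F h))"

lemma right_equivariant_eqI:
  assumes "right_equivariant F" "right_equivariant G" "F (T 1) = G (T 1)"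
  shows "F h = G h"
proof (rule hlinear_eqI[of F G])
  show "F (T w) = G (T w)" for w
  proof (induction w rule: affW_len_induct)
    case (mult x a)
    then show ?case using assms by (simp add: right_equivariant_def flip: T_right_T)
  qed (rule assms)
qed (use assms in \<open>auto simp: right_equivariant_def\<close>)

lemma right_equivariant_foldr_left: "right_equivariant (foldr T_simple_mult xs)"
  unfolding right_equivariant_def
  by (induction xs) (auto simp: hlinear_def T_left_right_commute hlinearD[OF hlinear_T_left])

lemma right_equivariant_foldr_left_inv: "right_equivariant (foldr T_left_inv xs)"
  unfolding right_equivariant_def
  by (induction xs) (auto simp: hlinear_def T_left_right_inv_commute hlinearD[OF hlinear_T_left_inv])

lemma foldr_left_inv_cancel:
  "foldr T_simple_mult xs (foldr T_left_inv (rev xs) h) = h"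
  "foldr T_left_inv (rev xs) (foldr T_simple_mult xs h) = h"
  by (induction xs arbitrary: h) simp_all

lemma reduced_expr_Cons:
  assumes "reduced_expr w (a # xs)"
  shows "reduced_expr (word_val xs) xs" "len (word_val xs) < len w"
proof -
  have w: "w = simple a * word_val xs" "Suc (length xs) = len w"
    using assms by (auto simp: reduced_expr_def)
  then have "len w \<le> Suc (len (word_val xs))" by (metis len_simple_mult_cases le_SucI le_refl lessI less_imp_le_nat)
  then show "reduced_expr (word_val xs) xs" "len (word_val xs) < len w"
    using len_word_le[of xs] w by (auto simp: reduced_expr_def)
qed

lemma foldr_left_reduced: "reduced_expr w xs \<Longrightarrow> foldr T_simple_mult xs (T 1) = T w"
proof (induction xs arbitrary: w)
  case (Cons a xs)
  then have "foldr T_simple_mult xs (T 1) = T (word_val xs)" "w = simple a * word_val xs"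
    using reduced_expr_Cons(1) by (auto simp: reduced_expr_def)
  then show ?case using reduced_expr_Cons(2)[OF Cons.prems] by (simp add: T_left_T)
qed (simp add: reduced_expr_def)

lemma hecke_mult_T: "reduced_expr w xs \<Longrightarrow> hecke_mult (T w) h = foldr T_simple_mult xs h"
proof -
  assume xs: "reduced_expr w xs"
  have some: "reduced_expr w (SOME xs. reduced_expr w xs)" using xs by (rule someI)
  have "foldr T_simple_mult (SOME xs. reduced_expr w xs) h = foldr T_simple_mult xs h"
    by (rule right_equivariant_eqI[OF right_equivariant_foldr_left right_equivariant_foldr_left])
      (simp only: foldr_left_reduced[OF xs] foldr_left_reduced[OF some])
  then show ?thesis by (simp add: hecke_mult_def)
qed

lemma right_equivariant_hecke_mult: "right_equivariant (hecke_mult g)"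
  unfolding right_equivariant_def hlinear_def hecke_mult_def lin_ext_def
  using right_equivariant_foldr_left unfolding right_equivariant_def
  by (auto simp: hlinearD sum.distrib hscale_sum mult.commute)

lemma hecke_mult_T_one: "hecke_mult g (T 1) = g"
proof -
  have "foldr T_simple_mult (SOME xs. reduced_expr w xs) (T 1) = T w" for w
    by (rule foldr_left_reduced, rule someI_ex) (rule reduced_expr_exists)
  then show ?thesis unfolding hecke_mult_def lin_ext_def by (simp add: hecke_sum_T)
qed

lemma hecke_inverse_T:
  assumes "reduced_expr w xs"
  shows "hecke_inverse (T w) = foldr T_left_inv (rev xs) (T 1)"
  unfolding hecke_inverse_def
proof (rule the_equality)
  let ?g = "foldr T_left_inv (rev xs) (T 1)"
  have "hecke_mult ?g h = foldr T_left_inv (rev xs) h" for h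
    by (rule right_equivariant_eqI[OF right_equivariant_hecke_mult right_equivariant_foldr_left_inv])
      (rule hecke_mult_T_one)
  then have "hecke_mult ?g (T w) = T 1"
    using foldr_left_inv_cancel(2)[of xs "T 1"] foldr_left_reduced[OF assms] by simp
  then show "hecke_mult ?g (T w) = T 1 \<and> hecke_mult (T w) ?g = T 1"
    using assms by (simp add: hecke_mult_T foldr_left_inv_cancel)
next
  fix g
  assume "hecke_mult g (T w) = T 1 \<and> hecke_mult (T w) g = T 1"
  then have "foldr T_simple_mult xs g = T 1" using hecke_mult_T[OF assms] by simp
  then show "g = foldr T_left_inv (rev xs) (T 1)" using foldr_left_inv_cancel(2)[of xs g] by simp
qed

definition bar_T :: "affW \<Rightarrow> hecke" where
  "bar_T w = hecke_inverse (T (inverse w))"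

lemma bar_T_one [simp]: "bar_T 1 = T 1"
  using hecke_inverse_T[of 1 "[]"] by (simp add: bar_T_def reduced_expr_def)

text \<open>The letter \<open>a\<close> comes first in the word of the inverse and so acts
  innermost, on \<open>T 1\<close>, where left and right operators agree; as a right operator it
  then moves out past the left ones.\<close>

lemma bar_T_mult:
  assumes "\<not> desc w a"
  shows "bar_T (w * simple a) = T_right_inv a (bar_T w)"
proof -
  obtain xs where xs: "reduced_expr (inverse w) xs" using reduced_expr_exists by blast
  have "len (simple a * inverse w) = Suc (len w)"
    using len_not_desc[OF assms] len_inverse[of "w * simple a"] by simp
  then have "reduced_expr (inverse (w * simple a)) (a # xs)"
    using xs by (simp add: reduced_expr_def)
  then have 1: "bar_T (w * simple a) = foldr T_left_inv (rev xs) (T_left_inv a (T 1))"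
    unfolding bar_T_def using hecke_inverse_T by fastforce
  have "T_simple_mult a (T 1) = T_right a (T 1)"
  proof -
    have "len (simple a * 1) = len (1 * simple a)" by simp
    then have "len 1 < len (simple a * 1)" using len_not_desc[of 1 a] by simp
    then show ?thesis using T_left_T[of 1 a] T_right_T[of 1 a] by simp
  qed
  then have 2: "T_left_inv a (T 1) = T_right_inv a (T 1)" by (simp add: T_left_inv_def T_right_inv_def)
  have "foldr T_left_inv ys (T_right_inv a h) = T_right_inv a (foldr T_left_inv ys h)" for ys h
    by (induction ys) (simp_all add: T_left_right_inv_commute)
  then show ?thesis using 1 2 hecke_inverse_T[OF xs] by (simp add: bar_T_def)
qed

lemma hecke_bar_superset:
  assumes "finite A" "keys h \<subseteq> A"
  shows "hecke_bar h = (\<Sum>w\<in>A. hscale (laurent_bar (lookup h w)) (bar_T w))"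
  unfolding hecke_bar_def bar_T_def using assms
  by (intro sum.mono_neutral_left) (auto simp: in_keys_iff)

lemma hecke_bar_add: "hecke_bar (g + h) = hecke_bar g + hecke_bar h"
proof -
  have "keys (g + h) \<subseteq> keys g \<union> keys h" by (auto simp: in_keys_iff lookup_add)
  then show ?thesis
    by (subst (1 2 3) hecke_bar_superset[of "keys g \<union> keys h"])
      (auto simp: lookup_add laurent_bar_add hscale_add_left sum.distrib)
qed

lemma hecke_bar_hscale: "hecke_bar (hscale c h) = hscale (laurent_bar c) (hecke_bar h)"
proof -
  have "keys (hscale c h) \<subseteq> keys h" by (auto simp: in_keys_iff)
  then show ?thesis
    by (subst (1 2) hecke_bar_superset[of "keys h"]) (auto simp: hscale_sum laurent_bar_mult)
qed

lemma hecke_bar_T: "hecke_bar (T w) = bar_T w"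
  by (subst hecke_bar_superset[of "{w}"]) (auto simp: lookup_T in_keys_iff split: if_splits)

lemma hecke_bar_diff: "hecke_bar (g - h) = hecke_bar g - hecke_bar h"
  using hecke_bar_add[of "g - h" h] by (simp add: algebra_simps)

lemma hecke_bar_sum: "hecke_bar (sum f A) = (\<Sum>x\<in>A. hecke_bar (f x))"
proof (induction A rule: infinite_finite_induct)
  case empty
  then show ?case using hecke_bar_diff[of 0 0] by simp
next
  case infinite
  then show ?case using hecke_bar_diff[of 0 0] by simp
qed (simp add: hecke_bar_add)

lemma hecke_bar_T_right: "hecke_bar (T_right a h) = T_right_inv a (hecke_bar h)"
proof (induction h rule: poly_mapping_single_induct)
  case (single w c)
  have s: "single w c = hscale c (T w)"
    by (rule poly_mapping_eqI) (simp add: lookup_T lookup_single when_def)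
  have "hecke_bar (T_right a (T w)) = T_right_inv a (bar_T w)"
  proof (cases "desc w a")
    case False
    then show ?thesis by (simp add: T_right_T hecke_bar_T bar_T_mult)
  next
    case True
    define x where "x = w * simple a"
    have x: "w = x * simple a" "\<not> desc x a" using True by (auto simp: x_def)
    have "T_right a (T w) = hscale (q - 1) (T w) + hscale q (T x)"
      using True by (simp add: T_right_def x_def)
    then show ?thesis
      using x by (simp add: hecke_bar_add hecke_bar_hscale hecke_bar_T bar_T_mult
        T_right_inv_square laurent_bar_minus q_def)
  qed
  then show ?case
    by (simp add: s hlinearD[OF hlinear_T_right] hlinearD[OF hlinear_T_right_inv] hecke_bar_hscale hecke_bar_T)
next
  case (add f g)
  then show ?case
    by (simp add: hlinearD[OF hlinear_T_right] hlinearD[OF hlinear_T_right_inv] hecke_bar_add)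
qed

lemma lookup_T_right_inv:
  "lookup (T_right_inv a h) y =
    (if desc y a then qhalf_pow (-2) * lookup h (y * simple a)
     else lookup h (y * simple a) + (qhalf_pow (-2) - 1) * lookup h y)"
  by (simp add: T_right_inv_def lookup_T_right lookup_add ring_distribs q_inverse flip: mult.assoc)

lemma bar_T_triangular:
  "(lookup (bar_T w) y \<noteq> 0 \<longrightarrow> y = w \<or> len y < len w) \<and>
    lookup (bar_T w) w = qhalf_pow (- 2 * int (len w))"
proof (induction w arbitrary: y rule: affW_len_induct)
  case one
  then show ?case by (simp add: lookup_T)
next
  case (mult x a)
  have l: "len (x * simple a) = Suc (len x)" using mult(2) by (rule len_not_desc)
  have "y = x * simple a \<or> len y < len (x * simple a)" if "lookup (bar_T (x * simple a)) y \<noteq> 0"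
  proof -
    have "lookup (bar_T x) (y * simple a) \<noteq> 0 \<or> lookup (bar_T x) y \<noteq> 0"
      using that by (auto simp: bar_T_mult[OF mult(2)] lookup_T_right_inv split: if_splits)
    then have "y * simple a = x \<or> len (y * simple a) < len x \<or> y = x \<or> len y < len x"
      using mult(1)[of y] mult(1)[of "y * simple a"] by blast
    then show ?thesis using l len_mult_simple_le[of "y * simple a" a] by auto
  qed
  moreover have "lookup (bar_T (x * simple a)) (x * simple a) = qhalf_pow (- 2 * int (len (x * simple a)))"
    using mult by (simp add: bar_T_mult lookup_T_right_inv l qhalf_pow_mult algebra_simps)
  ultimately show ?case by blast
qed

text \<open>At an element \<open>y\<close> of greatest length in the support, bar invariance makes
  the exponents symmetric about \<open>- len y\<close>, while the degree condition keeps all of them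
  strictly below.\<close>

lemma bar_invariant_zero:
  assumes "hecke_bar h = h" and deg: "\<And>y k. lookup (lookup h y) k \<noteq> 0 \<Longrightarrow> k \<le> - int (len y) - 1"
  shows "h = 0"
proof (rule ccontr)
  assume "h \<noteq> 0"
  then have "keys h \<noteq> {}" by simp
  then obtain y where y: "y \<in> keys h" "\<And>z. z \<in> keys h \<Longrightarrow> len z \<le> len y"
    using obtains_MAX[of "keys h" len] by (metis Max_ge finite_imageI finite_keys imageI)
  have "lookup (hecke_bar h) y = (\<Sum>w\<in>keys h. laurent_bar (lookup h w) * lookup (bar_T w) y)"
    by (subst hecke_bar_superset[of "keys h"]) (auto simp: lookup_sum)
  also have "\<dots> = (\<Sum>w\<in>{y}. laurent_bar (lookup h w) * lookup (bar_T w) y)"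
    using y bar_T_triangular by (intro sum.mono_neutral_right) (auto, metis leD)
  also have "\<dots> = qhalf_pow (- 2 * int (len y)) * laurent_bar (lookup h y)"
    using bar_T_triangular[of y] by (simp add: mult.commute)
  finally have eq: "lookup h y = qhalf_pow (- 2 * int (len y)) * laurent_bar (lookup h y)"
    using assms(1) by simp
  have "lookup (lookup h y) k = lookup (lookup h y) (- k - 2 * int (len y))" for k
    by (subst eq, simp only: lookup_qhalf_pow_mult lookup_laurent_bar) (simp add: algebra_simps)
  then have "lookup (lookup h y) k = 0" for k
    using deg[of y k] deg[of y "- k - 2 * int (len y)"] by fastforce
  then have "lookup h y = 0" by (intro poly_mapping_eqI) simp
  then show False using y(1) by (simp add: in_keys_iff)
qed

subsection \<open>The Kazhdan-Lusztig basis\<close>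

definition C_right :: "gen \<Rightarrow> hecke \<Rightarrow> hecke" where
  "C_right s h = hscale (qhalf_pow (-1)) (h + T_right s h)"

lemma lookup_C_right:
  "lookup (C_right s h) y = (if desc y s
     then qhalf_pow (-1) * lookup h (y * simple s) + qhalf_pow 1 * lookup h y
     else qhalf_pow (-1) * lookup h y + qhalf_pow 1 * lookup h (y * simple s))"
  by (simp add: C_right_def lookup_add lookup_T_right algebra_simps q_mult_qhalf_pow
    flip: mult.assoc)

lemma hlinear_C_right [simp]: "hlinear (C_right s)"
  by (rule hlinearI) (simp_all add: C_right_def hlinearD[OF hlinear_T_right] algebra_simps)

lemma hecke_bar_C_right: "hecke_bar (C_right s h) = C_right s (hecke_bar h)"
  by (rule poly_mapping_eqI)
    (simp add: C_right_def hecke_bar_hscale hecke_bar_add hecke_bar_T_right T_right_inv_def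
      lookup_add ring_distribs qhalf_pow_mult flip: mult.assoc)

definition gap :: laurent where "gap = qhalf_pow 1 + qhalf_pow (-1)"

lemma C_right_square: "C_right s (C_right s h) = hscale gap (C_right s h)"
  by (rule poly_mapping_eqI)
    (simp add: lookup_C_right gap_def ring_distribs qhalf_pow_mult qhalf_pow_mult_left flip: mult.assoc)

text \<open>The coefficient of \<open>T y\<close> is the Kazhdan-Lusztig polynomial with its
  half-exponents shifted by \<open>- len w\<close>: the lower bound excludes negative powers,
  evenness says that it is a polynomial in \<open>q\<close>, and the upper bound is the degree
  condition.\<close>

definition is_KL :: "affW \<Rightarrow> hecke \<Rightarrow> bool" where
  "is_KL w C \<longleftrightarrow> hecke_bar C = C \<and> lookup C w = qhalf_pow (- int (len w)) \<and>
     (\<forall>y k. lookup (lookup C y) k \<noteq> 0 \<longrightarrow>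
        y \<le> w \<and> - int (len w) \<le> k \<and> even (k + int (len w)) \<and> (y \<noteq> w \<longrightarrow> k \<le> - int (len y) - 1))"

lemma is_KL_unique:
  assumes "is_KL w C" "is_KL w C'" shows "C = C'"
proof -
  have "C - C' = 0"
  proof (rule bar_invariant_zero)
    show "hecke_bar (C - C') = C - C'" using assms by (simp add: is_KL_def hecke_bar_diff)
    fix y k assume nz: "lookup (lookup (C - C') y) k \<noteq> 0"
    then have "lookup C y \<noteq> lookup C' y" by (auto simp: lookup_minus)
    then have "y \<noteq> w" using assms by (auto simp: is_KL_def)
    moreover have "lookup (lookup C y) k \<noteq> 0 \<or> lookup (lookup C' y) k \<noteq> 0"
      using nz by (auto simp: lookup_minus)
    ultimately show "k \<le> - int (len y) - 1" using assms unfolding is_KL_def by blast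
  qed
  then show ?thesis by simp
qed

lemma is_KL_one: "is_KL 1 (T 1)"
  by (auto simp: is_KL_def hecke_bar_T lookup_T lookup_one when_def split: if_splits)

text \<open>The inductive construction of the basis. Since \<open>D\<close> is only assumed correct
  below \<open>len w\<close>, this serves both the existence proof, before \<open>KL\<close> is
  available, and the product formula afterwards.\<close>

lemma is_KL_step:
  assumes C: "is_KL w C" and s: "\<not> desc w s"
    and D: "\<And>z. len z < len w \<Longrightarrow> is_KL z (D z)"
    and m_def: "\<And>z. m z = lookup (lookup C z) (- int (len z) - 1)"
    and Z_def: "Z = {z \<in> keys C. desc z s}"
  shows "is_KL (w * simple s) (C_right s C - (\<Sum>z\<in>Z. hscale (single 0 (m z)) (D z)))"
    (is "is_KL ?w ?h")
proof -
  have lw: "len ?w = Suc (len w)" using s by (rule len_not_desc)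
  have CD: "y \<le> w" "- int (len w) \<le> k" "even (k + int (len w))" "y \<noteq> w \<Longrightarrow> k \<le> - int (len y) - 1"
    if "lookup (lookup C y) k \<noteq> 0" for y k
    using C that by (auto simp: is_KL_def)
  have keysC: "z \<le> w" if "z \<in> keys C" for z
  proof -
    have "lookup C z \<noteq> 0" using that by (simp add: in_keys_iff)
    then obtain k where "lookup (lookup C z) k \<noteq> 0" by (metis lookup_zero poly_mapping_eqI)
    then show ?thesis using CD by blast
  qed
  have Zlen: "len z < len w" if "z \<in> Z" for z
    using that keysC[of z] le_affW_len[of z w] s by (auto simp: Z_def)
  have DD: "hecke_bar (D z) = D z" "lookup (D z) z = qhalf_pow (- int (len z))" if "z \<in> Z" for z
    using D[OF Zlen[OF that]] by (auto simp: is_KL_def)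
  have DD': "y \<le> z" "- int (len z) \<le> k" "even (k + int (len z))" "y \<noteq> z \<Longrightarrow> k \<le> - int (len y) - 1"
    if "z \<in> Z" "lookup (lookup (D z) y) k \<noteq> 0" for z y k
    using D[OF Zlen[OF that(1)]] that(2) by (auto simp: is_KL_def)
  have finZ: "finite Z" by (simp add: Z_def)
  \<comment> \<open>The coefficient of \<open>C_right s C\<close> at \<open>y\<close> and exponent
    \<open>k\<close>; next, \<open>a\<close> is that of the subtracted sum.\<close>
  define e where "e = (\<lambda>y k. if desc y s
      then lookup (lookup C (y * simple s)) (k + 1) + lookup (lookup C y) (k - 1)
      else lookup (lookup C y) (k + 1) + lookup (lookup C (y * simple s)) (k - 1))"
  define a where "a = (\<lambda>y k. \<Sum>z\<in>Z. m z * lookup (lookup (D z) y) k)"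
  have look: "lookup (lookup ?h y) k = e y k - a y k" for y k
    by (simp add: lookup_minus lookup_C_right lookup_add lookup_sum e_def a_def lookup_single_mult)
  have a_nz: "\<exists>z\<in>Z. m z \<noteq> 0 \<and> lookup (lookup (D z) y) k \<noteq> 0" if "a y k \<noteq> 0" for y k
    using that unfolding a_def by (metis (no_types, lifting) mult_not_zero sum.not_neutral_contains_not_neutral)
  have bar: "hecke_bar ?h = ?h"
  proof -
    have "hecke_bar C = C" using C by (simp add: is_KL_def)
    then show ?thesis
      by (simp add: hecke_bar_diff hecke_bar_C_right hecke_bar_sum hecke_bar_hscale laurent_bar_single DD)
  qed
  have top: "lookup ?h ?w = qhalf_pow (- int (len ?w))"
  proof (rule poly_mapping_eqI)
    fix k
    have "\<not> ?w \<le> w" using le_affW_len[of ?w w] lw by auto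
    then have "lookup (lookup C ?w) (k - 1) = 0" using CD(1) by blast
    moreover have "a ?w k = 0"
    proof (rule ccontr)
      assume "a ?w k \<noteq> 0"
      then obtain z where "z \<in> Z" "?w \<le> z" using a_nz DD'(1) by blast
      then show False using le_affW_len[of ?w z] Zlen[of z] lw by auto
    qed
    ultimately show "lookup (lookup ?h ?w) k = lookup (qhalf_pow (- int (len ?w))) k"
      using C s unfolding look by (simp add: e_def is_KL_def lookup_qhalf_pow lw)
  qed
  have rest: "y \<le> ?w \<and> - int (len ?w) \<le> k \<and> even (k + int (len ?w))"
    if nz: "lookup (lookup ?h y) k \<noteq> 0" for y k
  proof -
    have "e y k \<noteq> 0 \<or> a y k \<noteq> 0" using nz look by auto
    then consider (e1) "lookup (lookup C y) (k + 1) \<noteq> 0" | (e2) "lookup (lookup C y) (k - 1) \<noteq> 0"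
      | (e3) "lookup (lookup C (y * simple s)) (k + 1) \<noteq> 0"
      | (e4) "lookup (lookup C (y * simple s)) (k - 1) \<noteq> 0"
      | (a) z where "z \<in> Z" "m z \<noteq> 0" "lookup (lookup (D z) y) k \<noteq> 0"
      using a_nz unfolding e_def by (metis add.left_neutral add.right_neutral)
    then show ?thesis
    proof cases
      case e1
      then show ?thesis using CD(1-3)[OF e1] bruhat_mult_simple_up(1)[of y w s] s lw by auto
    next
      case e2
      then show ?thesis using CD(1-3)[OF e2] bruhat_mult_simple_up(1)[of y w s] s lw by auto
    next
      case e3
      then show ?thesis using CD(1-3)[OF e3] bruhat_mult_simple_up(2)[of "y * simple s" w s] s lw by auto
    next
      case e4
      then show ?thesis using CD(1-3)[OF e4] bruhat_mult_simple_up(2)[of "y * simple s" w s] s lw by auto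
    next
      case (a z)
      have "y \<le> ?w"
        using DD'(1)[OF a(1,3)] keysC[of z] a(1) bruhat_mult_simple_up(1)[of y w s] s
        by (auto simp: Z_def)
      moreover have "- int (len ?w) \<le> k" using DD'(2)[OF a(1,3)] Zlen[OF a(1)] lw by auto
      \<comment> \<open>A nonzero \<open>m z\<close> forces the lengths of \<open>z\<close> and
        \<open>w\<close> to have different parity.\<close>
      moreover have "even (- int (len z) - 1 + int (len w))"
        using CD(3)[of z "- int (len z) - 1"] a(2) m_def by auto
      then have "even (k + int (len ?w))" using DD'(3)[OF a(1,3)] lw by simp presburger
      ultimately show ?thesis by blast
    qed
  qed
  have deg: "lookup (lookup ?h y) k = 0" if y: "y \<noteq> ?w" and k: "\<not> k \<le> - int (len y) - 1" for y k
  proof (cases "desc y s")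
    case True
    \<comment> \<open>Beyond the degree bound only the exponent \<open>- len y\<close> can survive,
      with coefficient \<open>m y\<close>; the summand for \<open>z = y\<close> removes it.\<close>
    have ly: "int (len (y * simple s)) = int (len y) - 1" using len_desc[OF True] by simp
    have "y * simple s \<noteq> w" using y by auto
    then have "lookup (lookup C (y * simple s)) (k + 1) = 0"
      using CD(4)[of "y * simple s" "k + 1"] k ly by auto
    moreover have "y \<noteq> w" using True s by auto
    then have "lookup (lookup C y) (k - 1) = 0" if "k \<noteq> - int (len y)"
      using CD(4)[of y "k - 1"] k that by linarith
    then have "lookup (lookup C y) (k - 1) = (if k = - int (len y) then m y else 0)"
      using m_def[of y] by simp
    ultimately have e: "e y k = (if k = - int (len y) then m y else 0)" using True by (simp add: e_def)
    have "a y k = (\<Sum>z\<in>Z. if z = y then (if k = - int (len y) then m y else 0) else 0)"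
      unfolding a_def
    proof (rule sum.cong)
      fix z assume z: "z \<in> Z"
      show "m z * lookup (lookup (D z) y) k = (if z = y then if k = - int (len y) then m y else 0 else 0)"
        using DD'(4)[OF z, of y k] DD(2)[OF z] k by (auto simp: lookup_qhalf_pow)
    qed simp
    moreover have "m y = 0" if "y \<notin> Z"
      using that True m_def[of y] by (simp add: Z_def in_keys_iff)
    ultimately have "a y k = (if k = - int (len y) then m y else 0)" using finZ by simp
    then show ?thesis using e look by simp
  next
    case False
    have ly: "int (len (y * simple s)) = int (len y) + 1" using len_not_desc[OF False] by simp
    have "lookup (lookup C y) (k + 1) = 0"
      using CD(4)[of y "k + 1"] C k by (cases "y = w") (auto simp: is_KL_def lookup_qhalf_pow)
    moreover have "y * simple s \<noteq> w" using False s by (metis desc_mult_self)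
    then have "lookup (lookup C (y * simple s)) (k - 1) = 0"
      using CD(4)[of "y * simple s" "k - 1"] k ly by auto
    ultimately have "e y k = 0" using False by (simp add: e_def)
    moreover have "a y k = 0"
    proof (rule ccontr)
      assume "a y k \<noteq> 0"
      then obtain z where z: "z \<in> Z" "lookup (lookup (D z) y) k \<noteq> 0" using a_nz by blast
      then have "y \<noteq> z" using False by (auto simp: Z_def)
      then show False using DD'(4)[OF z] k by simp
    qed
    ultimately show ?thesis using look by simp
  qed
  show ?thesis unfolding is_KL_def using bar top rest deg by blast
qed

definition KL :: "affW \<Rightarrow> hecke" where
  "KL w = (THE C. is_KL w C)"

lemma is_KL_KL: "is_KL w (KL w)"
proof -
  have "\<exists>C. is_KL w C"
  proof (induction "len w" arbitrary: w rule: less_induct)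
    case less
    show ?case
    proof (cases "w = 1")
      case False
      then obtain s where s: "desc w s" using exists_desc by blast
      define x where "x = w * simple s"
      have x: "w = x * simple s" "\<not> desc x s" "len x < len w"
        using s by (auto simp: x_def) (simp add: desc_def)
      obtain C where "is_KL x C" using less x(3) by blast
      moreover have "is_KL z (SOME D. is_KL z D)" if "len z < len x" for z
        using less[of z] that x(3) by (meson less_trans someI_ex)
      ultimately show ?thesis
        using is_KL_step[of x C s "\<lambda>z. SOME D. is_KL z D" "\<lambda>z. lookup (lookup C z) (- int (len z) - 1)"] x
        by auto
    qed (use is_KL_one in blast)
  qed
  then show ?thesis unfolding KL_def by (metis is_KL_unique theI)
qed

lemma KL_eqI: "is_KL w C \<Longrightarrow> KL w = C"
  using is_KL_unique is_KL_KL by blast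

lemma KL_coeff:
  assumes "lookup (lookup (KL w) y) k \<noteq> 0"
  shows "y \<le> w" "- int (len w) \<le> k" "even (k + int (len w))" "y \<noteq> w \<Longrightarrow> k \<le> - int (len y) - 1"
  using is_KL_KL[of w] assms by (auto simp: is_KL_def)

lemma KL_top: "lookup (KL w) w = qhalf_pow (- int (len w))"
  using is_KL_KL[of w] by (auto simp: is_KL_def)

text \<open>The exponent is the largest one allowed for \<open>x < w\<close>. The value is 0 unless
  \<open>x < w\<close>, and, by the evenness in \<open>is_KL\<close>, also when the lengths have
  equal parity.\<close>

definition mu0 :: "affW \<Rightarrow> affW \<Rightarrow> int" where
  "mu0 x w = lookup (lookup (KL w) x) (- int (len x) - 1)"

lemma KL_mult_up:
  assumes "\<not> desc w s"
  shows "C_right s (KL w) =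
    KL (w * simple s) + (\<Sum>z\<in>{z \<in> keys (KL w). desc z s}. hscale (single 0 (mu0 z w)) (KL z))"
  using KL_eqI[OF is_KL_step[OF is_KL_KL assms is_KL_KL mu0_def refl]] by simp

text \<open>With \<open>w = x * simple s\<close>, the product formula expresses \<open>KL w\<close>
  through \<open>C_right s (KL x)\<close> and shorter basis elements with descent \<open>s\<close>;
  all of these are scaled by \<open>gap\<close>, the first one by
  \<open>C_right_square\<close>.\<close>

lemma KL_mult_down: "desc w s \<Longrightarrow> C_right s (KL w) = hscale gap (KL w)"
proof (induction "len w" arbitrary: w rule: less_induct)
  case less
  define x where "x = w * simple s"
  have x: "w = x * simple s" "\<not> desc x s" "len x < len w"
    using less.prems by (auto simp: x_def) (simp add: desc_def)
  let ?Z = "{z \<in> keys (KL x). desc z s}"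
  have Z: "C_right s (KL z) = hscale gap (KL z)" if "z \<in> ?Z" for z
  proof -
    obtain k where "lookup (lookup (KL x) z) k \<noteq> 0"
      using \<open>z \<in> ?Z\<close> by (metis (mono_tags) in_keys_iff lookup_zero mem_Collect_eq poly_mapping_eqI)
    then have "len z < len w" using KL_coeff(1) le_affW_len[of z x] x(3) by fastforce
    then show ?thesis using less.hyps that by blast
  qed
  have eq: "C_right s (KL x) = KL w + (\<Sum>z\<in>?Z. hscale (single 0 (mu0 z x)) (KL z))"
    using KL_mult_up[OF x(2)] x(1) by simp
  have "C_right s (C_right s (KL x)) = hscale gap (C_right s (KL x))" by (rule C_right_square)
  then show ?case unfolding eq
    by (simp add: hlinearD[OF hlinear_C_right] hscale_sum Z mult.commute)
qed

section \<open>Comparison of the basis with \<open>KL_family\<close> and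
  \<open>KL_mu\<close>\<close>

lemma lookup_poly_at_q:
  "lookup (poly_at_q p) k = (if 0 \<le> k \<and> even k then coeff p (nat (k div 2)) else 0)"
proof (induction p arbitrary: k)
  case 0
  then show ?case by (simp add: poly_at_q_def)
next
  case (pCons a p)
  have "poly_at_q (pCons a p) = single 0 a + q * poly_at_q p"
    by (simp add: poly_at_q_def map_poly_pCons flip: single_of_int)
  then have *: "lookup (poly_at_q (pCons a p)) k = (if k = 0 then a else 0) + lookup (poly_at_q p) (k - 2)"
    by (simp add: lookup_add lookup_single q_def when_def)
  show ?case
  proof (cases "0 \<le> k \<and> even k")
    case True
    then obtain j where j: "k = 2 * j" "0 \<le> j" by (auto elim!: evenE)
    show ?thesis
    proof (cases "j = 0")
      case False
      then have "nat j = Suc (nat (j - 1))" "(k - 2) div 2 = j - 1" using j by auto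
      then show ?thesis using j False unfolding * pCons.IH by simp
    next
      case True
      then show ?thesis unfolding * pCons.IH using j by simp
    qed
  next
    case False
    then have "\<not> (0 \<le> k - 2 \<and> even (k - 2))" "k \<noteq> 0" by auto
    then show ?thesis unfolding * pCons.IH using False by auto
  qed
qed

text \<open>Any family as in the definition yields an element satisfying \<open>is_KL\<close>, hence
  \<open>KL w\<close>. This is the uniqueness needed to evaluate the definite description in
  \<open>KL_poly\<close>.\<close>

lemma KL_family_coeff:
  assumes "KL_family w p"
  shows "coeff (p y) i = lookup (lookup (KL w) y) (2 * int i - int (len w))"
proof -
  obtain C where C: "\<And>y. lookup C y = qhalf_pow (- int (len w)) * poly_at_q (p y)" "hecke_bar C = C"
    using assms by (auto simp: KL_family_def)
  have look: "lookup (lookup C y) k = lookup (poly_at_q (p y)) (k + int (len w))" for y k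
    by (simp add: C)
  have "is_KL w C"
    unfolding is_KL_def
  proof (intro conjI allI impI)
    have "p w = 1" using assms by (simp add: KL_family_def)
    then show "lookup C w = qhalf_pow (- int (len w))"
      by (simp add: C poly_at_q_def)
    fix y k assume nz: "lookup (lookup C y) k \<noteq> 0"
    then have c: "0 \<le> k + int (len w)" "even (k + int (len w))"
      "coeff (p y) (nat ((k + int (len w)) div 2)) \<noteq> 0"
      unfolding look lookup_poly_at_q by (auto split: if_splits)
    then show "- int (len w) \<le> k" "even (k + int (len w))" by auto
    show le: "y \<le> w" using c(3) assms by (auto simp: KL_family_def)
    assume "y \<noteq> w"
    then have "real (degree (p y)) \<le> (real (len w) - real (len y) - 1) / 2"
      using assms le by (auto simp: KL_family_def)
    moreover have "nat ((k + int (len w)) div 2) \<le> degree (p y)" using c(3) by (rule le_degree)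
    then have "(k + int (len w)) div 2 \<le> int (degree (p y))" by simp
    then have "k + int (len w) \<le> 2 * int (degree (p y))" using c(2) by fastforce
    then have "real_of_int k + real (len w) \<le> 2 * real (degree (p y))" by linarith
    ultimately have "real_of_int k \<le> - real (len y) - 1" by (simp add: field_simps)
    then show "k \<le> - int (len y) - 1" by linarith
  qed (rule C)
  then have "KL w = C" by (rule KL_eqI)
  then show ?thesis by (simp add: look lookup_poly_at_q)
qed

lemma KL_family_exists: "\<exists>p. KL_family w p"
proof -
  define f where "f = (\<lambda>y i. lookup (lookup (KL w) y) (2 * int i - int (len w)))"
  define p where "p = (\<lambda>y. Abs_poly (f y))"
  have bound: "2 * int i - int (len w) \<le> (if y = w then - int (len w) else - int (len y) - 1)" "y \<le> w"
    if "f y i \<noteq> 0" for y i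
    using that KL_coeff[of w y "2 * int i - int (len w)"] KL_top[of w]
    by (auto simp: f_def lookup_qhalf_pow split: if_splits)
  have co: "coeff (p y) = f y" for y
    unfolding p_def
  proof (rule coeff_Abs_poly)
    show "f y i = 0" if "len w < i" for i
      using bound(1)[of y i] that by (cases "f y i = 0") (auto split: if_splits)
  qed
  have "KL_family w p"
    unfolding KL_family_def
  proof (intro conjI allI impI)
    show "p w = 1"
      by (rule poly_eqI) (simp add: co f_def KL_top lookup_qhalf_pow)
    show "p y = 0" if "\<not> y \<le> w" for y
      using bound(2)[of y] that by (intro poly_eqI) (auto simp: co)
    show "real (degree (p y)) \<le> (real (len w) - real (len y) - 1) / 2" if "y < w" for y
    proof (cases "p y = 0")
      case True
      then show ?thesis using less_affW_len[OF that] by simp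
    next
      case False
      then have "f y (degree (p y)) \<noteq> 0" using co by (metis leading_coeff_0_iff)
      from bound(1)[OF this] that have "2 * int (degree (p y)) - int (len w) \<le> - int (len y) - 1"
        by (auto split: if_splits)
      then have "2 * real (degree (p y)) - real (len w) \<le> - real (len y) - 1" by linarith
      then show ?thesis by simp
    qed
    show "\<exists>C. (\<forall>y. lookup C y = qhalf_pow (- int (len w)) * poly_at_q (p y)) \<and> hecke_bar C = C"
    proof (intro exI conjI allI)
      show "hecke_bar (KL w) = KL w" using is_KL_KL[of w] by (simp add: is_KL_def)
      show "lookup (KL w) y = qhalf_pow (- int (len w)) * poly_at_q (p y)" for y
      proof (rule poly_mapping_eqI)
        fix k
        show "lookup (lookup (KL w) y) k = lookup (qhalf_pow (- int (len w)) * poly_at_q (p y)) k"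
        proof (cases "0 \<le> k + int (len w) \<and> even (k + int (len w))")
          case True
          then show ?thesis by (simp add: lookup_poly_at_q co f_def)
        next
          case False
          then have "lookup (lookup (KL w) y) k = 0" using KL_coeff(2,3)[of w y k] by fastforce
          then show ?thesis using False by (auto simp: lookup_poly_at_q)
        qed
      qed
    qed
  qed
  then show ?thesis by blast
qed

lemma KL_mu_eq:
  assumes "u < w" "odd (len w - len u)"
  shows "KL_mu u w = mu0 u w"
proof -
  obtain p where p: "KL_family w p" using KL_family_exists by blast
  have "p' = p" if "KL_family w p'" for p'
    by (intro ext poly_eqI) (simp only: KL_family_coeff[OF that] KL_family_coeff[OF p])
  then have "(THE p. KL_family w p) = p" using p by (intro the_equality)
  then have "KL_poly u w = p u" by (simp add: KL_poly_def)
  moreover have "2 * int ((len w - len u - 1) div 2) - int (len w) = - int (len u) - 1"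
  proof -
    obtain j where "len w - len u = 2 * j + 1" using assms(2) by (rule oddE)
    then have "len w = len u + (2 * j + 1)" by linarith
    then show ?thesis by simp
  qed
  ultimately show ?thesis
    using assms(2) KL_family_coeff[OF p, of u] by (simp add: KL_mu_def mu0_def)
qed

subsection \<open>The W-graph\<close>

lemma mu0_less: "mu0 x w \<noteq> 0 \<Longrightarrow> x < w"
  using KL_coeff(1)[of w x] KL_top[of w]
  by (auto simp: mu0_def lookup_qhalf_pow less_affW_def)

lemma mu0_zero_len: "len w \<le> len x \<Longrightarrow> mu0 x w = 0"
  using mu0_less[of x w] less_affW_len[of x w] by fastforce

lemma gap_neq_zero: "gap \<noteq> 0"
proof
  assume "gap = 0"
  then have "lookup gap 1 = 0" by simp
  then show False by (simp add: gap_def lookup_add lookup_qhalf_pow)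
qed

text \<open>Elements in the image of \<open>C_right s\<close> have equal coefficients at
  \<open>x\<close> and \<open>x * simple s\<close>, and \<open>gap\<close> times \<open>KL w\<close>
  lies in that image.\<close>

lemma KL_coeff_desc:
  assumes "desc w s" shows "lookup (KL w) (x * simple s) = lookup (KL w) x"
proof -
  have "lookup (C_right s (KL w)) (x * simple s) = lookup (C_right s (KL w)) x"
    by (auto simp: lookup_C_right)
  then show ?thesis using gap_neq_zero by (simp add: KL_mult_down[OF assms])
qed

text \<open>Passing to \<open>u * simple s\<close> keeps the coefficient but lowers the degree bound
  by one, so the exponent in question survives only if \<open>u * simple s\<close> is
  \<open>w\<close> itself.\<close>

lemma mu0_desc:
  assumes "desc w s" "\<not> desc u s"
  shows "mu0 u w = (if w = u * simple s then 1 else 0)"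
proof -
  have l: "int (len (u * simple s)) = int (len u) + 1" using len_not_desc[OF assms(2)] by simp
  have "mu0 u w = lookup (lookup (KL w) (u * simple s)) (- int (len (u * simple s)))"
    by (simp add: mu0_def KL_coeff_desc[OF assms(1)] l)
  moreover have "\<dots> = 0" if "w \<noteq> u * simple s"
    using KL_coeff(4)[of w "u * simple s" "- int (len (u * simple s))"] that by fastforce
  ultimately show ?thesis by (auto simp: KL_top lookup_qhalf_pow)
qed

definition mu :: "affW \<Rightarrow> affW \<Rightarrow> int" where
  "mu x y = mu0 x y + mu0 y x"

lemma mu_sym: "mu x y = mu y x"
  by (simp add: mu_def)

lemma mu_neq_zero_cases:
  assumes "mu x y \<noteq> 0"
  obtains "mu0 x y = mu x y" "x < y" | "mu0 y x = mu x y" "y < x"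
proof -
  consider "mu0 x y \<noteq> 0" | "mu0 y x \<noteq> 0" using assms unfolding mu_def by fastforce
  then show ?thesis
  proof cases
    case 1
    then have "x < y" by (rule mu0_less)
    then have "mu0 y x = 0" using mu0_less[of y x] by fastforce
    then show ?thesis using that(1) \<open>x < y\<close> by (simp add: mu_def)
  next
    case 2
    then have "y < x" by (rule mu0_less)
    then have "mu0 x y = 0" using mu0_less[of x y] by fastforce
    then show ?thesis using that(2) \<open>y < x\<close> by (simp add: mu_def)
  qed
qed

lemma mu_len_less: "len x < len y \<Longrightarrow> mu x y = mu0 x y"
  by (simp add: mu_def mu0_zero_len)

lemma mu_mult_simple: "mu x (x * simple s) = 1"
proof (cases "desc x s")
  case False
  then show ?thesis using mu0_desc[of "x * simple s" s x] len_not_desc[OF False]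
    by (simp add: mu_len_less)
next
  case True
  then show ?thesis using mu0_desc[of x s "x * simple s"] len_desc[OF True]
    by (simp add: mu_len_less mu_sym[of x])
qed

lemma mu_desc_greater:
  assumes "mu z w \<noteq> 0" "desc z s" "\<not> desc w s" "w < z"
  shows "z = w * simple s"
proof (rule ccontr)
  assume "z \<noteq> w * simple s"
  then have "mu0 w z = 0" using mu0_desc[of z s w] assms by auto
  moreover have "mu0 z w = 0" using mu0_less[of z w] assms(4) by fastforce
  ultimately show False using assms(1) by (simp add: mu_def)
qed

definition up_nbrs :: "gen \<Rightarrow> affW \<Rightarrow> affW set" where
  "up_nbrs s w = {z. desc z s \<and> mu z w \<noteq> 0}"

lemma finite_mu: "\<not> desc w s \<Longrightarrow> finite (up_nbrs s w)"
proof -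
  assume s: "\<not> desc w s"
  have "up_nbrs s w \<subseteq> insert (w * simple s) (keys (KL w))"
  proof
    fix z assume z: "z \<in> up_nbrs s w"
    then have "mu z w \<noteq> 0" "desc z s" by (auto simp: up_nbrs_def)
    then show "z \<in> insert (w * simple s) (keys (KL w))"
    proof (cases rule: mu_neq_zero_cases)
      case 1
      then have "lookup (KL w) z \<noteq> 0" using \<open>mu z w \<noteq> 0\<close> by (auto simp: mu0_def)
      then show ?thesis by (simp add: in_keys_iff)
    next
      case 2
      then show ?thesis using mu_desc_greater \<open>mu z w \<noteq> 0\<close> \<open>desc z s\<close> s by blast
    qed
  qed
  then show ?thesis by (rule finite_subset) simp
qed

text \<open>For the symmetric \<open>mu\<close> the leading term \<open>w * simple s\<close> of the
  product is a neighbour like any other, of weight 1.\<close>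

lemma KL_mult_nbrs:
  assumes "\<not> desc w s"
  shows "C_right s (KL w) = (\<Sum>z\<in>up_nbrs s w. hscale (single 0 (mu z w)) (KL z))"
proof -
  let ?Z = "{z \<in> keys (KL w). desc z s}" and ?f = "\<lambda>z. hscale (single 0 (mu z w)) (KL z)"
  have lw: "len (w * simple s) = Suc (len w)" using assms by (rule len_not_desc)
  have nin: "w * simple s \<notin> ?Z"
  proof
    assume "w * simple s \<in> ?Z"
    then obtain k where "lookup (lookup (KL w) (w * simple s)) k \<noteq> 0"
      by (metis (mono_tags) in_keys_iff lookup_zero mem_Collect_eq poly_mapping_eqI)
    then show False using KL_coeff(1) le_affW_len lw by fastforce
  qed
  have "(\<Sum>z\<in>?Z. hscale (single 0 (mu0 z w)) (KL z)) = (\<Sum>z\<in>?Z. ?f z)"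
  proof (rule sum.cong)
    fix z assume z: "z \<in> ?Z"
    then have "z \<noteq> w * simple s" using nin by auto
    then have "mu0 w z = 0" using mu0_desc[of z s w] z assms by simp
    then show "hscale (single 0 (mu0 z w)) (KL z) = ?f z" by (simp add: mu_def)
  qed simp
  moreover have "KL (w * simple s) = ?f (w * simple s)" by (simp add: mu_sym[of _ w] mu_mult_simple)
  ultimately have "C_right s (KL w) = (\<Sum>z\<in>insert (w * simple s) ?Z. ?f z)"
    using KL_mult_up[OF assms] nin by simp
  also have "\<dots> = (\<Sum>z\<in>up_nbrs s w. ?f z)"
  proof (rule sum.mono_neutral_right)
    show "up_nbrs s w \<subseteq> insert (w * simple s) ?Z"
    proof
      fix z assume z: "z \<in> up_nbrs s w"
      then have "mu z w \<noteq> 0" "desc z s" by (auto simp: up_nbrs_def)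
      then show "z \<in> insert (w * simple s) ?Z"
      proof (cases rule: mu_neq_zero_cases)
        case 1
        then have "lookup (KL w) z \<noteq> 0" using \<open>mu z w \<noteq> 0\<close> by (auto simp: mu0_def)
        then show ?thesis using \<open>desc z s\<close> by (simp add: in_keys_iff)
      next
        case 2
        then show ?thesis using mu_desc_greater \<open>mu z w \<noteq> 0\<close> \<open>desc z s\<close> assms by blast
      qed
    qed
  qed (use assms in \<open>auto simp: up_nbrs_def\<close>)
  finally show ?thesis .
qed

subsection \<open>Star operations\<close>

lemma mu_star_value:
  assumes "in_D t s w" "in_D s t z"
  shows "mu z w = (if z = star t s w then 1 else 0)"
proof (cases "mu z w = 0")
  case True
  have "star t s w = w * simple t \<or> star t s w = w * simple s" by (simp add: star_def)
  then have "mu (star t s w) w = 1" using mu_mult_simple[of w] by (auto simp: mu_sym[of _ w])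
  then show ?thesis using True by auto
next
  case False
  have d: "s \<noteq> t" "desc w t" "\<not> desc w s" "desc z s" "\<not> desc z t"
    using assms by (auto simp: in_D_def)
  from False have "z = star t s w"
  proof (cases rule: mu_neq_zero_cases)
    case 1
    then have "z = w * simple t" using mu_desc_greater[of w z t] False d by (auto simp: mu_sym)
    then show ?thesis using d by (simp add: star_def)
  next
    case 2
    then have "z = w * simple s" using mu_desc_greater[of z w s] False d by auto
    then show ?thesis using d desc_up_iff[of s t w] by (auto simp: star_def)
  qed
  moreover have "star t s w = w * simple t \<or> star t s w = w * simple s" by (simp add: star_def)
  then have "mu (star t s w) w = 1" using mu_mult_simple[of w] by (auto simp: mu_sym[of _ w])
  ultimately show ?thesis by simp
qed

text \<open>The coefficient of \<open>C_right s (KL w)\<close> at \<open>x\<close> and exponent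
  \<open>- len x - 1\<close>, once read off directly and once from the expansion over the neighbours
  of \<open>w\<close>.\<close>

lemma mu0_star_sum:
  assumes x: "in_D s t x" and w: "in_D t s w"
  shows "mu0 (x * simple s) w + mu0 (x * simple t) w =
    mu0 x (star t s w) + (if desc (x * simple t) s then mu (x * simple t) w else 0)"
proof -
  have d: "s \<noteq> t" "desc w t" "\<not> desc w s" "desc x s" "\<not> desc x t"
    using assms by (auto simp: in_D_def)
  have ls: "int (len (x * simple s)) = int (len x) - 1" using len_desc[OF d(4)] by simp
  have lt: "int (len (x * simple t)) = int (len x) + 1" using len_not_desc[OF d(5)] by simp
  let ?e = "- int (len x) - 1"
  have "lookup (lookup (C_right s (KL w)) x) ?e = mu0 (x * simple s) w + mu0 (x * simple t) w"
    using d KL_coeff_desc[OF d(2), of x] by (simp add: lookup_C_right lookup_add mu0_def ls lt)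
  moreover have "lookup (lookup (C_right s (KL w)) x) ?e = (\<Sum>z\<in>up_nbrs s w. mu z w * mu0 x z)"
    by (simp add: KL_mult_nbrs[OF d(3)] lookup_sum lookup_single_mult mu0_def)
  moreover have "(\<Sum>z\<in>up_nbrs s w. mu z w * mu0 x z) =
    (\<Sum>z\<in>{x * simple t, star t s w}. if desc z s then mu z w * mu0 x z else 0)"
  proof -
    \<comment> \<open>If \<open>z\<close> has both descents, it can be joined to \<open>x\<close>
      only as \<open>x * simple t\<close>; if it has \<open>s\<close> but not \<open>t\<close>, it
      can be joined to \<open>w\<close> only as the star partner of \<open>w\<close>.\<close>
    have z: "z = x * simple t \<or> z = star t s w" if "desc z s" "mu z w \<noteq> 0" "mu0 x z \<noteq> 0" for z
    proof (cases "desc z t")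
      case True
      then show ?thesis using mu0_desc[of z t x] d that by (auto split: if_splits)
    next
      case False
      then have "in_D s t z" using d that by (simp add: in_D_def)
      then show ?thesis using mu_star_value[OF w, of z] that by (auto split: if_splits)
    qed
    let ?g = "\<lambda>z. if desc z s then mu z w * mu0 x z else 0"
    have "(\<Sum>z\<in>up_nbrs s w. mu z w * mu0 x z) = sum ?g (up_nbrs s w)"
      by (intro sum.cong) (auto simp: up_nbrs_def)
    also have "\<dots> = sum ?g (up_nbrs s w \<union> {x * simple t, star t s w})"
      using finite_mu[OF d(3)] by (intro sum.mono_neutral_left) (auto simp: up_nbrs_def)
    also have "\<dots> = sum ?g {x * simple t, star t s w}"
      using finite_mu[OF d(3)] z by (intro sum.mono_neutral_right) auto
    finally show ?thesis .
  qed
  moreover have "x * simple t \<noteq> star t s w"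
    using d in_D_star(1)[OF w] unfolding in_D_def by (metis desc_mult_self)
  moreover have "desc (star t s w) s" using in_D_star(1)[OF w] by (simp add: in_D_def)
  moreover have "mu (star t s w) w = 1" using mu_star_value[OF w in_D_star(1)[OF w]] by simp
  moreover have "mu0 x (x * simple t) = 1" using mu0_desc[of "x * simple t" t x] d by simp
  ultimately show ?thesis by (auto split: if_splits)
qed

lemma mu0_star:
  assumes x: "in_D s t x" and w: "in_D t s w"
  shows "mu0 (star s t x) w = mu0 x (star t s w)
    + (if desc (x * simple s) t then (if x * simple t = w * simple s then 1 else 0)
       else - (if w = x * simple s * simple t then 1 else 0))"
proof -
  have d: "s \<noteq> t" "desc w t" "\<not> desc w s" "desc x s" "\<not> desc x t"
    using assms by (auto simp: in_D_def)
  have iff: "desc (x * simple t) s \<longleftrightarrow> desc (x * simple s) t"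
    using desc_up_iff[of t s x] d by auto
  show ?thesis
  proof (cases "desc (x * simple s) t")
    case True
    then have "mu0 w (x * simple t) = (if x * simple t = w * simple s then 1 else 0)"
      using mu0_desc[of "x * simple t" s w] d iff by auto
    then show ?thesis using True mu0_star_sum[OF assms] iff by (simp add: star_def mu_def)
  next
    case False
    then have "mu0 (x * simple s) w = (if w = x * simple s * simple t then 1 else 0)"
      using mu0_desc[of w t "x * simple s"] d by auto
    then show ?thesis using False mu0_star_sum[OF assms] iff by (simp add: star_def)
  qed
qed

text \<open>The correction terms of \<open>mu0_star\<close> come from edges given by one generator.
  Those for \<open>x\<close> and \<open>w\<close> and those for the star partners in reverse order
  cancel in the symmetric sum.\<close>

lemma mu_star:
  assumes x: "in_D s t x" and w: "in_D t s w"
  shows "mu (star s t x) w = mu x (star t s w)"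
proof -
  define x' where "x' = star s t x"
  define w' where "w' = star t s w"
  note x' = in_D_star[OF x, folded x'_def] and w' = in_D_star[OF w, folded w'_def]
  have 1: "mu0 x' w = mu0 x w'
    + (if desc (x * simple s) t then (if x * simple t = w * simple s then 1 else 0)
       else - (if w = x * simple s * simple t then 1 else 0))"
    using mu0_star[OF x w] by (simp add: x'_def w'_def)
  have 2: "mu0 w x' = mu0 w' x
    + (if desc (w' * simple s) t then (if w' * simple t = x' * simple s then 1 else 0)
       else - (if x' = w' * simple s * simple t then 1 else 0))"
    using mu0_star[OF w'(1) x'(1)] by (simp add: x'(2) w'(2))
  have "(if desc (x * simple s) t then (if x * simple t = w * simple s then 1 else 0)
       else - (if w = x * simple s * simple t then 1 else 0)) +
    (if desc (w' * simple s) t then (if w' * simple t = x' * simple s then 1 else 0)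
       else - (if x' = w' * simple s * simple t then 1 else 0)) = (0 :: int)"
    using x
  proof (cases rule: in_D_cases)
    case (short x0)
    note dx = min_rep_desc[OF short(1)]
    have xs: "x = x0 * simple s" "x' = x0 * simple s * simple t" using short by (simp_all add: x'_def)
    show ?thesis using w'(1)
    proof (cases rule: in_D_cases)
      case (short w0)
      note dw = min_rep_desc[OF short(1)]
      have ws: "w' = w0 * simple s" "w = w0 * simple s * simple t" using short w'(2) by simp_all
      have "x0 * simple s \<noteq> w0" using dx dw by auto
      moreover have "w0 * simple s \<noteq> x0" using dx dw by auto
      ultimately show ?thesis using dx dw by (simp add: xs ws)
    next
      case (long w0)
      note dw = min_rep_desc[OF long(1)]
      have ws: "w' = w0 * simple t * simple s" "w = w0 * simple t" using long w'(2) by simp_all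
      have "w0 * simple t * simple s * simple t = w0 * simple s * simple t * simple s"
        using braid_right[of s t w0] long(1) by (simp add: min_rep_def)
      then show ?thesis using dx dw by (auto simp: xs ws)
    qed
  next
    case (long x0)
    note dx = min_rep_desc[OF long(1)]
    have xs: "x = x0 * simple t * simple s" "x' = x0 * simple t" using long by (simp_all add: x'_def)
    have bx: "x0 * simple t * simple s * simple t = x0 * simple s * simple t * simple s"
      using braid_right[of s t x0] long(1) by (simp add: min_rep_def)
    show ?thesis using w'(1)
    proof (cases rule: in_D_cases)
      case (short w0)
      note dw = min_rep_desc[OF short(1)]
      have ws: "w' = w0 * simple s" "w = w0 * simple s * simple t" using short w'(2) by simp_all
      show ?thesis using dx dw by (auto simp: xs ws bx)
    next
      case (long w0)
      note dw = min_rep_desc[OF long(1)]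
      have ws: "w' = w0 * simple t * simple s" "w = w0 * simple t" using long w'(2) by simp_all
      have "w0 \<noteq> x0 * simple s * simple t * simple s * simple s * simple t"
        using dx dw by auto
      moreover have "w0 * simple t * simple s * simple t \<noteq> x0 * simple t * simple s"
        using dx dw by metis
      ultimately show ?thesis using dx dw by (auto simp: xs ws bx mult_simple_eq_iff)
    qed
  qed
  then show ?thesis using 1 2 by (simp add: mu_def flip: x'_def w'_def)
qed

subsection \<open>The braid relation on the W-graph\<close>

text \<open>Every \<open>T w\<close> arises from \<open>T 1\<close> by left operators, which commute
  with the right ones, so the relation need only be checked at \<open>T 1\<close>.\<close>

lemma T_right_braid:
  assumes "s \<noteq> t"
  shows "T_right s (T_right t (T_right s h)) = T_right t (T_right s (T_right t h))"
proof -
  let ?F = "\<lambda>h. T_right s (T_right t (T_right s h))" and ?G = "\<lambda>h. T_right t (T_right s (T_right t h))"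
  have "min_rep s t 1" using assms by (simp add: min_rep_def)
  note d = min_rep_desc[OF this]
  have one: "?F (T 1) = ?G (T 1)"
    using d braid[OF assms] by (simp add: T_right_T mult.assoc flip: mult.assoc)
  have fold: "T_right a (foldr T_simple_mult xs h) = foldr T_simple_mult xs (T_right a h)" for a xs h
    by (induction xs) (simp_all flip: T_left_right_commute)
  have "hlinear ?F" "hlinear ?G" by (simp_all add: hlinear_def hlinearD[OF hlinear_T_right])
  moreover have "?F (T w) = ?G (T w)" for w
  proof -
    obtain xs where "reduced_expr w xs" using reduced_expr_exists by blast
    then have "T w = foldr T_simple_mult xs (T 1)" by (simp add: foldr_left_reduced)
    then show ?thesis by (simp add: fold one)
  qed
  ultimately show ?thesis by (rule hlinear_eqI[where F = ?F and G = ?G])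
qed

text \<open>Both sides are \<open>h\<close> times the Kazhdan-Lusztig element of the longest element
  of the dihedral group, that is, the sum over its six elements scaled by
  \<open>qhalf_pow (-3)\<close>.\<close>

lemma C_right_braid:
  assumes "s \<noteq> t"
  shows "C_right s (C_right t (C_right s h)) - C_right s h = C_right t (C_right s (C_right t h)) - C_right t h"
proof -
  have *: "C_right s (C_right t (C_right s h)) - C_right s h =
    hscale (qhalf_pow (-3)) (h + T_right s h + T_right t h + T_right s (T_right t h)
      + T_right t (T_right s h) + T_right s (T_right t (T_right s h)))" for s t
  proof (rule poly_mapping_eqI)
    fix y
    let ?A = "lookup (T_right s h) y" and ?H = "lookup h y"
    let ?B = "lookup (T_right t h) y + lookup (T_right s (T_right t h)) y
      + lookup (T_right t (T_right s h)) y + lookup (T_right s (T_right t (T_right s h))) y"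
    have "lookup (C_right s (C_right t (C_right s h))) y =
      qhalf_pow (-3) * (?H + ?A + ?A + ((q - 1) * ?A + q * ?H) + ?B)"
      by (simp add: C_right_def hlinearD[OF hlinear_T_right] T_right_square lookup_add
        distrib_left qhalf_pow_mult flip: mult.assoc)
    also have "\<dots> = qhalf_pow (-3) * (?H + ?A + ?B) + qhalf_pow (-1) * (?H + ?A)"
    proof -
      have "?H + ?A + ?A + ((q - 1) * ?A + q * ?H) + ?B = (?H + ?A + ?B) + q * (?H + ?A)"
        by (simp add: algebra_simps)
      then show ?thesis by (simp only: distrib_left[of "qhalf_pow (-3)"] q_def qhalf_pow_mult_left) simp
    qed
    finally show "lookup (C_right s (C_right t (C_right s h)) - C_right s h) y = lookup
      (hscale (qhalf_pow (-3)) (h + T_right s h + T_right t h + T_right s (T_right t h)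
      + T_right t (T_right s h) + T_right s (T_right t (T_right s h)))) y"
      by (simp add: lookup_minus lookup_add C_right_def algebra_simps)
  qed
  show ?thesis unfolding * T_right_braid[OF assms] by (simp add: algebra_simps)
qed

text \<open>Elements of the Hecke algebra written in the Kazhdan-Lusztig basis are again stored as
  finitely supported functions, with \<open>T z\<close> standing for \<open>KL z\<close>.\<close>

definition from_KL :: "hecke \<Rightarrow> hecke" where
  "from_KL = lin_ext KL"

lemma hlinear_from_KL [simp]: "hlinear from_KL"
  unfolding from_KL_def by (rule hlinear_lin_ext)

lemma from_KL_T [simp]: "from_KL (T w) = KL w"
  by (simp add: from_KL_def)

text \<open>Linear independence of the Kazhdan-Lusztig basis, from triangularity at an element of
  greatest length.\<close>

lemma from_KL_eq_zero:
  assumes "from_KL g = 0" shows "g = 0"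
proof (rule ccontr)
  assume "g \<noteq> 0"
  then have "keys g \<noteq> {}" by simp
  then obtain y where y: "y \<in> keys g" "\<And>z. z \<in> keys g \<Longrightarrow> len z \<le> len y"
    using obtains_MAX[of "keys g" len] by (metis Max_ge finite_imageI finite_keys imageI)
  have "lookup (KL z) y = 0" if "z \<in> keys g" "z \<noteq> y" for z
  proof (rule ccontr)
    assume "lookup (KL z) y \<noteq> 0"
    then obtain k where "lookup (lookup (KL z) y) k \<noteq> 0" by (metis lookup_zero poly_mapping_eqI)
    then have "y \<le> z" by (rule KL_coeff(1))
    then show False using le_affW_len[of y z] that y(2)[of z] by auto
  qed
  then have "lookup (from_KL g) y = (\<Sum>z\<in>{y}. lookup g z * lookup (KL z) y)"
    unfolding from_KL_def lin_ext_def lookup_sum lookup_hscale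
    using y(1) by (intro sum.mono_neutral_right) auto
  then have "lookup g y * qhalf_pow (- int (len y)) = 0" using assms by (simp add: KL_top)
  moreover have "qhalf_pow k \<noteq> 0" for k by (metis lookup_qhalf_pow lookup_zero zero_neq_one)
  ultimately show False using y(1) by (simp add: in_keys_iff)
qed

text \<open>The matrix of \<open>C_right s\<close> in the Kazhdan-Lusztig basis.\<close>

definition KL_right :: "gen \<Rightarrow> hecke \<Rightarrow> hecke" where
  "KL_right s = lin_ext (\<lambda>w. if desc w s then hscale gap (T w)
     else \<Sum>z\<in>up_nbrs s w. hscale (single 0 (mu z w)) (T z))"

lemma hlinear_KL_right [simp]: "hlinear (KL_right s)"
  unfolding KL_right_def by (rule hlinear_lin_ext)

lemma from_KL_KL_right: "from_KL (KL_right s g) = C_right s (from_KL g)"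
proof -
  have "hlinear (\<lambda>g. from_KL (KL_right s g))" "hlinear (\<lambda>g. C_right s (from_KL g))"
    by (rule hlinear_comp[OF hlinear_from_KL hlinear_KL_right],
      rule hlinear_comp[OF hlinear_C_right hlinear_from_KL])
  moreover have "from_KL (KL_right s (T w)) = C_right s (from_KL (T w))" for w
    by (simp add: KL_right_def hlinearD[OF hlinear_from_KL] KL_mult_down KL_mult_nbrs)
  ultimately show ?thesis
    by (rule hlinear_eqI[where F = "\<lambda>g. from_KL (KL_right s g)" and G = "\<lambda>g. C_right s (from_KL g)"])
qed

lemma lookup_KL_right:
  "lookup (KL_right s g) z = (if desc z s
     then gap * lookup g z + (\<Sum>w\<in>{w \<in> keys g. \<not> desc w s}. lookup g w * single 0 (mu z w)) else 0)"
proof -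
  let ?f = "\<lambda>w. if desc w s then hscale gap (T w)
     else \<Sum>z\<in>up_nbrs s w. hscale (single 0 (mu z w)) (T z)"
  have f: "lookup (?f w) z = (if desc w s then (if w = z then gap else 0)
      else if desc z s then single 0 (mu z w) else 0)" for w
  proof (cases "desc w s")
    case False
    have "lookup (\<Sum>z\<in>up_nbrs s w. hscale (single 0 (mu z w)) (T z)) z =
      (\<Sum>x\<in>up_nbrs s w. if x = z then single 0 (mu z w) else 0)"
      unfolding lookup_sum lookup_hscale lookup_T by (intro sum.cong) auto
    also have "\<dots> = (if desc z s then single 0 (mu z w) else 0)"
      using finite_mu[OF False] by (auto simp: up_nbrs_def)
    finally show ?thesis using False by simp
  qed (auto simp: lookup_T)
  have "lookup (KL_right s g) z = (\<Sum>w\<in>keys g. lookup g w * lookup (?f w) z)"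
    unfolding KL_right_def lin_ext_def lookup_sum lookup_hscale ..
  also have "\<dots> = (\<Sum>w\<in>keys g. (if w = z then if desc z s then lookup g z * gap else 0 else 0) +
      (if \<not> desc w s then if desc z s then lookup g w * single 0 (mu z w) else 0 else 0))"
    unfolding f by (intro sum.cong) auto
  also have "\<dots> = (if desc z s then gap * lookup g z + (\<Sum>w\<in>{w \<in> keys g. \<not> desc w s}. lookup g w * single 0 (mu z w)) else 0)"
    unfolding sum.distrib by (auto simp: sum.inter_filter[symmetric] in_keys_iff mult.commute)
  finally show ?thesis .
qed

definition D_nbrs :: "gen \<Rightarrow> gen \<Rightarrow> affW \<Rightarrow> affW set" where
  "D_nbrs s t w = {x. in_D s t x \<and> mu x w \<noteq> 0}"

text \<open>The sum counts weighted paths from \<open>w\<close> to \<open>z\<close> that pass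
  through a star pair; within the descents involved, \<open>mu_star_value\<close> leaves the star
  partner as the only middle step.\<close>

lemma lookup_KL_right_triple:
  assumes "s \<noteq> t" "\<not> desc w s" "\<not> desc w t" "desc z s" "desc z t"
  shows "lookup (lookup (KL_right s (KL_right t (KL_right s (T w))) - KL_right s (T w)) z) 0 =
    mu z w + (\<Sum>x\<in>D_nbrs s t w. mu x w * mu z (star s t x))"
proof -
  define h1 where "h1 = KL_right s (T w)"
  define h2 where "h2 = KL_right t h1"
  have keysT: "keys (T w) = {w}" by (simp add: T_def)
  have h1: "lookup h1 x = (if desc x s then single 0 (mu x w) else 0)" for x
  proof -
    have "{v. v = w \<and> \<not> desc v s} = {w}" using assms(2) by auto
    then show ?thesis unfolding h1_def lookup_KL_right keysT using assms(2) by (auto simp: lookup_T)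
  qed
  have nz: "single 0 c \<noteq> (0 :: laurent) \<longleftrightarrow> c \<noteq> 0" for c
    by (metis lookup_single_eq lookup_zero single_zero)
  have keys1: "{x \<in> keys h1. \<not> desc x t} = D_nbrs s t w"
    using assms(1) by (auto simp: in_keys_iff h1 nz D_nbrs_def in_D_def)
  have fin: "finite (D_nbrs s t w)" using keys1 by (metis finite_Collect_conjI finite_keys Collect_mem_eq)
  have h2: "lookup h2 y = single 0 (mu (star t s y) w)" if y: "in_D t s y" for y
  proof -
    have d: "desc y t" "\<not> desc y s" using y by (auto simp: in_D_def)
    have "lookup h2 y = (\<Sum>x\<in>D_nbrs s t w. single 0 (mu x w) * single 0 (mu y x))"
      unfolding h2_def lookup_KL_right keys1 using d
      by (auto simp: h1 D_nbrs_def in_D_def intro!: sum.cong)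
    also have "\<dots> = (\<Sum>x\<in>D_nbrs s t w. if x = star t s y then single 0 (mu x w) else 0)"
    proof (rule sum.cong)
      fix x assume "x \<in> D_nbrs s t w"
      then have "mu y x = (if x = star t s y then 1 else 0)"
        using mu_star_value[OF y, of x] by (simp add: D_nbrs_def mu_sym)
      then show "single 0 (mu x w) * single 0 (mu y x) = (if x = star t s y then single 0 (mu x w) else 0)"
        by simp
    qed simp
    also have "\<dots> = single 0 (mu (star t s y) w)"
      using fin in_D_star(1)[OF y] by (auto simp: D_nbrs_def)
    finally show ?thesis .
  qed
  have h2z: "lookup h2 z = gap * single 0 (mu z w) + single 0 (\<Sum>x\<in>D_nbrs s t w. mu x w * mu z x)"
  proof -
    have "(\<Sum>x\<in>D_nbrs s t w. lookup h1 x * single 0 (mu z x)) = (\<Sum>x\<in>D_nbrs s t w. single 0 (mu x w * mu z x))"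
      by (intro sum.cong) (auto simp: h1 D_nbrs_def in_D_def mult_single)
    also have "\<dots> = single 0 (\<Sum>x\<in>D_nbrs s t w. mu x w * mu z x)"
      by (rule poly_mapping_eqI) (auto simp: lookup_sum lookup_single when_def)
    finally show ?thesis unfolding h2_def lookup_KL_right keys1 using assms by (simp add: h1)
  qed
  have keys2: "{y \<in> keys h2. \<not> desc y s} = star s t ` D_nbrs s t w"
  proof (intro set_eqI iffI)
    fix y assume y: "y \<in> {y \<in> keys h2. \<not> desc y s}"
    then have "in_D t s y"
      using assms(1) unfolding h2_def in_keys_iff lookup_KL_right in_D_def by (auto split: if_splits)
    moreover from this have "mu (star t s y) w \<noteq> 0" using y h2 by (auto simp: in_keys_iff)
    ultimately show "y \<in> star s t ` D_nbrs s t w"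
      using in_D_star[of t s y] by (auto simp: D_nbrs_def intro!: image_eqI[of _ _ "star t s y"])
  next
    fix y assume "y \<in> star s t ` D_nbrs s t w"
    then obtain x where x: "in_D s t x" "mu x w \<noteq> 0" "y = star s t x" by (auto simp: D_nbrs_def)
    then have "in_D t s y" "star t s y = x" using in_D_star by auto
    then show "y \<in> {y \<in> keys h2. \<not> desc y s}" using h2[of y] x nz by (auto simp: in_keys_iff in_D_def)
  qed
  have "lookup (KL_right s h2) z = gap * lookup h2 z +
    (\<Sum>y\<in>star s t ` D_nbrs s t w. lookup h2 y * single 0 (mu z y))"
    unfolding lookup_KL_right keys2 using assms by simp
  also have "(\<Sum>y\<in>star s t ` D_nbrs s t w. lookup h2 y * single 0 (mu z y)) =
    (\<Sum>x\<in>D_nbrs s t w. lookup h2 (star s t x) * single 0 (mu z (star s t x)))"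
  proof (rule sum.reindex_cong[of "star s t"])
    show "inj_on (star s t) (D_nbrs s t w)"
      by (rule inj_on_inverseI[of _ "star t s"]) (auto simp: D_nbrs_def in_D_star)
  qed auto
  also have "\<dots> = (\<Sum>x\<in>D_nbrs s t w. single 0 (mu x w * mu z (star s t x)))"
    by (intro sum.cong) (auto simp: D_nbrs_def h2 in_D_star mult_single)
  also have "\<dots> = single 0 (\<Sum>x\<in>D_nbrs s t w. mu x w * mu z (star s t x))"
    by (rule poly_mapping_eqI) (auto simp: lookup_sum lookup_single when_def)
  finally have "lookup (KL_right s h2 - h1) z = gap * (gap * single 0 (mu z w))
      + gap * single 0 (\<Sum>x\<in>D_nbrs s t w. mu x w * mu z x)
      + single 0 (\<Sum>x\<in>D_nbrs s t w. mu x w * mu z (star s t x)) - single 0 (mu z w)"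
    using assms by (simp add: lookup_minus h2z h1 distrib_left)
  \<comment> \<open>\<open>gap\<close> has no constant term and \<open>gap * gap\<close> has
    constant term 2: the middle sum disappears, and two copies of \<open>mu z w\<close> minus one
    remain.\<close>
  then show ?thesis
    unfolding h1_def[symmetric] h2_def[symmetric]
    by (simp add: gap_def distrib_right lookup_add lookup_minus lookup_single when_def)
qed

text \<open>Coefficients of the basis element of \<open>z\<close> in \<open>C_right_braid\<close>
  applied to \<open>KL w\<close>: the term \<open>mu z w\<close> is common to both sides, and the
  paths through star pairs remain.\<close>

theorem W_graph_braid:
  assumes "s \<noteq> t" "\<not> desc w s" "\<not> desc w t" "desc z s" "desc z t"
  shows "(\<Sum>x\<in>D_nbrs s t w. mu x w * mu z (star s t x)) = (\<Sum>x\<in>D_nbrs t s w. mu x w * mu z (star t s x))"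
proof -
  let ?P = "\<lambda>s t. KL_right s (KL_right t (KL_right s (T w))) - KL_right s (T w)"
  have diff: "from_KL (g - h) = from_KL g - from_KL h" for g h
    using hlinearD(1)[OF hlinear_from_KL, of "g - h" h] by (simp add: algebra_simps)
  have "from_KL (?P s t - ?P t s) = 0"
    using C_right_braid[OF assms(1), of "KL w"] by (simp add: diff from_KL_KL_right)
  then have "?P s t = ?P t s" using from_KL_eq_zero by fastforce
  then show ?thesis
    using lookup_KL_right_triple[OF assms] lookup_KL_right_triple[of t s w z] assms by simp
qed

subsection \<open>Cyclic words\<close>

text \<open>The sequence is infinite and has a letter \<open>s 0\<close>, although words start with
  \<open>s 1\<close>. It has period three, so letters are compared by their indices modulo three
  even outside the word.\<close>

definition cyc :: "(nat \<Rightarrow> gen) \<Rightarrow> bool" where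
  "cyc s \<longleftrightarrow> (\<forall>i. s i \<noteq> s (Suc i) \<and> s i \<noteq> s (Suc (Suc i)))"

lemma cyc_distinct: "cyc s \<Longrightarrow> s i \<noteq> s (Suc i)" "cyc s \<Longrightarrow> s i \<noteq> s (Suc (Suc i))"
  by (auto simp: cyc_def)

lemma cyc_distinct':
  assumes "cyc s"
  shows "s i \<noteq> s (i + 1)" "s i \<noteq> s (i + 2)" "s (i + 1) \<noteq> s (i + 2)"
    "s (i + 1) \<noteq> s (i + 3)" "s (i + 2) \<noteq> s (i + 3)"
  using cyc_distinct[OF assms, of i] cyc_distinct[OF assms, of "Suc i"]
    cyc_distinct[OF assms, of "Suc (Suc i)"] by (simp_all add: numeral_eq_Suc)

lemma cyc_period: "cyc s \<Longrightarrow> s (i + 3) = s i"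
  using gen_cases[of "s i" "s (Suc i)" "s (Suc (Suc i))" "s (i + 3)"] cyc_distinct[of s i]
    cyc_distinct[of s "Suc i"] cyc_distinct[of s "Suc (Suc i)"] by (auto simp: numeral_eq_Suc)

lemma cyc_plus3: "cyc s \<Longrightarrow> j = i + 3 \<Longrightarrow> s i = s j"
  by (simp add: cyc_period)

lemma cyc_mod: "cyc s \<Longrightarrow> s i = s (i mod 3)"
proof (induction i rule: less_induct)
  case (less i)
  show ?case
  proof (cases "i < 3")
    case False
    then have "s i = s (i - 3)" using cyc_period[OF less.prems, of "i - 3"] by simp
    then show ?thesis using less.IH[of "i - 3"] less.prems False by (simp add: le_mod_geq)
  qed simp
qed

lemma cyc_cong: "cyc s \<Longrightarrow> i mod 3 = j mod 3 \<Longrightarrow> s i = s j"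
  by (metis cyc_mod)

lemma cycI:
  assumes "\<And>i. s i \<noteq> s (Suc i)" "\<And>i. s i \<noteq> s (Suc (Suc i))" shows "cyc s"
  using assms by (simp add: cyc_def)

definition shift :: "nat \<Rightarrow> (nat \<Rightarrow> gen) \<Rightarrow> nat \<Rightarrow> gen" where
  "shift m s = (\<lambda>i. s (i + m))"

lemma cyc_shift: "cyc s \<Longrightarrow> cyc (shift m s)"
  by (auto simp: cyc_def shift_def)

text \<open>Doubling is negation modulo three: the new sequence runs through the cycle in the
  opposite direction.\<close>

lemma cyc_double: "cyc s \<Longrightarrow> cyc (\<lambda>i. s (2 * i + m))"
proof (rule cycI)
  assume c: "cyc s"
  fix i
  have "s (2 * i + m) \<noteq> s (2 * i + m + 2)" "s (2 * i + m) \<noteq> s (2 * i + m + 1)"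
    using cyc_distinct'[OF c, of "2 * i + m"] by auto
  moreover have "s (2 * i + m + 4) = s (2 * i + m + 1)" by (rule cyc_cong[OF c]) presburger
  moreover have "2 * Suc i + m = 2 * i + m + 2" "2 * Suc (Suc i) + m = 2 * i + m + 4" by simp_all
  ultimately show "s (2 * i + m) \<noteq> s (2 * Suc i + m)" "s (2 * i + m) \<noteq> s (2 * Suc (Suc i) + m)"
    by metis+
qed

section \<open>Group elements attached to a cyclic sequence\<close>

fun strip :: "(nat \<Rightarrow> gen) \<Rightarrow> nat \<Rightarrow> affW" where
  "strip s 0 = 1"
| "strip s (Suc n) = strip s n * simple (s (Suc n))"

lemma strip_word: "strip s n = word_val (map s [1..<Suc n])"
  by (induction n) auto

lemma strip_add: "strip s (m + n) = strip s m * strip (shift m s) n"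
  by (induction n) (simp_all add: shift_def mult.assoc add.commute)

lemma strip_desc:
  assumes "cyc s"
  shows "\<not> desc (strip s n) (s (n + 1))" "\<not> desc (strip s n) (s (n + 2))"
    "1 \<le> n \<Longrightarrow> desc (strip s n) (s n)"
proof -
  \<comment> \<open>The last conjunct is carried along because, through \<open>desc_up_iff\<close>,
    it rules out the descent \<open>s n\<close> of the next word.\<close>
  have "\<not> desc (strip s n) (s (n + 1)) \<and> \<not> desc (strip s n) (s (n + 2)) \<and>
    (1 \<le> n \<longrightarrow> desc (strip s n) (s n) \<and> \<not> desc (strip s (n - 1)) (s (n + 1)))"
  proof (induction n)
    case (Suc n)
    have e: "s (Suc n + 2) = s n" by (rule cyc_cong[OF assms]) presburger
    have ne: "s (n + 1) \<noteq> s (n + 2)" "s (n + 1) \<noteq> s n" using cyc_distinct'[OF assms, of n] by auto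
    have 1: "desc (strip s (Suc n)) (s (Suc n))" using Suc by simp
    have 2: "\<not> desc (strip s (Suc n)) (s (n + 2))"
      using desc_up_iff[of "s (n + 1)" "s (n + 2)" "strip s n"] Suc ne by simp
    have 3: "\<not> desc (strip s (Suc n)) (s n)"
    proof (cases n)
      case 0
      then show ?thesis using desc_up_iff[of "s 1" "s 0" 1] ne by simp
    next
      case (Suc m)
      have "strip s n * simple (s n) = strip s m" using Suc by simp
      then show ?thesis
        using desc_up_iff[of "s (n + 1)" "s n" "strip s n"] Suc.IH ne Suc by simp
    qed
    show ?case using 1 2 3 e Suc by simp
  qed simp
  then show "\<not> desc (strip s n) (s (n + 1))" "\<not> desc (strip s n) (s (n + 2))"
    "1 \<le> n \<Longrightarrow> desc (strip s n) (s n)" by auto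
qed

lemma len_strip: "cyc s \<Longrightarrow> len (strip s n) = n"
  by (induction n) (use strip_desc(1) in \<open>auto simp: len_not_desc\<close>)

lemma strip_in_D:
  assumes "cyc s" "1 \<le> n"
  shows "in_D (s n) (s (n + 1)) (strip s n)" "star (s n) (s (n + 1)) (strip s n) = strip s (n + 1)"
    "in_D (s (n + 1)) (s n) (strip s (n + 1))" "star (s (n + 1)) (s n) (strip s (n + 1)) = strip s n"
proof -
  obtain m where m: "n = Suc m" using assms(2) by (cases n) auto
  have ne: "s n \<noteq> s (n + 1)" by (rule cyc_distinct'(1)[OF assms(1)])
  have "\<not> desc (strip s m) (s (n + 1))" using strip_desc(2)[OF assms(1), of m] m by simp
  then show 1: "in_D (s n) (s (n + 1)) (strip s n)" "star (s n) (s (n + 1)) (strip s n) = strip s (n + 1)"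
    using strip_desc[OF assms(1), of n] assms(2) ne m by (auto simp: in_D_def star_def)
  show "in_D (s (n + 1)) (s n) (strip s (n + 1))" "star (s (n + 1)) (s n) (strip s (n + 1)) = strip s n"
    using in_D_star[OF 1(1)] 1(2) by auto
qed

text \<open>Every neighbour of a cyclic word with two right descents turns out to be of the form
  \<open>zeta s k\<close>.\<close>

definition zeta :: "(nat \<Rightarrow> gen) \<Rightarrow> nat \<Rightarrow> affW" where
  "zeta s k = strip s (k + 2) * simple (s (k + 1))"

text \<open>The star partner of \<open>zeta s k\<close>, with the single descent
  \<open>s (k + 3)\<close>. Multiplying it by \<open>s (k + 1)\<close> or by
  \<open>s (k + 2)\<close> gives again two descents, at \<open>zeta s (k + 2)\<close> and at
  \<open>eta s k\<close>.\<close>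

definition tau :: "(nat \<Rightarrow> gen) \<Rightarrow> nat \<Rightarrow> affW" where
  "tau s k = zeta s k * simple (s (k + 3))"

definition eta :: "(nat \<Rightarrow> gen) \<Rightarrow> nat \<Rightarrow> affW" where
  "eta s k = tau s k * simple (s (k + 2))"

lemma zeta_two_desc: "cyc s \<Longrightarrow> two_desc (s (k + 1)) (s (k + 2)) (s (k + 3)) (zeta s k)"
proof -
  assume c: "cyc s"
  have dist: "distinct [s (k + 1), s (k + 2), s (k + 3)]"
    using cyc_distinct'[OF c, of k] by simp
  have e: "s (k + 2 + 2) = s (k + 1)" by (rule cyc_cong[OF c]) presburger
  have 1: "\<not> desc (strip s (k + 2)) (s (k + 1))" using strip_desc(2)[OF c, of "k + 2"] e by simp
  have "strip s (k + 2) * simple (s (k + 2)) = strip s (k + 1)" by (simp add: numeral_eq_Suc)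
  then have "desc (zeta s k) (s (k + 2))"
    unfolding zeta_def using desc_up_iff[of "s (k + 1)" "s (k + 2)" "strip s (k + 2)"] 1 dist
      strip_desc(3)[OF c, of "k + 1"] strip_desc(3)[OF c, of "k + 2"] by simp
  then show ?thesis using dist 1 by (simp add: two_desc_def zeta_def)
qed

lemma len_zeta: "cyc s \<Longrightarrow> len (zeta s k) = k + 3"
proof -
  assume c: "cyc s"
  have "s (k + 2 + 2) = s (k + 1)" by (rule cyc_cong[OF c]) presburger
  then have "\<not> desc (strip s (k + 2)) (s (k + 1))" using strip_desc(2)[OF c, of "k + 2"] by simp
  then show ?thesis by (simp add: zeta_def len_not_desc len_strip[OF c] del: strip.simps)
qed

lemma tau_desc:
  assumes "cyc s"
  shows "desc (tau s k) (s (k + 3))" "\<not> desc (tau s k) (s (k + 1))" "\<not> desc (tau s k) (s (k + 2))"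
  using two_desc_third_up[OF zeta_two_desc[OF assms, of k]] by (auto simp: tau_def)

lemma len_tau: "cyc s \<Longrightarrow> len (tau s k) = k + 4"
  using two_descD(6)[OF zeta_two_desc[of s k]] by (simp add: tau_def len_not_desc len_zeta)

lemma eta_two_desc: "cyc s \<Longrightarrow> two_desc (s (k + 2)) (s (k + 3)) (s (k + 1)) (eta s k)"
  using two_desc_third_up(4)[OF two_desc_sym[OF zeta_two_desc[of s k]]] by (simp add: eta_def tau_def)

lemma len_eta: "cyc s \<Longrightarrow> len (eta s k) = k + 5"
  using tau_desc(3)[of s k] by (simp add: eta_def len_not_desc len_tau)

lemma zeta_alt:
  "zeta s k = strip s k * simple (s (k + 1)) * simple (s (k + 2)) * simple (s (k + 1))"
  by (simp add: zeta_def numeral_eq_Suc)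

lemma zeta_alt': "cyc s \<Longrightarrow>
  zeta s k = strip s k * simple (s (k + 2)) * simple (s (k + 1)) * simple (s (k + 2))"
  using braid_right[of "s (k + 1)" "s (k + 2)" "strip s k"] cyc_distinct(1)[of s "k + 1"]
  by (simp add: zeta_alt)

lemma zeta_step: "cyc s \<Longrightarrow> tau s k * simple (s (k + 1)) = zeta s (k + 2)"
proof -
  assume c: "cyc s"
  have e: "s (k + 2 + 1) = s (k + 3)" "s (k + 2 + 2) = s (k + 1)"
    by (rule cyc_cong[OF c], presburger)+
  have ne: "s (k + 1) \<noteq> s (k + 3)" by (rule cyc_distinct'(4)[OF c])
  have "zeta s (k + 2) = strip s (k + 2) * simple (s (k + 3)) * simple (s (k + 1)) * simple (s (k + 3))"
    unfolding zeta_alt e ..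
  also have "\<dots> = strip s (k + 2) * simple (s (k + 1)) * simple (s (k + 3)) * simple (s (k + 1))"
    using braid_right[OF ne] by simp
  finally show ?thesis by (simp only: tau_def zeta_def)
qed

text \<open>Braid relations push the extra first letter through to the far end. As
  \<open>zeta\<close> and \<open>tau\<close> alternate with the parity of the length, deleting the
  second letter of a cyclic word, which is this situation after a shift by two, depends on that
  parity as well.\<close>

lemma strip_left:
  assumes "cyc s"
  shows "simple (s 2) * strip s (2 * i + 2) = zeta s (2 * i)"
    "simple (s 2) * strip s (2 * i + 3) = tau s (2 * i)"
proof -
  have tau: "simple (s 2) * strip s (2 * i + 3) = tau s (2 * i)"
    if "simple (s 2) * strip s (2 * i + 2) = zeta s (2 * i)" for i
    using that by (simp add: tau_def numeral_eq_Suc flip: mult.assoc)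
  have zeta: "simple (s 2) * strip s (2 * i + 2) = zeta s (2 * i)" for i
  proof (induction i)
    case 0
    have "s 1 \<noteq> s 2" using cyc_distinct(1)[OF assms, of 1] by (simp add: numeral_eq_Suc)
    then show ?case using braid[of "s 1" "s 2"] by (simp add: zeta_def numeral_eq_Suc mult.assoc)
  next
    case (Suc i)
    have e: "s (2 * i + 4) = s (2 * i + 1)" by (rule cyc_cong[OF assms]) presburger
    have "simple (s 2) * strip s (2 * Suc i + 2) = simple (s 2) * strip s (2 * i + 3) * simple (s (2 * i + 4))"
      by (simp add: numeral_eq_Suc mult.assoc)
    also have "\<dots> = zeta s (2 * Suc i)" using tau[OF Suc] zeta_step[OF assms, of "2 * i"] e by simp
    finally show ?case .
  qed
  show "simple (s 2) * strip s (2 * i + 2) = zeta s (2 * i)"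
    "simple (s 2) * strip s (2 * i + 3) = tau s (2 * i)"
    using zeta tau by blast+
qed

lemma eta_word: "cyc s \<Longrightarrow> 2 \<le> k \<Longrightarrow>
  eta s (k - 2) = strip s k * simple (s (k + 2)) * simple (s (k + 1)) * simple (s (k + 3))"
proof -
  assume c: "cyc s" and k: "2 \<le> k"
  then obtain j where j: "k = j + 2" by (metis le_add_diff_inverse2)
  have "s (j + 2) = s (k + 3)" "s (j + 3) = s (k + 1)" "s (j + 1) = s (k + 2)"
    unfolding j by (rule cyc_cong[OF c], presburger)+
  then show ?thesis using j by (simp add: eta_def tau_def zeta_def)
qed

subsection \<open>Neighbours of elements with two descents\<close>

lemma mu_two_desc_star:
  assumes z: "two_desc a b c z" and z': "two_desc c a b z'"
  shows "mu z' (z * simple c) = mu (z' * simple b) z"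
proof -
  note 1 = in_D_two_desc[OF two_desc_sym[OF z]] and 2 = in_D_two_desc[OF z']
  show ?thesis using mu_star[OF 1(3) 2(3)] 1(4) 2(4) by (metis mu_sym)
qed

text \<open>From above, \<open>z'\<close> is one generator away. From below it is a coatom or
  shorter; if shorter, \<open>mu_two_desc_star\<close> moves the edge to one ending in
  \<open>z\<close>, and there the descent \<open>a\<close> of \<open>z\<close> forces it to be given
  by one generator.\<close>

lemma mu_two_desc_cases:
  assumes z: "two_desc a b c z" and z': "two_desc c a b z'" and nz: "mu z' (z * simple c) \<noteq> 0"
  obtains "z' = z * simple c * simple a" | "z' = z * simple a * simple b"
    | "z' < z * simple c" "len z' = len z"
  using nz
proof (cases rule: mu_neq_zero_cases)
  case 1
  have lz: "len (z * simple c) = Suc (len z)" using len_not_desc two_descD(6)[OF z] by blast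
  show ?thesis
  proof (cases "len z' = len z")
    case False
    then have "len z' < len z" using less_affW_len[OF 1(2)] lz by simp
    moreover have "len (z' * simple b) = Suc (len z')" using len_not_desc two_descD(6)[OF z'] by blast
    ultimately have "\<not> z < z' * simple b" using less_affW_len[of z "z' * simple b"] by auto
    moreover have nz': "mu (z' * simple b) z \<noteq> 0" using mu_two_desc_star[OF z z'] nz by simp
    ultimately have "z' * simple b < z" using mu_neq_zero_cases[OF nz'] by metis
    moreover have "\<not> desc (z' * simple b) a" using two_desc_third_up[OF z'] by simp
    ultimately have "z = z' * simple b * simple a"
      using mu_desc_greater[of z "z' * simple b" a] nz' two_descD(4)[OF z] by (simp add: mu_sym)
    then have "z' = z * simple a * simple b" by simp
    then show ?thesis using that(2) by blast
  qed (use 1 that(3) in blast)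
next
  case 2
  have "desc z' a" "\<not> desc (z * simple c) a" using two_descD(5)[OF z'] two_desc_third_up(2)[OF z] by auto
  then have "z' = z * simple c * simple a" using mu_desc_greater nz 2(2) by blast
  then show ?thesis using that(1) by blast
qed

text \<open>The exponent \<open>- len w\<close> carries the constant term of the polynomial. The
  subtracted terms of the product formula come from elements no longer than \<open>w\<close> and do
  not reach the exponent \<open>- len w - 1\<close>.\<close>

lemma KL_bottom_mult:
  assumes "\<not> desc w s"
  shows "lookup (lookup (KL (w * simple s)) x) (- int (len (w * simple s))) =
    lookup (lookup (KL w) (if desc x s then x * simple s else x)) (- int (len w))"
proof -
  let ?e = "- int (len w) - 1"
  have lw: "- int (len (w * simple s)) = ?e" using len_not_desc[OF assms] by simp
  have low: "lookup (lookup (KL w) y) (- 2 - int (len w)) = 0" for y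
    using KL_coeff(2)[of w y "- 2 - int (len w)"] by fastforce
  have "lookup (lookup (KL z) x) ?e = 0" if z: "z \<in> {z \<in> keys (KL w). desc z s}" for z
  proof -
    obtain k where "lookup (lookup (KL w) z) k \<noteq> 0"
      using z by (metis (mono_tags) in_keys_iff lookup_zero mem_Collect_eq poly_mapping_eqI)
    then have "len z \<le> len w" using KL_coeff(1) le_affW_len[of z w] by fastforce
    then show ?thesis using KL_coeff(2)[of z x ?e] by fastforce
  qed
  then have "lookup (lookup (C_right s (KL w)) x) ?e = lookup (lookup (KL (w * simple s)) x) ?e"
    unfolding KL_mult_up[OF assms] by (simp add: lookup_add lookup_sum lookup_single_mult)
  then show ?thesis unfolding lw by (auto simp: lookup_C_right lookup_add low)
qed

lemma mu_coatom_bottom: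
  assumes "len w = Suc (len x)" shows "mu x w = lookup (lookup (KL w) x) (- int (len w))"
proof -
  have "- int (len w) = - int (len x) - 1" using assms by simp
  then show ?thesis using assms by (simp only: mu_len_less mu0_def lessI)
qed

lemma KL_bottom_self: "lookup (lookup (KL w) w) (- int (len w)) = 1"
  by (simp add: KL_top lookup_qhalf_pow)

text \<open>The value is a constant term, as \<open>eta s (k - 2)\<close> is shorter by one. Four
  letters are peeled off the end of \<open>tau s k\<close>; removing the first three also shortens
  the lower element, and the pair becomes \<open>strip s k\<close> with itself.\<close>

lemma mu_eta_tau:
  assumes c: "cyc s" and k: "2 \<le> k"
  shows "mu (eta s (k - 2)) (tau s k) = 1"
proof -
  define j where "j = k - 2"
  have kj: "k = j + 2" using k by (simp add: j_def)
  let ?B = "\<lambda>w x. lookup (lookup (KL w) x) (- int (len w))"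
  have e: "s (j + 1) = s (k + 2)" "s (j + 2) = s (k + 3)" "s (j + 3) = s (k + 1)"
    unfolding kj by (rule cyc_cong[OF c], presburger)+
  have p1: "desc (eta s j) (s (k + 3))" "desc (tau s j) (s (k + 1))" "desc (zeta s j) (s (k + 2))"
    using two_descD[OF eta_two_desc[OF c, of j]] tau_desc[OF c, of j] two_descD[OF zeta_two_desc[OF c, of j]]
    unfolding e by auto
  have x: "eta s j * simple (s (k + 3)) = tau s j" "tau s j * simple (s (k + 1)) = zeta s j"
    "zeta s j * simple (s (k + 2)) = strip s k"
    unfolding eta_def tau_def zeta_def e by (simp_all only: simple_square) (simp only: kj)
  have w: "tau s k = zeta s k * simple (s (k + 3))" "zeta s k = strip s (k + 2) * simple (s (k + 1))"
    "strip s (k + 2) = strip s (k + 1) * simple (s (k + 2))" "strip s (k + 1) = strip s k * simple (s (k + 1))"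
    by (simp_all add: tau_def zeta_def numeral_eq_Suc)
  have nd: "\<not> desc (zeta s k) (s (k + 3))" "\<not> desc (strip s (k + 2)) (s (k + 1))"
    "\<not> desc (strip s (k + 1)) (s (k + 2))" "\<not> desc (strip s k) (s (k + 1))"
  proof -
    have "s (k + 2 + 2) = s (k + 1)" by (rule cyc_cong[OF c]) presburger
    then show "\<not> desc (strip s (k + 2)) (s (k + 1))" using strip_desc(2)[OF c, of "k + 2"] by simp
    show "\<not> desc (strip s (k + 1)) (s (k + 2))" using strip_desc(1)[OF c, of "k + 1"] by (simp add: numeral_eq_Suc)
  qed (use strip_desc(1)[OF c] two_descD(6)[OF zeta_two_desc[OF c]] in auto)
  have "?B (tau s k) (eta s j) = ?B (zeta s k) (tau s j)"
    using KL_bottom_mult[OF nd(1), of "eta s j"] p1 x unfolding w(1) by simp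
  also have "\<dots> = ?B (strip s (k + 2)) (zeta s j)"
    using KL_bottom_mult[OF nd(2), of "tau s j"] p1 x unfolding w(2) by simp
  also have "\<dots> = ?B (strip s (k + 1)) (strip s k)"
    using KL_bottom_mult[OF nd(3), of "zeta s j"] p1 x unfolding w(3) by simp
  also have "\<dots> = ?B (strip s k) (strip s k)"
    using KL_bottom_mult[OF nd(4), of "strip s k"] nd(4) unfolding w(4) by simp
  finally have "?B (tau s k) (eta s j) = 1" by (simp add: KL_bottom_self)
  moreover have "len (tau s k) = Suc (len (eta s j))" using len_tau[OF c] len_eta[OF c] kj by simp
  ultimately show ?thesis using mu_coatom_bottom unfolding j_def by metis
qed

section \<open>Coatoms of \<open>tau s k\<close>\<close>

lemma strip_shift_word: "word_val (map s [Suc m..<Suc (m + n)]) = strip (shift m s) n"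
  by (induction n) (simp_all add: shift_def add.commute)

lemma strip_single_desc:
  assumes "cyc s" "desc (strip s n) a" shows "a = s n"
proof -
  have "distinct [s n, s (n + 1), s (n + 2)]" using cyc_distinct'[OF assms(1), of n] by simp
  then show ?thesis using gen_cases[of "s n" "s (n + 1)" "s (n + 2)" a] strip_desc[OF assms(1), of n] assms(2) by auto
qed

lemma tau_single_desc:
  assumes "cyc s" "desc (tau s k) a" shows "a = s (k + 3)"
proof -
  have "distinct [s (k + 1), s (k + 2), s (k + 3)]" using cyc_distinct'[OF assms(1), of k] by simp
  then show ?thesis using gen_cases[of "s (k + 1)" "s (k + 2)" "s (k + 3)" a] tau_desc[OF assms(1), of k] assms(2) by auto
qed

text \<open>The word of \<open>tau s k\<close> without its second letter, evaluated by
  \<open>strip_left\<close>: for even \<open>k\<close> it is not reduced, against the assumed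
  length; for odd \<open>k\<close> it is an \<open>eta\<close> times its third generator, with a
  single descent.\<close>

lemma strip_delete_second:
  assumes c: "cyc s" and k: "2 \<le> k"
    and x: "x = simple (s 1) * strip (shift 2 s) k * simple (s (k + 1)) * simple (s (k + 3))"
    and len: "len x = k + 3" and d: "desc x a"
  shows "a = s (k + 3)"
proof -
  let ?s = "shift 2 s"
  have c': "cyc ?s" by (rule cyc_shift[OF c])
  have e1: "?s 2 = s 1" unfolding shift_def by (rule cyc_cong[OF c]) simp
  show ?thesis
  proof (cases "even k")
    case True
    then have "k = 2 * ((k - 2) div 2) + 2" using k by presburger
    then obtain i where i: "k = 2 * i + 2" by blast
    have z: "simple (s 1) * strip ?s k = zeta ?s (2 * i)" using strip_left(1)[OF c', of i] e1 i by simp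
    have "?s (2 * i + 1) = s (k + 1)" unfolding shift_def i by (rule cyc_cong[OF c]) presburger
    then have "desc (zeta ?s (2 * i)) (s (k + 1))"
      using two_descD(4)[OF zeta_two_desc[OF c', of "2 * i"]] by simp
    then have "len (zeta ?s (2 * i) * simple (s (k + 1))) = k"
      using len_desc len_zeta[OF c', of "2 * i"] i by fastforce
    then have "len x \<le> k + 1"
      unfolding x z using len_mult_simple_le[of "zeta ?s (2 * i) * simple (s (k + 1))" "s (k + 3)"] by simp
    then show ?thesis using len by simp
  next
    case False
    then have "k = 2 * ((k - 3) div 2) + 3" using k by presburger
    then obtain i where i: "k = 2 * i + 3" by blast
    have z: "simple (s 1) * strip ?s k = tau ?s (2 * i)" using strip_left(2)[OF c', of i] e1 i by simp
    have "?s (2 * i + 2) = s (k + 1)" "?s (2 * i + 1) = s (k + 3)"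
      unfolding shift_def i by (rule cyc_cong[OF c], presburger)+
    then have "x = eta ?s (2 * i) * simple (?s (2 * i + 1))" unfolding x z by (simp add: eta_def)
    moreover note two_desc_third_up(2,3)[OF eta_two_desc[OF c', of "2 * i"]]
    moreover have "distinct [?s (2 * i + 1), ?s (2 * i + 2), ?s (2 * i + 3)]"
      using cyc_distinct'[OF c', of "2 * i"] by simp
    ultimately show ?thesis
      using gen_cases[of "?s (2 * i + 1)" "?s (2 * i + 2)" "?s (2 * i + 3)" a] d
        \<open>?s (2 * i + 1) = s (k + 3)\<close> by auto
  qed
qed

text \<open>Deletions of one letter from a reduced word of \<open>tau s k\<close> are not reduced or
  have a single descent, with two exceptions: deleting the last letter gives
  \<open>zeta s k\<close>, which lacks the descent \<open>s (k + 3)\<close>, and for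
  \<open>2 \<le> k\<close> deleting the letter at place \<open>k + 1\<close> gives
  \<open>eta s (k - 2)\<close>.\<close>

lemma tau_coatom:
  assumes c: "cyc s" and x: "x < tau s k" "len x = k + 3" and a: "desc x a" "a \<noteq> s (k + 3)"
    and d: "desc x (s (k + 3))"
  shows "2 \<le> k \<and> x = eta s (k - 2)"
proof -
  define xs where "xs = map s [1..<k + 3] @ [s (k + 1), s (k + 3)]"
  have val: "word_val xs = tau s k"
    unfolding xs_def tau_def zeta_def strip_word by (simp add: mult.assoc numeral_eq_Suc)
  obtain us b vs where uv: "xs = us @ b # vs" "x = word_val (us @ vs)"
    using coatom_deletion[of x xs] x val len_tau[OF c, of k] by auto
  define j where "j = length us"
  have us: "us = take j xs" and vs: "vs = drop (Suc j) xs" using uv(1) by (simp_all add: j_def)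
  have "length xs = k + 4" by (simp add: xs_def)
  then have jlen: "j < k + 4" using uv(1) by (simp add: j_def)
  have nlen: False if "x = word_val ys" "length ys < k + 3" for ys
    using len_word_le[of ys] x(2) that by simp
  consider (in_strip) "j < k + 2" | (last_two) "j = k + 2" | (last) "j = k + 3" using jlen by linarith
  then show ?thesis
  proof cases
    case in_strip
    define V where "V = map s [j + 2..<k + 3]"
    have us': "us = map s [1..<Suc j]" and vs': "vs = V @ [s (k + 1), s (k + 3)]"
      using in_strip by (simp_all add: us vs xs_def V_def take_map take_upt drop_map)
    have xV: "x = strip s j * word_val V * simple (s (k + 1)) * simple (s (k + 3))"
      using uv(2) by (simp add: us' vs' strip_word mult.assoc del: upt_Suc)
    \<comment> \<open>\<open>j\<close> letters precede the deleted one, which is therefore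
      \<open>s (j + 1)\<close>.\<close>
    consider (A0) "j = 0" "1 \<le> k" | (A1) "j = 1" "2 \<le> k" | (A2) "2 \<le> j" "j < k" | (A3) "j = k" | (A4) "j = k + 1"
      using in_strip by linarith
    then show ?thesis
    proof cases
      case A0
      let ?s = "shift 1 s"
      have "word_val V = strip ?s (k + 1)" using A0 strip_shift_word[where m = 1 and n = "k + 1" and s = s] by (simp add: V_def numeral_eq_Suc)
      then have "x = tau ?s (k - 1)" using A0 by (simp add: xV tau_def zeta_def shift_def numeral_3_eq_3)
      then have "a = s (k + 3)" using tau_single_desc[OF cyc_shift[OF c], where m1 = 1 and k = "k - 1" and a = a] a(1) A0
        by (simp add: shift_def numeral_3_eq_3)
      then show ?thesis using a(2) by simp
    next
      case A1
      have "word_val V = strip (shift 2 s) k" using A1 strip_shift_word[where m = 2 and n = k and s = s] by (simp add: V_def numeral_eq_Suc)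
      then have "x = simple (s 1) * strip (shift 2 s) k * simple (s (k + 1)) * simple (s (k + 3))"
        using A1 by (simp add: xV)
      then show ?thesis using strip_delete_second[OF c A1(2) _ x(2) a(1)] a(2) by blast
    next
      case A2
      \<comment> \<open>Around the gap the word reads \<open>s (j - 1)\<close>, \<open>s j\<close>,
        \<open>s (j - 1)\<close>, \<open>s j\<close>, which a braid relation shortens.\<close>
      define V' where "V' = map s [j + 4..<k + 3]"
      define i where "i = j - 2"
      have j: "j = i + 2" using A2 by (simp add: i_def)
      have "[j + 2..<k + 3] = (j + 2) # (j + 3) # [j + 4..<k + 3]"
        using A2 by (simp add: upt_conv_Cons numeral_eq_Suc)
      then have "word_val V = simple (s (j + 2)) * simple (s (j + 3)) * word_val V'"
        by (simp add: V_def V'_def mult.assoc)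
      moreover have "s (j + 2) = s (i + 1)" "s (j + 3) = s (i + 2)"
        unfolding j by (rule cyc_cong[OF c], presburger)+
      moreover have "strip s j = strip s i * simple (s (i + 1)) * simple (s (i + 2))"
        unfolding j by (simp add: numeral_eq_Suc)
      moreover have "strip s i * simple (s (i + 1)) * simple (s (i + 2)) * simple (s (i + 1)) * simple (s (i + 2))
        = strip s i * simple (s (i + 2)) * simple (s (i + 1))"
        using braid_right[OF cyc_distinct'(3)[OF c, of i], of "strip s i"] by simp
      ultimately have "x = word_val (map s [1..<Suc i] @ [s (i + 2), s (i + 1)] @ V' @ [s (k + 1), s (k + 3)])"
        by (simp add: xV strip_word del: upt_Suc flip: mult.assoc)
      moreover have "length (map s [1..<Suc i] @ [s (i + 2), s (i + 1)] @ V' @ [s (k + 1), s (k + 3)]) < k + 3"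
        using A2 by (simp add: V'_def j del: upt_Suc)
      ultimately show ?thesis using nlen by blast
    next
      case A3
      have "V = [s (k + 2)]" using A3 by (simp add: V_def numeral_eq_Suc)
      then have xk: "x = strip s k * simple (s (k + 2)) * simple (s (k + 1)) * simple (s (k + 3))"
        using A3 by (simp add: xV)
      show ?thesis
      proof (cases "2 \<le> k")
        case True
        then show ?thesis using eta_word[OF c True] xk by simp
      next
        case False
        then consider "k = 0" | "k = 1" by linarith
        \<comment> \<open>For these two values the word is cyclic in the opposite direction and so
          has a single descent.\<close>
        then have "\<exists>m n. x = strip (\<lambda>i. s (2 * i + m)) n \<and> s (2 * n + m) = s (k + 3)"
        proof cases
          case 1
          have "s 4 = s 1" "s 6 = s 3" by (rule cyc_cong[OF c], simp)+
          then have "x = strip (\<lambda>i. s (2 * i + 0)) 3 \<and> s (2 * 3 + 0) = s (k + 3)"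
            unfolding xk 1 by (simp add: numeral_eq_Suc)
          then show ?thesis by blast
        next
          case 2
          have "s 4 = s 1" "s 6 = s 3" "s 8 = s 2" "s 10 = s 4" by (rule cyc_cong[OF c], simp)+
          then have "x = strip (\<lambda>i. s (2 * i + 2)) 4 \<and> s (2 * 4 + 2) = s (k + 3)"
            unfolding xk 2 by (simp add: numeral_eq_Suc)
          then show ?thesis by blast
        qed
        then show ?thesis using strip_single_desc[OF cyc_double[OF c]] a by metis
      qed
    next
      case A4
      have "V = []" using A4 by (simp add: V_def)
      then have "x = strip s k * simple (s (k + 3))" using A4 by (simp add: xV)
      then have "x = word_val (map s [1..<Suc k] @ [s (k + 3)])" by (simp add: strip_word del: upt_Suc)
      then show ?thesis using nlen[of "map s [1..<Suc k] @ [s (k + 3)]"] by (simp del: upt_Suc)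
    qed
  next
    case last_two
    have "us = map s [1..<k + 3]" "vs = [s (k + 3)]" by (simp_all add: us vs xs_def last_two)
    then have "x = strip s (k + 3)" using uv(2) by (simp add: strip_word numeral_eq_Suc)
    then show ?thesis using strip_single_desc[OF c] a by blast
  next
    case last
    have "us = map s [1..<k + 3] @ [s (k + 1)]" "vs = []" by (simp_all add: us vs xs_def last)
    then have "x = zeta s k" using uv(2) by (simp add: zeta_def strip_word numeral_eq_Suc mult.assoc)
    then show ?thesis using two_descD(6)[OF zeta_two_desc[OF c, of k]] d by simp
  qed
qed

lemma zeta_minus2:
  assumes "cyc s" "2 \<le> n" shows "zeta s (n - 2) = strip s n * simple (s (n + 2))"
proof -
  have "s (n - 2 + 1) = s (n + 2)" by (rule cyc_plus3[OF assms(1)]) (use assms(2) in simp)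
  moreover have "n - 2 + 2 = n" using assms(2) by simp
  ultimately show ?thesis by (simp only: zeta_def)
qed

text \<open>For this pair of descents the neighbour above is one generator away; of the candidates
  below, \<open>strip s (k + 1)\<close> lacks a descent and \<open>tau_coatom\<close> leaves only
  \<open>eta s (k - 2)\<close>.\<close>

lemma mu_tau_next:
  assumes c: "cyc s" and z': "two_desc (s (k + 3)) (s (k + 1)) (s (k + 2)) z'"
  shows "mu z' (tau s k) = (if z' = zeta s (k + 2) \<or> 2 \<le> k \<and> z' = eta s (k - 2) then 1 else 0)"
proof (cases "mu z' (tau s k) = 0")
  case True
  have "mu (zeta s (k + 2)) (tau s k) = 1"
    using mu_mult_simple[of "tau s k" "s (k + 1)"] zeta_step[OF c, of k] by (simp add: mu_sym)
  then show ?thesis using True mu_eta_tau[OF c, of k] by auto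
next
  case False
  note z = zeta_two_desc[OF c, of k]
  have "z' = zeta s (k + 2) \<or> 2 \<le> k \<and> z' = eta s (k - 2)"
  proof (rule mu_two_desc_cases[OF z z'])
    show "mu z' (zeta s k * simple (s (k + 3))) \<noteq> 0" using False by (simp add: tau_def)
  next
    assume "z' = zeta s k * simple (s (k + 3)) * simple (s (k + 1))"
    then show ?thesis using zeta_step[OF c, of k] by (simp add: tau_def)
  next
    assume "z' = zeta s k * simple (s (k + 1)) * simple (s (k + 2))"
    then have "z' = strip s (k + 1)" by (simp add: zeta_alt)
    then show ?thesis using strip_desc(2)[OF c, of "k + 1"] two_descD(4)[OF z'] by (simp add: numeral_3_eq_3)
  next
    assume "z' < zeta s k * simple (s (k + 3))" "len z' = len (zeta s k)"
    then show ?thesis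
      using tau_coatom[OF c, of z' k "s (k + 1)"] two_descD[OF z'] len_zeta[OF c, of k] by (simp add: tau_def)
  qed
  moreover have "mu (zeta s (k + 2)) (tau s k) = 1"
    using mu_mult_simple[of "tau s k" "s (k + 1)"] zeta_step[OF c, of k] by (simp add: mu_sym)
  ultimately show ?thesis using mu_eta_tau[OF c, of k] by auto
qed

text \<open>For this pair of descents the coatom \<open>eta s (k - 2)\<close> is excluded by its
  descents, and the neighbour below is \<open>zeta s k\<close> with two generators removed on the
  right.\<close>

lemma mu_tau_prev:
  assumes c: "cyc s" and z': "two_desc (s (k + 3)) (s (k + 2)) (s (k + 1)) z'"
  shows "mu z' (tau s k) = (if z' = eta s k \<or> 2 \<le> k \<and> z' = zeta s (k - 2) then 1 else 0)"
proof -
  note z = two_desc_sym[OF zeta_two_desc[OF c, of k]]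
  have 1: "mu (eta s k) (tau s k) = 1"
    using mu_mult_simple[of "tau s k" "s (k + 2)"] by (simp add: eta_def mu_sym)
  have zz: "zeta s k * simple (s (k + 2)) * simple (s (k + 1)) = strip s k * simple (s (k + 2))"
    by (simp add: zeta_alt'[OF c])
  note zz2 = zeta_minus2[OF c, of k]
  have 2: "mu z' (tau s k) = 1" if "2 \<le> k" "z' = zeta s (k - 2)"
  proof -
    have "z' * simple (s (k + 1)) = zeta s k * simple (s (k + 2))"
      using that zz2[OF that(1)] zz by (metis simple_square(2))
    then have "mu (z' * simple (s (k + 1))) (zeta s k) = 1"
      using mu_mult_simple[of "zeta s k" "s (k + 2)"] by (simp add: mu_sym)
    then show ?thesis using mu_two_desc_star[OF z z'] by (simp add: tau_def)
  qed
  have "z' = eta s k \<or> 2 \<le> k \<and> z' = zeta s (k - 2)" if nz: "mu z' (tau s k) \<noteq> 0"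
  proof (rule mu_two_desc_cases[OF z z'])
    show "mu z' (zeta s k * simple (s (k + 3))) \<noteq> 0" using nz by (simp add: tau_def)
  next
    assume "z' = zeta s k * simple (s (k + 3)) * simple (s (k + 2))"
    then show ?thesis by (simp add: eta_def tau_def)
  next
    assume "z' = zeta s k * simple (s (k + 2)) * simple (s (k + 1))"
    then have zs: "z' = strip s k * simple (s (k + 2))" using zz by simp
    then have "len z' \<le> k + 1" using len_mult_simple_le[of "strip s k"] len_strip[OF c, of k] by simp
    then have "2 \<le> k" using two_desc_len[OF z'] by simp
    then show ?thesis using zz2 zs by simp
  next
    assume *: "z' < zeta s k * simple (s (k + 3))" "len z' = len (zeta s k)"
    then have k: "2 \<le> k" and e: "z' = eta s (k - 2)"
      using tau_coatom[OF c, of z' k "s (k + 2)"] two_descD[OF z'] len_zeta[OF c, of k] by (auto simp: tau_def)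
    have "s (k - 2 + 1) = s (k + 2)" by (rule cyc_plus3[OF c]) (use k in simp)
    then show ?thesis using two_descD(6)[OF eta_two_desc[OF c, of "k - 2"]] e two_descD(5)[OF z'] by simp
  qed
  then show ?thesis using 1 2 by auto
qed

text \<open>For this pair of descents \<open>eta s (k - 2)\<close> is a neighbour of both
  \<open>tau s k\<close> and \<open>tau s (k - 2)\<close>; the difference eliminates it and leaves
  only elements \<open>zeta\<close>.\<close>

lemma mu_tau_recurrence:
  assumes c: "cyc s" and z': "two_desc (s (k + 3)) (s (k + 1)) (s (k + 2)) z'"
  shows "mu z' (tau s k) + (if 4 \<le> k \<and> z' = zeta s (k - 4) then 1 else 0) =
    (if z' = zeta s (k + 2) then 1 else 0) + (if 2 \<le> k then mu z' (tau s (k - 2)) else 0)"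
proof (cases "2 \<le> k")
  case False
  then show ?thesis using mu_tau_next[OF assms] by simp
next
  case True
  have "k - 2 + 3 = k + 1" using True by simp
  then have e: "s (k - 2 + 3) = s (k + 1)" "s (k - 2 + 2) = s (k + 3)" "s (k - 2 + 1) = s (k + 2)"
    using True by (simp only:, intro cyc_plus3[OF c], simp, intro cyc_plus3[OF c], simp)
  have "two_desc (s (k - 2 + 3)) (s (k - 2 + 2)) (s (k - 2 + 1)) z'"
    unfolding e by (rule two_desc_sym[OF z'])
  from mu_tau_prev[OF c this]
  have p: "mu z' (tau s (k - 2)) = (if z' = eta s (k - 2) \<or> 4 \<le> k \<and> z' = zeta s (k - 4) then 1 else 0)"
    using True by (auto simp: le_diff_conv2 numeral_eq_Suc)
  have "eta s (k - 2) \<noteq> zeta s (k + 2)" "4 \<le> k \<Longrightarrow> eta s (k - 2) \<noteq> zeta s (k - 4)"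
    "4 \<le> k \<Longrightarrow> zeta s (k + 2) \<noteq> zeta s (k - 4)"
    using len_eta[OF c, of "k - 2"] len_zeta[OF c, of "k + 2"] len_zeta[OF c, of "k - 4"] True
    by (auto dest: arg_cong[of _ _ len])
  then show ?thesis using p mu_tau_next[OF assms] True by auto
qed

subsection \<open>Neighbours of cyclic words\<close>

text \<open>Two star operations in a row shorten the cyclic word by two letters and take
  \<open>z\<close> to \<open>z * simple (s (m + 1))\<close> and back.\<close>

lemma mu_strip_top:
  assumes c: "cyc s" and m: "1 \<le> m" and z: "two_desc (s (m + 2)) (s (m + 3)) (s (m + 4)) z"
  shows "mu z (strip s (m + 2)) = mu z (strip s m)"
proof -
  have e: "s (m + 4) = s (m + 1)" "s (m + 3) = s m" by (rule cyc_cong[OF c], presburger)+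
  have z': "two_desc (s (m + 2)) (s m) (s (m + 1)) z" using z e by simp
  note 1 = in_D_two_desc[OF z'] and 2 = in_D_two_desc[OF two_desc_sym[OF z']]
  have m1: "1 \<le> m + 1" by simp
  note p = strip_in_D[OF c m1] and r = strip_in_D[OF c m]
  have "mu z (strip s (m + 2)) = mu (z * simple (s (m + 1))) (strip s (m + 1))"
    using mu_star[OF 1(1), of "strip s (m + 1)"] p 1(2) by (simp add: numeral_eq_Suc del: strip.simps)
  also have "\<dots> = mu z (strip s m)"
    using mu_star[OF 2(3), of "strip s m"] r 2(4) by simp
  finally show ?thesis .
qed

text \<open>For \<open>1 \<le> n\<close> these turn out to be the neighbours of
  \<open>strip s n\<close> with descents \<open>s n\<close> and \<open>s (n + 2)\<close>. The first
  is \<open>strip s n * simple (s (n + 2))\<close> and lies above; the second is, by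
  \<open>strip_left\<close>, the word \<open>strip s n\<close> without its second letter.\<close>

definition bottom_nbrs :: "(nat \<Rightarrow> gen) \<Rightarrow> nat \<Rightarrow> affW set" where
  "bottom_nbrs s n = {z. 2 \<le> n \<and> z = zeta s (n - 2) \<or> even n \<and> 4 \<le> n \<and> z = zeta (shift 2 s) (n - 4)}"

text \<open>An element with two descents has length at least 3, so only \<open>n = 4\<close> admits
  one below, the longest element for \<open>s 1\<close> and \<open>s 3\<close>; its weight is a
  constant term.\<close>

lemma mu_strip_small:
  assumes c: "cyc s" and n: "1 \<le> n" "n \<le> 4" and z: "two_desc (s n) (s (n + 2)) (s (n + 1)) z"
  shows "mu z (strip s n) = (if z \<in> bottom_nbrs s n then 1 else 0)"
proof -
  note zeta = zeta_minus2[OF c, of n]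
  have v1: "mu (zeta s (n - 2)) (strip s n) = 1" if "2 \<le> n"
    using zeta[OF that] mu_mult_simple[of "strip s n" "s (n + 2)"] by (simp add: mu_sym)
  have s4: "s 4 = s 1" "s 6 = s 3" by (rule cyc_cong[OF c], simp)+
  have s13: "s 1 \<noteq> s 3" using cyc_distinct'(4)[OF c, of 0] by simp
  have z4: "zeta (shift 2 s) 0 = simple (s 1) * simple (s 3) * simple (s 1)"
    using braid[OF s13] s4 by (simp add: zeta_alt shift_def numeral_eq_Suc)
  have v2: "mu (zeta (shift 2 s) 0) (strip s 4) = 1"
  proof -
    let ?B = "\<lambda>w x. lookup (lookup (KL w) x) (- int (len w))"
    have w: "strip s 4 = strip s 3 * simple (s 1)" "strip s 3 = strip s 2 * simple (s 3)"
      "strip s 2 = strip s 1 * simple (s 2)" using s4 by (simp_all add: numeral_eq_Suc)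
    have nd: "\<not> desc (strip s 3) (s 1)" "\<not> desc (strip s 2) (s 3)" "\<not> desc (strip s 1) (s 2)"
      using strip_desc(1)[OF c, of 3] strip_desc(1)[OF c, of 2] strip_desc(1)[OF c, of 1] s4 by (simp_all add: numeral_eq_Suc)
    have "min_rep (s 1) (s 3) 1" using s13 by (simp add: min_rep_def)
    note d = min_rep_desc[OF this]
    have "?B (strip s 4) (zeta (shift 2 s) 0) = ?B (strip s 3) (simple (s 1) * simple (s 3))"
      using KL_bottom_mult[OF nd(1), of "zeta (shift 2 s) 0"] d unfolding w(1) z4 by simp
    also have "\<dots> = ?B (strip s 2) (simple (s 1))"
      using KL_bottom_mult[OF nd(2), of "simple (s 1) * simple (s 3)"] d unfolding w(2) by simp
    also have "\<dots> = ?B (strip s 1) (strip s 1)"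
      using KL_bottom_mult[OF nd(3), of "simple (s 1)"] nd(3) unfolding w(3) by simp
    finally have "?B (strip s 4) (zeta (shift 2 s) 0) = 1" by (simp only: KL_bottom_self)
    moreover have "len (strip s 4) = Suc (len (zeta (shift 2 s) 0))"
      using len_strip[OF c, of 4] len_zeta[OF cyc_shift[OF c], of 2 0] by simp
    ultimately show ?thesis using mu_coatom_bottom by metis
  qed
  have "z \<in> bottom_nbrs s n" if nz: "mu z (strip s n) \<noteq> 0"
    using nz
  proof (cases rule: mu_neq_zero_cases)
    case 1
    then have "len z < n" using less_affW_len len_strip[OF c] by metis
    then have n4: "n = 4" and z3: "len z = 3" using two_desc_len[OF z] n by auto
    have "z = simple (s 4) * simple (s 6) * simple (s 4)" using two_desc_len3[OF z z3] n4 by simp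
    then show ?thesis using z4 s4 n4 by (simp add: bottom_nbrs_def)
  next
    case 2
    then have zs: "z = strip s n * simple (s (n + 2))"
      using mu_desc_greater[OF nz two_descD(5)[OF z] strip_desc(2)[OF c]] by blast
    have "2 \<le> n"
      using two_desc_len[OF z] len_mult_simple_le[of "strip s n" "s (n + 2)"] len_strip[OF c, of n] zs by simp
    then show ?thesis using zs zeta by (simp add: bottom_nbrs_def)
  qed
  then show ?thesis using v1 v2 n by (auto simp: bottom_nbrs_def)
qed

lemma sum_bottom_nbrs:
  assumes "cyc s"
  shows "(\<Sum>x\<in>bottom_nbrs s n. f x) = (if 2 \<le> n then f (zeta s (n - 2)) else 0) +
    (if even n \<and> 4 \<le> n then f (zeta (shift 2 s) (n - 4)) else (0 :: int))"
proof -
  have "zeta s (n - 2) \<noteq> zeta (shift 2 s) (n - 4)" if "4 \<le> n"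
    using len_zeta[OF assms, of "n - 2"] len_zeta[OF cyc_shift[OF assms], of 2 "n - 4"] that
    by (auto dest: arg_cong[of _ _ len])
  moreover have "bottom_nbrs s n = (if 2 \<le> n then {zeta s (n - 2)} else {}) \<union>
    (if even n \<and> 4 \<le> n then {zeta (shift 2 s) (n - 4)} else {})"
    by (auto simp: bottom_nbrs_def)
  ultimately show ?thesis by auto
qed

lemma bottom_nbrs_finite: "finite (bottom_nbrs s n)"
  by (rule finite_subset[of _ "{zeta s (n - 2), zeta (shift 2 s) (n - 4)}"]) (auto simp: bottom_nbrs_def)

lemma bottom_nbrs_two_desc:
  assumes c: "cyc s" and x: "x \<in> bottom_nbrs s n"
  shows "two_desc (s n) (s (n + 2)) (s (n + 1)) x"
proof -
  from x consider "2 \<le> n" "x = zeta s (n - 2)" | "4 \<le> n" "x = zeta (shift 2 s) (n - 4)"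
    by (auto simp: bottom_nbrs_def)
  then show ?thesis
  proof cases
    case 1
    have "s (n - 2 + 1) = s (n + 2)" by (rule cyc_plus3[OF c]) (use 1 in simp)
    moreover have "n - 2 + 2 = n" "n - 2 + 3 = n + 1" using 1 by simp_all
    ultimately show ?thesis using two_desc_sym[OF zeta_two_desc[OF c, of "n - 2"]] 1 by metis
  next
    case 2
    define m where "m = n - 4"
    have m: "n = m + 4" using 2 by (simp add: m_def)
    have "s (m + 1 + 2) = s (n + 2)" "s (m + 2 + 2) = s n" "s (m + 3 + 2) = s (n + 1)"
      unfolding m by (rule cyc_cong[OF c], presburger)+
    then show ?thesis
      using two_desc_sym[OF zeta_two_desc[OF cyc_shift[OF c], of 2 m]] 2(2) by (simp only: shift_def m_def)
  qed
qed

text \<open>The relation of \<open>W_graph_braid\<close> at \<open>strip s n\<close> expresses the neighbours of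
  \<open>strip s (n + 2)\<close> through those of shorter cyclic words; it is the recurrence
  \<open>h\<^sub>j\<^sub>+\<^sub>1 = h\<^sub>j e\<^sub>1 - h\<^sub>j\<^sub>-\<^sub>1 e\<^sub>2 + h\<^sub>j\<^sub>-\<^sub>2 e\<^sub>3\<close> between complete and elementary symmetric functions.\<close>

lemma mu_strip_bottom:
  assumes c: "cyc s" and "1 \<le> n" and z: "two_desc (s n) (s (n + 2)) (s (n + 1)) z"
  shows "mu z (strip s n) = (if z \<in> bottom_nbrs s n then 1 else 0)"
  using assms(2) z
proof (induction n arbitrary: z rule: less_induct)
  case (less N z)
  show ?case
  proof (cases "N \<le> 4")
    case True
    then show ?thesis using mu_strip_small[OF c] less.prems by blast
  next
    case False
    define n where "n = N - 2"
    have N: "N = n + 2" and n3: "3 \<le> n" using False by (auto simp: n_def)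
    let ?s = "shift 2 s"
    have c': "cyc ?s" by (rule cyc_shift[OF c])
    let ?a = "s (n + 1)" and ?b = "s (n + 2)" and ?w = "strip s n"
    have ab: "?a \<noteq> ?b" and abn: "s n \<noteq> ?a" "s n \<noteq> ?b" using cyc_distinct'[OF c, of n] by auto
    have dist: "distinct [s n, ?a, ?b]" using ab abn by simp
    have e: "s (n + 2 + 1) = s n" "s (n + 2 + 2) = ?a" by (rule cyc_cong[OF c], presburger)+
    have dw: "\<not> desc ?w ?a" "\<not> desc ?w ?b" "desc ?w (s n)" using strip_desc[OF c, of n] n3 by auto
    have z: "two_desc ?b ?a (s n) z" using less.prems(2) unfolding N e .
    have e2: "s (n - 2) = ?a" "s (n - 1) = ?b" by (rule cyc_plus3[OF c], use n3 in simp)+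
    \<comment> \<open>The neighbours whose second descent is \<open>s (m + 1)\<close> reduce by
      \<open>mu_strip_top\<close> to those of \<open>strip s (m - 2)\<close> covered by the
      induction hypothesis.\<close>
    have top: "mu x (strip s m) = (if x \<in> bottom_nbrs s (m - 2) then 1 else 0)"
      if m: "1 \<le> m" "m \<le> n" and x: "two_desc (s m) (s (m + 1)) (s (m + 2)) x" for m x
    proof (cases "3 \<le> m")
      case True
      define j where "j = m - 2"
      have mj: "m = j + 2" and j: "1 \<le> j" using True by (auto simp: j_def)
      have ej: "s (j + 3) = s j" "s (j + 4) = s (j + 1)" by (rule cyc_cong[OF c], presburger)+
      have x1: "two_desc (s (j + 2)) (s (j + 3)) (s (j + 4)) x"
        using x mj by (simp add: numeral_eq_Suc)
      have x2: "two_desc (s j) (s (j + 2)) (s (j + 1)) x" using two_desc_sym[OF x1] unfolding ej .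
      show ?thesis
        using mu_strip_top[OF c j x1] less.IH[of j x] j x2 m N unfolding mj by simp
    next
      case False
      have "mu x (strip s m) = 0"
      proof (rule ccontr)
        assume nz: "mu x (strip s m) \<noteq> 0"
        then show False
        proof (cases rule: mu_neq_zero_cases)
          case 1
          then have "len x < m" using less_affW_len len_strip[OF c] by metis
          then show False using two_desc_len[OF x] False by simp
        next
          case 2
          then have "x = strip s (m + 1)"
            using mu_desc_greater[OF nz two_descD(5)[OF x] strip_desc(1)[OF c]] by simp
          then show False using strip_single_desc[OF c, of "m + 1" "s m"] two_descD[OF x] by simp
        qed
      qed
      moreover have "bottom_nbrs s (m - 2) = {}" using False by (auto simp: bottom_nbrs_def)
      ultimately show ?thesis by simp
    qed
    have bot: "mu x ?w = (if x \<in> bottom_nbrs s n then 1 else 0)" if "two_desc (s n) ?b ?a x" for x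
      using less.IH[of n x] that n3 N by simp
    have below: "x = strip s (n - 1) \<or> desc x (s n)" if "mu x ?w \<noteq> 0" "x < ?w" for x
    proof (cases "desc x (s n)")
      case False
      then have "?w = x * simple (s n)" using mu_desc_greater[of ?w x "s n"] that dw by (simp add: mu_sym)
      then have "x = ?w * simple (s n)" by simp
      also have "\<dots> = strip s (n - 1)" using n3 by (cases n) auto
      finally show ?thesis by simp
    qed simp
    let ?top = "bottom_nbrs s (n - 2)" and ?bot = "bottom_nbrs s n"
    have top_td: "two_desc ?a (s n) ?b x" if "x \<in> ?top" for x
    proof -
      have "n - 2 + 2 = n" "n - 2 + 1 = n - 1" using n3 by simp_all
      then show ?thesis using bottom_nbrs_two_desc[OF c that] e2 by simp
    qed
    have bot_td: "two_desc ?b (s n) ?a x" if "x \<in> ?bot" for x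
      using two_desc_sym[OF bottom_nbrs_two_desc[OF c that]] by simp
    have D1: "D_nbrs ?a ?b ?w = insert (strip s (n + 1)) ?top"
    proof (intro set_eqI iffI)
      fix x assume "x \<in> D_nbrs ?a ?b ?w"
      then have x: "desc x ?a" "\<not> desc x ?b" "mu x ?w \<noteq> 0" by (auto simp: D_nbrs_def in_D_def)
      from x(3) show "x \<in> insert (strip s (n + 1)) ?top"
      proof (cases rule: mu_neq_zero_cases)
        case 1
        have "x \<noteq> strip s (n - 1)" using strip_single_desc[OF c, of "n - 1" ?a] x(1) e2 ab by auto
        then have "desc x (s n)" using below[OF x(3) 1(2)] by simp
        then have "two_desc (s n) ?a ?b x" using x dist by (simp add: two_desc_def)
        then show ?thesis using top[of n x] x(3) n3 by (auto split: if_splits)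
      next
        case 2
        then show ?thesis using mu_desc_greater[OF x(3) x(1) dw(1)] by simp
      qed
    next
      fix x assume "x \<in> insert (strip s (n + 1)) ?top"
      then consider "x = strip s (n + 1)" | "x \<in> ?top" by blast
      then show "x \<in> D_nbrs ?a ?b ?w"
      proof cases
        case 1
        then show ?thesis using strip_in_D(1)[OF c, of "n + 1"] mu_mult_simple[of ?w ?a]
          by (simp add: D_nbrs_def mu_sym)
      next
        case 2
        then show ?thesis using top_td[OF 2] top[of n x] in_D_two_desc(1)[OF top_td[OF 2]]
            two_desc_sym[OF top_td[OF 2]] n3 by (simp add: D_nbrs_def)
      qed
    qed
    have D2: "D_nbrs ?b ?a ?w = insert (strip s (n - 1)) ?bot"
    proof (intro set_eqI iffI)
      fix x assume "x \<in> D_nbrs ?b ?a ?w"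
      then have x: "desc x ?b" "\<not> desc x ?a" "mu x ?w \<noteq> 0" by (auto simp: D_nbrs_def in_D_def)
      from x(3) show "x \<in> insert (strip s (n - 1)) ?bot"
      proof (cases rule: mu_neq_zero_cases)
        case 1
        show ?thesis
        proof (cases "desc x (s n)")
          case True
          then have "two_desc (s n) ?b ?a x" using x dist by (auto simp: two_desc_def)
          then show ?thesis using bot[of x] x(3) by (auto split: if_splits)
        qed (use below[OF x(3) 1(2)] in simp)
      next
        case 2
        then show ?thesis using mu_desc_greater[OF x(3) x(1) dw(2)] zeta_minus2[OF c, of n] n3
          by (simp add: bottom_nbrs_def)
      qed
    next
      fix x assume "x \<in> insert (strip s (n - 1)) ?bot"
      then consider "x = strip s (n - 1)" | "x \<in> ?bot" by blast
      then show "x \<in> D_nbrs ?b ?a ?w"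
      proof cases
        case 1
        have "?w = x * simple (s n)" using n3 1 by (cases n) auto
        moreover have "in_D ?b ?a (strip s (n - 1))"
        proof -
          have "n - 2 + 1 = n - 1" using n3 by simp
          then show ?thesis using strip_in_D(3)[OF c, of "n - 2"] e2 n3 by simp
        qed
        ultimately show ?thesis using mu_mult_simple[of x "s n"] 1 by (simp add: D_nbrs_def)
      next
        case 2
        then show ?thesis using bot[of x] in_D_two_desc(1)[OF bot_td[OF 2]]
            two_desc_sym[OF bot_td[OF 2]] by (simp add: D_nbrs_def)
      qed
    qed
    \<comment> \<open>The star operation lengthens the cyclic word by one letter and multiplies each
      neighbour with two descents by its third generator, which turns \<open>zeta\<close> into
      \<open>tau\<close>. In \<open>sum2\<close> the cyclic word is shortened instead.\<close>
    have sum1: "(\<Sum>x\<in>D_nbrs ?a ?b ?w. mu x ?w * mu z (star ?a ?b x)) =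
      mu z (strip s (n + 2)) + (\<Sum>x\<in>?top. mu z (x * simple ?b))"
    proof -
      have nin: "strip s (n + 1) \<notin> ?top"
        using two_descD(5)[OF top_td] strip_single_desc[OF c, of "n + 1" "s n"] abn by auto
      have "(\<Sum>x\<in>?top. mu x ?w * mu z (star ?a ?b x)) = (\<Sum>x\<in>?top. mu z (x * simple ?b))"
      proof (rule sum.cong)
        fix x assume x: "x \<in> ?top"
        then have "mu x ?w = 1" using top[of n x] two_desc_sym[OF top_td[OF x]] n3 by simp
        then show "mu x ?w * mu z (star ?a ?b x) = mu z (x * simple ?b)"
          using in_D_two_desc(2)[OF top_td[OF x]] by simp
      qed simp
      moreover have "mu (strip s (n + 1)) ?w = 1" using mu_mult_simple[of ?w ?a] by (simp add: mu_sym)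
      moreover have "star ?a ?b (strip s (n + 1)) = strip s (n + 2)"
        using strip_in_D(2)[OF c, of "n + 1"] by (simp add: numeral_eq_Suc)
      ultimately show ?thesis unfolding D1 sum.insert[OF bottom_nbrs_finite nin] by simp
    qed
    have sum2: "(\<Sum>x\<in>D_nbrs ?b ?a ?w. mu x ?w * mu z (star ?b ?a x)) =
      mu z (strip s (n - 2)) + (\<Sum>x\<in>?bot. mu z (x * simple ?a))"
    proof -
      have nin: "strip s (n - 1) \<notin> ?bot"
        using two_descD(5)[OF bot_td] strip_single_desc[OF c, of "n - 1" "s n"] abn e2 by auto
      have "(\<Sum>x\<in>?bot. mu x ?w * mu z (star ?b ?a x)) = (\<Sum>x\<in>?bot. mu z (x * simple ?a))"
      proof (rule sum.cong)
        fix x assume x: "x \<in> ?bot"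
        then have "mu x ?w = 1" using bot[of x] two_desc_sym[OF bot_td[OF x]] by simp
        then show "mu x ?w * mu z (star ?b ?a x) = mu z (x * simple ?a)"
          using in_D_two_desc(2)[OF bot_td[OF x]] by simp
      qed simp
      moreover have "?w = strip s (n - 1) * simple (s n)" using n3 by (cases n) auto
      then have "mu (strip s (n - 1)) ?w = 1" using mu_mult_simple by metis
      moreover have "star ?b ?a (strip s (n - 1)) = strip s (n - 2)"
      proof -
        have "n - 2 + 1 = n - 1" using n3 by simp
        then show ?thesis using strip_in_D(4)[OF c, of "n - 2"] e2 n3 by simp
      qed
      ultimately show ?thesis unfolding D2 sum.insert[OF bottom_nbrs_finite nin] by simp
    qed
    have main: "mu z (strip s (n + 2)) + (\<Sum>x\<in>?top. mu z (x * simple ?b)) =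
      mu z (strip s (n - 2)) + (\<Sum>x\<in>?bot. mu z (x * simple ?a))"
      using W_graph_braid[OF ab dw(1,2), of z] two_descD[OF z] sum1 sum2 by simp
    have t1: "zeta s (n - 2) * simple ?a = tau s (n - 2)"
    proof -
      have "n - 2 + 3 = n + 1" using n3 by simp
      then show ?thesis by (simp only: tau_def)
    qed
    have t2: "zeta ?s (n - 4) * simple ?a = tau ?s (n - 4)" if "4 \<le> n"
    proof -
      have "n - 4 + 3 + 2 = n + 1" using that by simp
      then show ?thesis by (simp only: tau_def shift_def)
    qed
    have t3: "zeta s (n - 2 - 2) * simple ?b = tau s (n - 2 - 2)" if "4 \<le> n"
    proof -
      have "n - 2 - 2 + 3 = n - 1" using that by simp
      then show ?thesis using e2 by (simp only: tau_def)
    qed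
    have t4: "zeta ?s (n - 2 - 4) * simple ?b = tau ?s (n - 4 - 2)" if "6 \<le> n"
    proof -
      have "n - 2 - 4 + 3 + 2 = n - 1" "n - 2 - 4 = n - 4 - 2" using that by simp_all
      then show ?thesis using e2 by (simp only: tau_def shift_def)
    qed
    have bsum: "(\<Sum>x\<in>?bot. mu z (x * simple ?a)) =
      mu z (tau s (n - 2)) + (if even n \<and> 4 \<le> n then mu z (tau ?s (n - 4)) else 0)"
      using sum_bottom_nbrs[OF c, of "\<lambda>x. mu z (x * simple ?a)" n] t1 t2 n3 by simp
    have tsum: "(\<Sum>x\<in>?top. mu z (x * simple ?b)) =
      (if 4 \<le> n then mu z (tau s (n - 2 - 2)) else 0) +
      (if even n \<and> 6 \<le> n then mu z (tau ?s (n - 4 - 2)) else 0)"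
    proof -
      have "2 \<le> n - 2 \<longleftrightarrow> 4 \<le> n" "even (n - 2) \<and> 4 \<le> n - 2 \<longleftrightarrow> even n \<and> 6 \<le> n" using n3 by auto
      then show ?thesis
        using sum_bottom_nbrs[OF c, of "\<lambda>x. mu z (x * simple ?b)" "n - 2"] t3 t4 by simp
    qed
    have z1: "two_desc (s (n - 2 + 3)) (s (n - 2 + 1)) (s (n - 2 + 2)) z"
    proof -
      have "n - 2 + 3 = n + 1" "n - 2 + 1 = n - 1" "n - 2 + 2 = n" using n3 by simp_all
      then show ?thesis using two_desc_sym[OF z] e2 by simp
    qed
    have low: "mu z (strip s (n - 2)) = (if 4 \<le> n - 2 \<and> z = zeta s (n - 2 - 4) then 1 else 0)
      + (if even n \<and> 4 \<le> n - 4 \<and> z = zeta ?s (n - 4 - 4) then 1 else 0)"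
    proof -
      have "two_desc (s (n - 2)) (s (n - 2 + 1)) (s (n - 2 + 2)) z"
      proof -
        have "n - 2 + 1 = n - 1" "n - 2 + 2 = n" using n3 by simp_all
        then show ?thesis using two_desc_sym[OF z] e2 by simp
      qed
      then have "mu z (strip s (n - 2)) = (if z \<in> bottom_nbrs s (n - 2 - 2) then 1 else 0)"
        using top[of "n - 2" z] n3 by simp
      also have "\<dots> = (\<Sum>x\<in>bottom_nbrs s (n - 2 - 2). if x = z then 1 else 0)"
        using bottom_nbrs_finite by simp
      finally show ?thesis
      proof -
        assume eq: "mu z (strip s (n - 2)) = (\<Sum>x\<in>bottom_nbrs s (n - 2 - 2). if x = z then 1 else 0)"
        have idx: "2 \<le> n - 2 - 2 \<longleftrightarrow> 4 \<le> n - 2"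
          "even (n - 2 - 2) \<and> 4 \<le> n - 2 - 2 \<longleftrightarrow> even n \<and> 4 \<le> n - 4"
          "n - 2 - 2 - 2 = n - 2 - 4" "n - 2 - 2 - 4 = n - 4 - 4" by auto
        show ?thesis
          unfolding eq sum_bottom_nbrs[OF c] idx by auto
      qed
    qed
    have r1: "mu z (tau s (n - 2)) + (if 4 \<le> n - 2 \<and> z = zeta s (n - 2 - 4) then 1 else 0) =
      (if z = zeta s n then 1 else 0) + (if 4 \<le> n then mu z (tau s (n - 2 - 2)) else 0)"
    proof -
      have "n - 2 + 2 = n" "2 \<le> n - 2 \<longleftrightarrow> 4 \<le> n" using n3 by auto
      then show ?thesis using mu_tau_recurrence[OF c z1] by simp
    qed
    have r2: "mu z (tau ?s (n - 4)) + (if 4 \<le> n - 4 \<and> z = zeta ?s (n - 4 - 4) then 1 else 0) =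
      (if z = zeta ?s (n - 2) then 1 else 0) + (if 6 \<le> n then mu z (tau ?s (n - 4 - 2)) else 0)"
      if n4: "4 \<le> n"
    proof -
      have "n - 4 + 3 + 2 = n + 1" "n - 4 + 1 + 2 = n - 1" "n - 4 + 2 + 2 = n" using n4 by simp_all
      then have "two_desc (?s (n - 4 + 3)) (?s (n - 4 + 1)) (?s (n - 4 + 2)) z"
        using two_desc_sym[OF z] e2 by (simp only: shift_def)
      moreover have "n - 4 + 2 = n - 2" "2 \<le> n - 4 \<longleftrightarrow> 6 \<le> n" using n4 by auto
      ultimately show ?thesis using mu_tau_recurrence[OF c', of "n - 4" z] by simp
    qed
    \<comment> \<open>Inserting \<open>r1\<close> and \<open>r2\<close> into \<open>main\<close>
      cancels every \<open>tau\<close> term and the two shorter \<open>zeta\<close> terms of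
      \<open>low\<close>; for odd \<open>n\<close> the contributions of \<open>?s\<close> are
      absent.\<close>
    have fin: "mu z (strip s (n + 2)) = (if z = zeta s n then 1 else 0) +
      (if even n \<and> z = zeta ?s (n - 2) then 1 else 0)"
    proof (cases "even n")
      case True
      then have "4 \<le> n" using n3 by presburger
      then show ?thesis using main bsum tsum low r1 r2 True by (simp split: if_splits)
    next
      case False
      then show ?thesis using main bsum tsum low r1 by simp
    qed
    moreover have "zeta s n \<noteq> zeta ?s (n - 2)"
      using len_zeta[OF c, of n] len_zeta[OF c', of "n - 2"] n3 by (auto dest: arg_cong[of _ _ len])
    moreover have "z \<in> bottom_nbrs s N \<longleftrightarrow> z = zeta s n \<or> even n \<and> z = zeta ?s (n - 2)"
      using n3 by (auto simp: bottom_nbrs_def N)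
    ultimately show ?thesis unfolding N by auto
  qed
qed

subsection \<open>The two-sided cells\<close>

text \<open>Unlike membership in \<open>cell1\<close> this holds at \<open>1\<close> as well, so
  that \<open>cell0\<close> is exactly the complement.\<close>

definition uniq_expr :: "affW \<Rightarrow> bool" where
  "uniq_expr w \<longleftrightarrow> (\<exists>!xs. reduced_expr w xs)"

lemma uniq_expr_one: "uniq_expr 1"
  unfolding uniq_expr_def reduced_expr_def by (rule ex1I[of _ "[]"]) auto

lemma cell0_iff: "u \<in> cell0 \<longleftrightarrow> \<not> uniq_expr u"
  using uniq_expr_one by (auto simp: cell0_def cell1_def uniq_expr_def)

lemma reduced_expr_snoc:
  "reduced_expr u (xs @ [a]) \<longleftrightarrow> desc u a \<and> reduced_expr (u * simple a) xs"
proof -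
  have *: "word_val (xs @ [a]) = u \<longleftrightarrow> word_val xs = u * simple a"
    by (simp add: mult_simple_eq_iff)
  show ?thesis
  proof
    assume "reduced_expr u (xs @ [a])"
    then have v: "word_val xs = u * simple a" and l: "Suc (length xs) = len u"
      using * by (auto simp: reduced_expr_def)
    then have "len (u * simple a) \<le> length xs" using len_word_le by metis
    then have d: "desc u a" using l by (simp add: desc_def)
    then show "desc u a \<and> reduced_expr (u * simple a) xs"
      using v l len_desc[OF d] by (simp add: reduced_expr_def)
  next
    assume "desc u a \<and> reduced_expr (u * simple a) xs"
    then show "reduced_expr u (xs @ [a])"
      using * len_desc[of u a] by (auto simp: reduced_expr_def)
  qed
qed

lemma uniq_expr_mult_desc:
  assumes "uniq_expr w" "desc w a" shows "uniq_expr (w * simple a)"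
proof -
  obtain xs where xs: "reduced_expr (w * simple a) xs" using reduced_expr_exists by blast
  have "ys = xs" if "reduced_expr (w * simple a) ys" for ys
  proof -
    have "reduced_expr w (ys @ [a])" "reduced_expr w (xs @ [a])"
      using that xs assms(2) by (simp_all add: reduced_expr_snoc)
    then show ?thesis using assms(1) unfolding uniq_expr_def by blast
  qed
  then show ?thesis using xs unfolding uniq_expr_def by blast
qed

lemma uniq_expr_single_desc:
  assumes "\<And>b. desc u b \<longleftrightarrow> b = a" "uniq_expr (u * simple a)" shows "uniq_expr u"
proof -
  have "\<exists>ys. xs = ys @ [a] \<and> reduced_expr (u * simple a) ys" if xs: "reduced_expr u xs" for xs
  proof (cases xs rule: rev_cases)
    case Nil
    then have "u = 1" using xs by (simp add: reduced_expr_def)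
    then show ?thesis using assms(1)[of a] by simp
  next
    case (snoc ys b)
    then have "desc u b" "reduced_expr (u * simple b) ys" using xs by (simp_all add: reduced_expr_snoc)
    then show ?thesis using assms(1) snoc by auto
  qed
  then show ?thesis using assms(2) reduced_expr_exists[of u] unfolding uniq_expr_def by metis
qed

text \<open>If \<open>u * simple c\<close> had only the descent \<open>a\<close>, induction would
  give \<open>u * simple c * simple a\<close> the descents \<open>c\<close> and \<open>b\<close>;
  climbing back up, \<open>a\<close> would be a descent of \<open>u\<close>.\<close>

lemma cell0_single_desc:
  assumes "\<not> uniq_expr u" "\<And>d. desc u d \<longleftrightarrow> d = c" "distinct [a, b, c]"
  shows "two_desc a b c (u * simple c)"
  using assms
proof (induction "len u" arbitrary: u a b c rule: less_induct)
  case less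
  let ?x = "u * simple c"
  have uc: "desc u c" using less.prems(2) by simp
  have nu: "\<not> uniq_expr ?x" using uniq_expr_single_desc[of u c] less.prems(1,2) by blast
  have xc: "\<not> desc ?x c" using uc by simp
  have one: "two_desc a b c ?x"
    if dist: "distinct [a, b, c]" and xa: "desc ?x a" for a b
  proof (cases "desc ?x b")
    case True
    then show ?thesis using that by (simp add: two_desc_def)
  next
    case False
    have "desc ?x d \<longleftrightarrow> d = a" for d
      using gen_cases[OF dist, of d] False xc xa by auto
    moreover have "len ?x < len u" using uc by (simp add: desc_def)
    moreover have "distinct [c, b, a]" using dist by auto
    ultimately have "two_desc c b a (?x * simple a)" using less.hyps[of ?x a c b] nu by blast
    from two_desc_third_up(4)[OF this] have "two_desc c a b u" by simp
    then have "desc u a" by (simp add: two_desc_def)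
    then show ?thesis using less.prems(2)[of a] dist by simp
  qed
  have "?x \<noteq> 1" using nu uniq_expr_one by metis
  then obtain d where d: "desc ?x d" using exists_desc by blast
  then have "d = a \<or> d = b" using gen_cases[OF less.prems(3), of d] xc by auto
  then show ?case
    using one[of a b] one[of b a] d less.prems(3) two_desc_sym by auto
qed

text \<open>Two consecutive letters determine the sequence; in shorter lists the missing ones are
  chosen distinct.\<close>

lemma cyc_of_list:
  assumes "\<And>i. Suc i < length xs \<Longrightarrow> xs ! i \<noteq> xs ! Suc i"
    "\<And>i. Suc (Suc i) < length xs \<Longrightarrow> xs ! i \<noteq> xs ! Suc (Suc i)"
  shows "\<exists>s. cyc s \<and> (\<forall>i<length xs. xs ! i = s (Suc i))"
proof -
  obtain a b c :: gen where abc: "distinct [a, b, c]"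
    "0 < length xs \<Longrightarrow> xs ! 0 = a" "1 < length xs \<Longrightarrow> xs ! 1 = b"
  proof -
    define a where "a = (if 0 < length xs then xs ! 0 else Gen_r)"
    have "\<exists>b. b \<noteq> a" by (cases a) auto
    then obtain b' where "b' \<noteq> a" by blast
    define b where "b = (if 1 < length xs then xs ! 1 else b')"
    have "a \<noteq> b" using assms(1)[of 0] \<open>b' \<noteq> a\<close> by (auto simp: a_def b_def)
    moreover obtain c where "c \<noteq> a" "c \<noteq> b" by (metis gen.distinct)
    ultimately have "distinct [a, b, c]" by auto
    then show ?thesis using that[of a b c] by (simp add: a_def b_def)
  qed
  define s where "s = (\<lambda>i. [c, a, b] ! (i mod 3))"
  have cyc: "cyc s"
  proof (rule cycI)
    fix i :: nat
    have "i mod 3 = 0 \<or> i mod 3 = 1 \<or> i mod 3 = 2" by presburger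
    then show "s i \<noteq> s (Suc i)" "s i \<noteq> s (Suc (Suc i))"
      using abc(1) by (auto simp: s_def mod_Suc)
  qed
  have "xs ! i = s (Suc i)" if "i < length xs" for i
    using that
  proof (induction i rule: less_induct)
    case (less i)
    consider "i = 0" | "i = 1" | j where "i = Suc (Suc j)" by (metis One_nat_def not0_implies_Suc)
    then show ?case
    proof cases
      case 3
      then have "xs ! j = s (Suc j)" "xs ! Suc j = s (Suc (Suc j))" using less by auto
      then have "xs ! i \<noteq> s (Suc j)" "xs ! i \<noteq> s (Suc (Suc j))"
        using assms(1)[of "Suc j"] assms(2)[of j] less.prems 3 by auto
      moreover have "distinct [s (Suc j), s (Suc (Suc j)), s (Suc (Suc (Suc j)))]"
        using cyc_distinct[OF cyc] by auto
      ultimately show ?thesis using gen_cases[of "s (Suc j)" "s (Suc (Suc j))" "s (Suc (Suc (Suc j)))" "xs ! i"] 3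
        by auto
    qed (use less.prems abc in \<open>auto simp: s_def numeral_2_eq_2\<close>)
  qed
  then show ?thesis using cyc by blast
qed

text \<open>In a unique reduced expression a factor \<open>a a\<close> would cancel, and a factor
  \<open>a b a\<close> could be replaced by \<open>b a b\<close>; so any three consecutive letters
  are distinct.\<close>

lemma uniq_expr_strip:
  assumes "uniq_expr w"
  obtains s where "cyc s" "w = strip s (len w)"
proof -
  obtain xs where xs: "reduced_expr w xs" "\<And>ys. reduced_expr w ys \<Longrightarrow> ys = xs"
    using assms unfolding uniq_expr_def by blast
  have v: "word_val xs = w" "length xs = len w" using xs(1) by (auto simp: reduced_expr_def)
  have id1: "xs = take i xs @ xs ! i # drop (Suc i) xs" if "i < length xs" for i
    using that by (simp add: id_take_nth_drop)
  have 1: "xs ! i \<noteq> xs ! Suc i" if i: "Suc i < length xs" for i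
  proof
    assume eq: "xs ! i = xs ! Suc i"
    have "drop (Suc i) xs = xs ! Suc i # drop (Suc (Suc i)) xs" using i by (simp add: Cons_nth_drop_Suc)
    then have "xs = take i xs @ [xs ! i, xs ! i] @ drop (Suc (Suc i)) xs" using id1[of i] i eq by simp
    then have "w = word_val (take i xs @ drop (Suc (Suc i)) xs)"
      using v(1) by (metis append_Cons append_Nil mult.assoc simple_square(3) word_val_simps(2) word_val_simps(3))
    then have "len w \<le> length (take i xs @ drop (Suc (Suc i)) xs)" using len_word_le by metis
    then show False using v(2) i by simp
  qed
  have 2: "xs ! i \<noteq> xs ! Suc (Suc i)" if i: "Suc (Suc i) < length xs" for i
  proof
    assume eq: "xs ! i = xs ! Suc (Suc i)"
    let ?a = "xs ! i" and ?b = "xs ! Suc i" and ?u = "take i xs" and ?v = "drop (Suc (Suc (Suc i))) xs"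
    have ab: "?a \<noteq> ?b" using 1[of i] i by simp
    have "drop (Suc i) xs = ?b # ?a # ?v" using i eq by (simp add: Cons_nth_drop_Suc)
    then have x: "xs = ?u @ [?a, ?b, ?a] @ ?v" using id1[of i] i by simp
    have "word_val (?u @ [?b, ?a, ?b] @ ?v) = word_val (?u @ [?a, ?b, ?a] @ ?v)"
      using braid[OF ab] by (simp flip: mult.assoc)
    then have "word_val (?u @ [?b, ?a, ?b] @ ?v) = w" using v(1) x by metis
    moreover have "length (?u @ [?b, ?a, ?b] @ ?v) = len w" using v(2) i by simp
    ultimately have "?u @ [?b, ?a, ?b] @ ?v = xs" using xs(2) by (simp add: reduced_expr_def)
    then have "[?b, ?a, ?b] @ ?v = [?a, ?b, ?a] @ ?v" using x by (metis append_same_eq same_append_eq)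
    then show False using ab by simp
  qed
  obtain s where s: "cyc s" "\<And>i. i < length xs \<Longrightarrow> xs ! i = s (Suc i)"
    using cyc_of_list[of xs] 1 2 by blast
  have "xs = map s [1..<Suc (len w)]"
    by (rule nth_equalityI) (use v(2) s(2) in \<open>auto simp del: upt_Suc\<close>)
  then have "w = strip s (len w)" using v(1) strip_word by metis
  then show ?thesis using that s(1) by blast
qed

theorem theorem6p10:
  fixes u w :: affW
  assumes "u < w"
    and "u \<in> cell0"
    and "w \<in> cell1"
    and "card (left_descents u) = 1"
    and "card (right_descents u) = 1"
  shows "KL_mu u w = 0"
proof (rule ccontr)
  assume "KL_mu u w \<noteq> 0"
  then have "mu0 u w \<noteq> 0" using KL_mu_eq[OF assms(1)] by (auto simp: KL_mu_def split: if_splits)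
  then have nz: "mu u w \<noteq> 0" using mu_len_less less_affW_len[OF assms(1)] by metis
  have uw: "\<not> uniq_expr u" "uniq_expr w" "w \<noteq> 1"
    using assms(2,3) by (auto simp: cell0_iff) (auto simp: cell1_def uniq_expr_def)
  obtain s where c: "cyc s" and ws: "w = strip s (len w)" using uniq_expr_strip[OF uw(2)] .
  define n where "n = len w"
  have w: "w = strip s n" using ws n_def by simp
  have n1: "1 \<le> n" using uw(3) len_zero_iff[of w] unfolding n_def by linarith
  have dw: "desc w (s n)" using strip_desc(3)[OF c n1] w by simp
  \<comment> \<open>Otherwise \<open>w\<close> would be \<open>u * simple (s n)\<close> and would
    pass its unique expression on to \<open>u\<close>.\<close>
  have "desc u (s n)"
  proof (rule ccontr)
    assume "\<not> desc u (s n)"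
    then have "w = u * simple (s n)"
      using mu_desc_greater[of w u "s n"] nz dw assms(1) by (simp add: mu_sym)
    then have "uniq_expr u" using uniq_expr_mult_desc[OF uw(2) dw] by simp
    then show False using uw(1) by simp
  qed
  obtain d where "right_descents u = {d}" using assms(5) by (meson card_1_singletonE)
  then have ud: "desc u e \<longleftrightarrow> e = s n" for e
    using \<open>desc u (s n)\<close> unfolding right_descents_eq by (metis mem_Collect_eq singleton_iff)
  define z where "z = u * simple (s n)"
  have uz: "u = z * simple (s n)" by (simp add: z_def)
  have "distinct [s (n + 2), s (n + 1), s n]" using cyc_distinct'[OF c, of n] by auto
  then have z: "two_desc (s (n + 2)) (s (n + 1)) (s n) z"
    using cell0_single_desc[OF uw(1) ud] z_def by blast
  have lu: "len u = Suc (len z)" unfolding uz using two_descD(6)[OF z] by (rule len_not_desc)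
  have lun: "len u < n" using less_affW_len[OF assms(1)] n_def by simp
  define m where "m = n - 1"
  have nm: "n = m + 1" and m1: "1 \<le> m" using lun lu two_desc_len[OF z] by (auto simp: m_def)
  have em: "s (n + 2) = s m" "s (n + 1) = s (m + 2)"
    unfolding nm by (rule cyc_cong[OF c], presburger)+
  have zm: "two_desc (s m) (s (m + 2)) (s (m + 1)) z" using z unfolding em unfolding nm .
  note D = in_D_two_desc[OF zm] and S = strip_in_D[OF c m1]
  \<comment> \<open>One star operation removes the last letter, \<open>s n = s (m + 1)\<close>, from
    both elements.\<close>
  have "mu z (strip s m) = mu u w"
    using mu_star[OF D(3) S(1)] D(4) S(2) by (simp add: uz w nm)
  then have "z \<in> bottom_nbrs s m" using nz mu_strip_bottom[OF c m1 zm] by (auto split: if_splits)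
  then consider "2 \<le> m" "z = zeta s (m - 2)" | "even m" "4 \<le> m" "z = zeta (shift 2 s) (m - 4)"
    by (auto simp: bottom_nbrs_def)
  then show False
  proof cases
    case 1
    \<comment> \<open>\<open>zeta s (m - 2)\<close> is longer than \<open>strip s m\<close>, which
      contradicts \<open>u < w\<close>.\<close>
    then show ?thesis using len_zeta[OF c, of "m - 2"] lu lun nm by simp
  next
    case 2
    let ?s = "shift 2 s"
    have c': "cyc ?s" by (rule cyc_shift[OF c])
    \<comment> \<open>Evenness lets \<open>strip_left\<close> rewrite the exceptional
      \<open>z\<close> so that its left end becomes visible.\<close>
    have "m = 2 * ((m - 4) div 2) + 4" using 2(1,2) by presburger
    then obtain i where i: "m = 2 * i + 4" by blast
    have lz: "len u = 2 * i + 4" using lu 2(3) len_zeta[OF c', of "2 * i"] i by simp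
    \<comment> \<open>The rest of \<open>u\<close> after three letters that form the longest element
      for \<open>?a\<close> and \<open>?b\<close>. Both of these can then start a word of
      \<open>u\<close>, and the bound \<open>lv\<close> shows that cancelling either one shortens
      \<open>u\<close>.\<close>
    define v where "v = strip (shift 2 ?s) (2 * i) * simple (s n)"
    have lv: "len v \<le> 2 * i + 1"
      using len_mult_simple_le[of "strip (shift 2 ?s) (2 * i)" "s n"]
        len_strip[OF cyc_shift[OF c'], of 2 "2 * i"] by (simp add: v_def)
    let ?a = "?s 1" and ?b = "?s 2"
    have ab: "?a \<noteq> ?b" using cyc_distinct(1)[OF c', of 1] by (simp add: numeral_2_eq_2)
    have "strip ?s (2 * i + 2) = simple ?a * simple ?b * strip (shift 2 ?s) (2 * i)"
      using strip_add[of ?s 2 "2 * i"] by (simp add: numeral_2_eq_2)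
    then have "z = simple ?b * (simple ?a * simple ?b * strip (shift 2 ?s) (2 * i))"
      using strip_left(1)[OF c', of i] 2(3) i by simp
    then have u1: "u = simple ?b * simple ?a * simple ?b * v" by (simp add: uz v_def mult.assoc)
    then have u2: "u = simple ?a * simple ?b * simple ?a * v" using braid[OF ab] by simp
    have len2: "len (simple p * simple q * v) < len u" for p q
    proof -
      have le: "len (simple p * x) \<le> Suc (len x)" for p x
        by (metis len_simple_mult_cases le_SucI le_refl lessI less_imp_le_nat)
      show ?thesis using le[of p "simple q * v"] le[of q v] lv lz by (simp add: mult.assoc)
    qed
    have "simple ?b * u = simple ?a * simple ?b * v" unfolding u1 by (simp add: mult.assoc)
    moreover have "simple ?a * u = simple ?b * simple ?a * v" unfolding u2 by (simp add: mult.assoc)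
    ultimately have "?b \<in> left_descents u" "?a \<in> left_descents u"
      using len2[of ?a ?b] len2[of ?b ?a] by (simp_all add: left_descents_def simple_mult_less_iff)
    moreover obtain d where "left_descents u = {d}" using assms(4) by (meson card_1_singletonE)
    ultimately show ?thesis using ab by auto
  qed
qed

end
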